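(* Let $X,Y,c,y_0,Z,Q,b$ be as in the context. The following are equivalent: 1. $b$ satisfies (A3S) (on $Z\times Y$). 2. $c$ satisfies (A3S) (on $X\times Y$). 3. For every smooth surface (embedded submanifold) $S\subseteq X$ of dimension $n$ which is transverse to each $L_x$ that it intersects, the restriction $c|_{S\times Y}$ satisfies (A3S) (on $S\times Y$).
   Context: Let $m\ge n$, and let $X$ and $Y$ be smooth manifolds of dimensions $m$ and $n$, with $Y$ connected, smoothly embedded in larger manifolds in which their closures are compact. Let $c\in C^4(\overline X\times\overline Y)$ satisfy: (A1, twist) for every $x\in X$, $y\mapsto D_xc(x,y)$ is injective on $\overline Y$; (A2, non-degeneracy) $D^2_{xy}c(x,y):T_yY\to T^*_xX$, $\frac{\partial}{\partial y^i}\mapsto \frac{\partial^2c(x,y)}{\partial y^i\partial x^j}dx^j$, is injective for all $x\in X,y\in Y$. $D_xc$, $D_yc$ denote the differentials in $x$ and $y$. Assume that for every $x\in X$ the level set $L_x(y):=\{\overline x\in X: D_yc(\overline x,y)=D_yc(x,y)\}$ is connected and independent of $y\in Y$; write it $L_x$ (an $(m-n)$-dimensional submanifold). Let $Z=X/\!\sim$, where $x\sim\overline x$ iff $\overline x\in L_x$, with quotient map $Q:X\to Z$. Fix $y_0\in Y$. The map $x\mapsto D_yc(x,y_0)$ has the same level sets as $Q$ and is open, so $Z$ is identified with the open subset $D_yc(X,y_0)\subseteq T^*_{y_0}Y$ and $Q$ with $x\mapsto D_yc(x,y_0)$. The function $b:Z\times Y\to\mathbb R$ is defined uniquely by $D_yb(z,y)=D_yc(x,y)$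 for $x\in Q^{-1}(z)$, $y\in Y$, together with $b(z,y_0)=0$. MTW curvature: $c\text{-}exp_x$ denotes the inverse of $y\mapsto D_xc(x,y)$, i.e. $D_xc(x,c\text{-}exp_x(p))=p$ for $p\in D_xc(x,Y)$. For $x\in X$, $y\in Y$, $\mathbf u\in T_xX$, $\mathbf v\in T_yY$, set $\mathbf p=D_xc(x,y)$ and $\mathbf q=D^2_{xy}c(x,y)\cdot\mathbf v\in T^*_xX$; under the present assumptions $\mathbf p+t\mathbf q\in D_xc(x,Y)$ for small $t$. For any smooth curve $\beta$ in $X$ with $\beta(0)=x$, $\beta'(0)=\mathbf u$, $$MTW_{xy}\langle\mathbf u,\mathbf v\rangle:=-\frac32\,\frac{\partial^4}{\partial s^2\partial t^2}\Big|_{s=t=0}c\big(\beta(s),c\text{-}exp_x(\mathbf p+t\mathbf q)\big).$$ $c$ satisfies (A3S) if $MTW_{xy}\langle\mathbf u,\mathbf v\rangle>0$ for all $x\in X$, $y\in Y$, $\mathbf u\in T_xX$, $\mathbf v\in T_yY$ with $\mathbf u\cdot D^2_{xy}c(x,y)\cdot\mathbf v=0$, $\mathbf u\cdot D^2_{xy}c(x,y)\ne0$ and $\mathbf v\neq0$. The same definitions apply to $b$ with $X$ replaced by $Z$, and to $c|_{S\times Y}$ with $X$ replaced by $S$. *)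

theory Defs
  imports "HOL-Analysis.Analysis"
begin

section \<open>Functions of class C^k on open subsets of normed spaces\<close>

primrec C_nat_on ::
  "nat \<Rightarrow> 'a::real_normed_vector set \<Rightarrow> ('a \<Rightarrow> 'b::real_normed_vector) \<Rightarrow> bool" where
  "C_nat_on 0 W f \<longleftrightarrow> continuous_on W f"
| "C_nat_on (Suc k) W f \<longleftrightarrow>
     (\<forall>x\<in>W. f differentiable (at x)) \<and>
     (\<forall>v. C_nat_on k W (\<lambda>x. frechet_derivative f (at x) v))"

text \<open>The class index is an extended natural number: \<open>\<infinity>\<close> means smooth.\<close>

definition C_on ::
  "enat \<Rightarrow> 'a::real_normed_vector set \<Rightarrow> ('a \<Rightarrow> 'b::real_normed_vector) \<Rightarrow> bool" where
  "C_on k W f \<longleftrightarrow> (\<forall>j. enat j \<le> k \<longrightarrow> C_nat_on j W f)"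

section \<open>Smooth manifolds\<close>

text \<open>A manifold is represented by an atlas, i.e. a set of charts \<open>(U, \<phi>)\<close>; its set of points is
  the union of the chart domains, its topology is the one induced by the charts, and its dimension
  is the dimension of the Euclidean space in which the charts take their values.\<close>

type_synonym ('a, 'e) atlas = "('a set \<times> ('a \<Rightarrow> 'e)) set"

definition points :: "('a, 'e) atlas \<Rightarrow> 'a set" where
  "points A = (\<Union>(U, \<phi>)\<in>A. U)"

definition manifold_topology :: "('a, 'e::euclidean_space) atlas \<Rightarrow> 'a topology" where
  "manifold_topology A =
     topology_generated_by {{x \<in> U. \<phi> x \<in> W} | U \<phi> W. (U, \<phi>) \<in> A \<and> open W}"

definition smooth_atlas :: "('a, 'e::euclidean_space) atlas \<Rightarrow> bool" where
  "smooth_atlas A \<longleftrightarrow>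
     (\<forall>(U, \<phi>)\<in>A. inj_on \<phi> U \<and> open (\<phi> ` U)) \<and>
     (\<forall>(U, \<phi>)\<in>A. \<forall>(V, \<psi>)\<in>A.
        open (\<phi> ` (U \<inter> V)) \<and> C_on \<infinity> (\<phi> ` (U \<inter> V)) (\<psi> \<circ> inv_into U \<phi>))"

definition smooth_manifold :: "('a, 'e::euclidean_space) atlas \<Rightarrow> bool" where
  "smooth_manifold A \<longleftrightarrow>
     smooth_atlas A \<and> Hausdorff_space (manifold_topology A) \<and>
     second_countable (manifold_topology A)"

definition product_atlas :: "('a, 'e) atlas \<Rightarrow> ('b, 'f) atlas \<Rightarrow> ('a \<times> 'b, 'e \<times> 'f) atlas" where
  "product_atlas A B =
     {(U \<times> V, map_prod \<phi> \<psi>) | U \<phi> V \<psi>. (U, \<phi>) \<in> A \<and> (V, \<psi>) \<in> B}"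

text \<open>The set of points of \<open>B\<close> is a subset of that of \<open>A\<close> and the inclusion is a smooth embedding:
  a smooth immersion which is a homeomorphism onto its image.\<close>

definition smoothly_embedded ::
  "('a, 'e::euclidean_space) atlas \<Rightarrow> ('a, 'f::euclidean_space) atlas \<Rightarrow> bool" where
  "smoothly_embedded B A \<longleftrightarrow>
     points B \<subseteq> points A \<and>
     manifold_topology B = subtopology (manifold_topology A) (points B) \<and>
     (\<forall>(U, \<phi>)\<in>B. \<forall>(V, \<psi>)\<in>A.
        C_on \<infinity> (\<phi> ` (U \<inter> V)) (\<psi> \<circ> inv_into U \<phi>) \<and>
        (\<forall>w\<in>\<phi> ` (U \<inter> V). inj (frechet_derivative (\<psi> \<circ> inv_into U \<phi>) (at w))))"

section \<open>Functions on manifolds\<close>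

definition C_fun_on ::
  "enat \<Rightarrow> ('a, 'e::euclidean_space) atlas \<Rightarrow> 'a set \<Rightarrow> ('a \<Rightarrow> real) \<Rightarrow> bool" where
  "C_fun_on k A W f \<longleftrightarrow>
     openin (manifold_topology A) W \<and>
     (\<forall>(U, \<phi>)\<in>A. C_on k (\<phi> ` (U \<inter> W)) (f \<circ> inv_into U \<phi>))"

definition C_near ::
  "enat \<Rightarrow> ('a, 'e::euclidean_space) atlas \<Rightarrow> 'a \<Rightarrow> ('a \<Rightarrow> real) \<Rightarrow> bool" where
  "C_near k A p f \<longleftrightarrow> (\<exists>W. p \<in> W \<and> C_fun_on k A W f)"

text \<open>Class C^k on an arbitrary subset \<open>E\<close>: near each point of \<open>E\<close> the function agrees on \<open>E\<close> with
  a C^k function defined on an open set (by partitions of unity, this is the same as having a C^k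
  extension to an open neighbourhood of \<open>E\<close>).\<close>

definition C_on_subset ::
  "enat \<Rightarrow> ('a, 'e::euclidean_space) atlas \<Rightarrow> 'a set \<Rightarrow> ('a \<Rightarrow> real) \<Rightarrow> bool" where
  "C_on_subset k A E f \<longleftrightarrow>
     (\<forall>p\<in>E. \<exists>W g. p \<in> W \<and> C_fun_on k A W g \<and> (\<forall>x\<in>W \<inter> E. g x = f x))"

section \<open>Curves, tangent vectors, differentials\<close>

text \<open>Curves of class C^k near the parameter \<open>0\<close>.\<close>

definition C_curve ::
  "enat \<Rightarrow> ('a, 'e::euclidean_space) atlas \<Rightarrow> (real \<Rightarrow> 'a) \<Rightarrow> bool" where
  "C_curve k A \<gamma> \<longleftrightarrow>
     (\<exists>(U, \<phi>)\<in>A. \<exists>\<epsilon>>0. \<gamma> ` {-\<epsilon><..<\<epsilon>} \<subseteq> U \<and> C_on k {-\<epsilon><..<\<epsilon>} (\<phi> \<circ> \<gamma>))"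

text \<open>A tangent vector at \<open>p\<close> is represented by its action (directional derivative) on the functions
  which are C^1 near \<open>p\<close>. The value \<open>0\<close> on all other functions makes the representation unique, and
  the linear operations on tangent vectors are the pointwise ones.\<close>

type_synonym 'a tangent = "('a \<Rightarrow> real) \<Rightarrow> real"

definition velocity :: "('a, 'e::euclidean_space) atlas \<Rightarrow> (real \<Rightarrow> 'a) \<Rightarrow> 'a tangent" where
  "velocity A \<gamma> = (\<lambda>f. if C_near 1 A (\<gamma> 0) f then deriv (f \<circ> \<gamma>) 0 else 0)"

definition tangent_space :: "('a, 'e::euclidean_space) atlas \<Rightarrow> 'a \<Rightarrow> 'a tangent set" where
  "tangent_space A p = {velocity A \<gamma> | \<gamma>. C_curve 1 A \<gamma> \<and> \<gamma> 0 = p}"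

text \<open>The tangent space at \<open>p\<close> of a submanifold \<open>S\<close> of \<open>A\<close>, as a subspace of the tangent space of
  \<open>A\<close>. The curves are only required to be C^1, since this is applied to the level sets of a cost
  of finite differentiability.\<close>

definition tangent_within ::
  "('a, 'e::euclidean_space) atlas \<Rightarrow> 'a set \<Rightarrow> 'a \<Rightarrow> 'a tangent set" where
  "tangent_within A S p =
     {velocity A \<gamma> | \<gamma>. C_curve 1 A \<gamma> \<and> \<gamma> 0 = p \<and> (\<exists>\<epsilon>>0. \<gamma> ` {-\<epsilon><..<\<epsilon>} \<subseteq> S)}"

definition transverse_at ::
  "('a, 'e::euclidean_space) atlas \<Rightarrow> 'a set \<Rightarrow> 'a set \<Rightarrow> 'a \<Rightarrow> bool" where
  "transverse_at A S L p \<longleftrightarrow>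
     {\<lambda>f. u f + w f | u w. u \<in> tangent_within A S p \<and> w \<in> tangent_within A L p}
       = tangent_space A p"

text \<open>Covectors at \<open>p\<close> are functions on the tangent space at \<open>p\<close>, extended by \<open>0\<close>.\<close>

type_synonym 'a cotangent = "'a tangent \<Rightarrow> real"

definition differential ::
  "('a, 'e::euclidean_space) atlas \<Rightarrow> ('a \<Rightarrow> real) \<Rightarrow> 'a \<Rightarrow> 'a cotangent" where
  "differential A f p = (\<lambda>u. if u \<in> tangent_space A p then u f else 0)"

section \<open>Cost functions\<close>

definition Dx ::
  "('a, 'e::euclidean_space) atlas \<Rightarrow> ('a \<Rightarrow> 'b \<Rightarrow> real) \<Rightarrow> 'a \<Rightarrow> 'b \<Rightarrow> 'a cotangent" where
  "Dx A c x y = differential A (\<lambda>x'. c x' y) x"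

definition Dy ::
  "('b, 'f::euclidean_space) atlas \<Rightarrow> ('a \<Rightarrow> 'b \<Rightarrow> real) \<Rightarrow> 'a \<Rightarrow> 'b \<Rightarrow> 'b cotangent" where
  "Dy B c x y = differential B (\<lambda>y'. c x y') y"

text \<open>The mixed second derivative as a map from tangent vectors at \<open>y\<close> to covectors at \<open>x\<close>;
  \<open>Dxy A c x y v u\<close> is the pairing written \<open>u . D^2_xy c(x,y) . v\<close>.\<close>

definition Dxy ::
  "('a, 'e::euclidean_space) atlas \<Rightarrow> ('a \<Rightarrow> 'b \<Rightarrow> real) \<Rightarrow> 'a \<Rightarrow> 'b \<Rightarrow> 'b tangent \<Rightarrow> 'a cotangent" where
  "Dxy A c x y v =
     (\<lambda>u. if u \<in> tangent_space A x then v (\<lambda>y'. u (\<lambda>x'. c x' y')) else 0)"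

definition twisted ::
  "('a, 'e::euclidean_space) atlas \<Rightarrow> 'b set \<Rightarrow> ('a \<Rightarrow> 'b \<Rightarrow> real) \<Rightarrow> bool" where
  "twisted A Y c \<longleftrightarrow> (\<forall>x\<in>points A. inj_on (Dx A c x) Y)"

definition nondegenerate ::
  "('a, 'e::euclidean_space) atlas \<Rightarrow> ('b, 'f::euclidean_space) atlas \<Rightarrow> ('a \<Rightarrow> 'b \<Rightarrow> real) \<Rightarrow> bool"
  where
  "nondegenerate A B c \<longleftrightarrow>
     (\<forall>x\<in>points A. \<forall>y\<in>points B. inj_on (Dxy A c x y) (tangent_space B y))"

section \<open>The MTW curvature\<close>

definition c_exp ::
  "('a, 'e::euclidean_space) atlas \<Rightarrow> ('b, 'f) atlas \<Rightarrow> ('a \<Rightarrow> 'b \<Rightarrow> real) \<Rightarrow>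
     'a \<Rightarrow> 'a cotangent \<Rightarrow> 'b" where
  "c_exp A B c x = inv_into (points B) (Dx A c x)"

definition MTW_along ::
  "('a, 'e::euclidean_space) atlas \<Rightarrow> ('b, 'f) atlas \<Rightarrow> ('a \<Rightarrow> 'b \<Rightarrow> real) \<Rightarrow>
     'a \<Rightarrow> 'b \<Rightarrow> (real \<Rightarrow> 'a) \<Rightarrow> 'b tangent \<Rightarrow> real" where
  "MTW_along A B c x y \<beta> v =
     - (3 / 2) * (deriv ^^ 2) (\<lambda>s. (deriv ^^ 2) (\<lambda>t.
         c (\<beta> s) (c_exp A B c x (\<lambda>w. Dx A c x y w + t * Dxy A c x y v w))) 0) 0"

text \<open>The curvature is the common value of the above for all smooth curves with velocity \<open>u\<close>.\<close>

definition MTW ::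
  "('a, 'e::euclidean_space) atlas \<Rightarrow> ('b, 'f) atlas \<Rightarrow> ('a \<Rightarrow> 'b \<Rightarrow> real) \<Rightarrow>
     'a \<Rightarrow> 'b \<Rightarrow> 'a tangent \<Rightarrow> 'b tangent \<Rightarrow> real" where
  "MTW A B c x y u v =
     (THE r. \<forall>\<beta>. C_curve \<infinity> A \<beta> \<and> \<beta> 0 = x \<and> velocity A \<beta> = u \<longrightarrow> r = MTW_along A B c x y \<beta> v)"

definition A3S ::
  "('a, 'e::euclidean_space) atlas \<Rightarrow> ('b, 'f::euclidean_space) atlas \<Rightarrow> ('a \<Rightarrow> 'b \<Rightarrow> real) \<Rightarrow> bool"
  where
  "A3S A B c \<longleftrightarrow>
     (\<forall>x\<in>points A. \<forall>y\<in>points B. \<forall>u\<in>tangent_space A x. \<forall>v\<in>tangent_space B y.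
        Dxy A c x y v u = 0 \<and>
        (\<exists>v'\<in>tangent_space B y. Dxy A c x y v' u \<noteq> 0) \<and>
        v \<noteq> (\<lambda>f. 0) \<longrightarrow> MTW A B c x y u v > 0)"

section \<open>The quotient by the level sets and the reduced cost\<close>

definition level_set ::
  "('a, 'e) atlas \<Rightarrow> ('b, 'f::euclidean_space) atlas \<Rightarrow> ('a \<Rightarrow> 'b \<Rightarrow> real) \<Rightarrow> 'a \<Rightarrow> 'b \<Rightarrow> 'a set" where
  "level_set A B c x y = {x' \<in> points A. Dy B c x' y = Dy B c x y}"

definition leaves ::
  "('a, 'e) atlas \<Rightarrow> ('b, 'f::euclidean_space) atlas \<Rightarrow> ('a \<Rightarrow> 'b \<Rightarrow> real) \<Rightarrow> 'b \<Rightarrow> 'a set set" where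
  "leaves A B c y\<^sub>0 =
     points A // {(x, x'). x \<in> points A \<and> x' \<in> level_set A B c x y\<^sub>0}"

definition basis_at ::
  "('b, real ^ 'n) atlas \<Rightarrow> 'b \<Rightarrow> ('n::finite \<Rightarrow> 'b tangent) \<Rightarrow> bool" where
  "basis_at B y e \<longleftrightarrow>
     (\<forall>i. e i \<in> tangent_space B y) \<and>
     (\<forall>v\<in>tangent_space B y. \<exists>!a::real^'n. v = (\<lambda>f. \<Sum>i\<in>UNIV. a $ i * e i f))"

text \<open>The quotient space is identified with a subset of the cotangent space at \<open>y\<^sub>0\<close> by mapping a
  class \<open>z\<close> to the common value of \<open>D_y c(x, y\<^sub>0)\<close> for \<open>x \<in> z\<close>. The charts of the quotient are the
  restrictions of the linear coordinates of the cotangent space, one for each basis of the tangent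
  space.\<close>

definition leaf_covector ::
  "('b, 'f::euclidean_space) atlas \<Rightarrow> ('a \<Rightarrow> 'b \<Rightarrow> real) \<Rightarrow> 'b \<Rightarrow> 'a set \<Rightarrow> 'b cotangent" where
  "leaf_covector B c y\<^sub>0 z = Dy B c (SOME x. x \<in> z) y\<^sub>0"

definition quotient_atlas ::
  "('a, 'e) atlas \<Rightarrow> ('b, real ^ 'n) atlas \<Rightarrow> ('a \<Rightarrow> 'b \<Rightarrow> real) \<Rightarrow> 'b \<Rightarrow>
     ('a set, real ^ 'n::finite) atlas" where
  "quotient_atlas A B c y\<^sub>0 =
     {(leaves A B c y\<^sub>0, \<lambda>z. \<chi> i. leaf_covector B c y\<^sub>0 z (e i)) | e. basis_at B y\<^sub>0 e}"

definition reduced_cost ::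
  "('a, 'e) atlas \<Rightarrow> ('b, 'f::euclidean_space) atlas \<Rightarrow> ('a \<Rightarrow> 'b \<Rightarrow> real) \<Rightarrow> 'b \<Rightarrow>
     ('a set \<Rightarrow> 'b \<Rightarrow> real) \<Rightarrow> bool" where
  "reduced_cost A B c y\<^sub>0 b \<longleftrightarrow>
     (\<forall>z\<in>leaves A B c y\<^sub>0.
        b z y\<^sub>0 = 0 \<and>
        (\<forall>y\<in>points B. C_near 1 B y (b z) \<and> (\<forall>x\<in>z. Dy B b z y = Dy B c x y)))"

end

theory Submission
  imports Defs
begin

text \<open>Since \<open>Y\<close> is connected, \<open>b(Q(x), y) = c(x, y) - c(x, y\<^sub>0)\<close>. Non-degeneracy makes \<open>Q\<close> a submersion,
  so at each \<open>x\<close> the affine curves \<open>p + t q\<close> of covectors for \<open>c\<close> and for \<open>b\<close> are matched by the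
  transpose of \<open>DQ\<close> and have the same exponential \<open>\<gamma>\<close>. The term \<open>c(x, y\<^sub>0)\<close> does not depend on \<open>t\<close>, so
  that \<open>MTW_c(u, v) = MTW_b(DQ u, v)\<close>, and likewise \<open>u . D^2 c . v = (DQ u) . D^2 b . v\<close>. Hence (A3S) for
  \<open>c\<close> at \<open>x\<close> is (A3S) for \<open>b\<close> at \<open>Q(x)\<close>. The same argument applies to any submanifold \<open>S\<close> for which
  \<open>Q\<close> restricted to \<open>S\<close> is a submersion at the point, and for a surface of the dimension of \<open>Y\<close> this
  is transversality to the leaf. Conversely a small affine disc in a chart, complementary to the kernel
  of \<open>DQ\<close>, is a transversal surface through any given point.\<close>

subsection \<open>Calculus of C^k functions\<close>

text \<open>The obstacle is regularity. \<open>Q\<close> is given by a y-derivative of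
  \<open>c\<close>, so it is only C^3, and the image in \<open>Z\<close> of a smooth curve need not
  be smooth, whereas \<open>MTW\<close> is a definite description over smooth curves with a
  prescribed velocity. Before curvatures can be compared, the iterated derivative on
  \<open>Z\<close> must be shown to depend on the curve through its velocity alone, and this already
  for C^2 curves. The means is to write the second t-derivative at 0 as a combination of partial
  derivatives of the local cost at a single point of \<open>Y\<close>, which leaves two derivatives
  in the first variable. The quotient atlas itself is smooth, since its charts are linear
  coordinates of one cotangent space. The transfer of (A3S) rests on the surjectivity of the
  differential of \<open>Q\<close> restricted to the surface: it makes the equations that define the
  two exponentials equivalent, and every tangent vector of \<open>Z\<close> is reached.\<close>

abbreviation frechet :: "('a::real_normed_vector \<Rightarrow> 'b::real_normed_vector) \<Rightarrow> 'a \<Rightarrow> 'a \<Rightarrow> 'b" where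
  "frechet f x \<equiv> frechet_derivative f (at x)"

lemma C_nat_on_has_derivative:
  "C_nat_on (Suc k) W f \<Longrightarrow> x \<in> W \<Longrightarrow> (f has_derivative frechet f x) (at x)"
  by (simp add: frechet_derivative_works)

text \<open>Openness matters: the derivatives are taken \<open>at x\<close>, over a full
  neighbourhood, so it is agreement on an open set that passes to the Frechet derivatives. These
  then serve as the pair of functions in the induction.\<close>

lemma C_nat_on_cong:
  assumes "open W" "\<And>x. x \<in> W \<Longrightarrow> f x = g x" "C_nat_on k W f"
  shows "C_nat_on k W g"
  using assms(2,3)
proof (induction k arbitrary: f g)
  case 0
  then show ?case by (simp cong: continuous_on_cong)
next
  case (Suc k)
  have d: "f differentiable (at x)" if "x \<in> W" for x using Suc.prems(2) that by simp
  have 1: "g differentiable (at x)" if x: "x \<in> W" for x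
  proof -
    have "(f has_derivative frechet f x) (at x)"
      using d[OF x] by (simp add: frechet_derivative_works)
    then have "(g has_derivative frechet f x) (at x)"
      by (rule has_derivative_transform_within_open[OF _ assms(1) x Suc.prems(1)])
    then show ?thesis by (auto simp: differentiable_def)
  qed
  have 2: "frechet f x v = frechet g x v" if "x \<in> W" for x v
    using frechet_derivative_transform_within_open[OF d[OF that] assms(1) that Suc.prems(1)] by simp
  have "C_nat_on k W (\<lambda>x. frechet g x v)" for v
    by (rule Suc.IH[where f="\<lambda>x. frechet f x v"]) (use 2 Suc.prems in auto)
  then show ?case using 1 by simp
qed

text \<open>\<open>frechet_derivative\<close> is a choice term; this rule raises the class by one
  from an explicit derivative, and most closure properties below are inductions through it.\<close>

lemma C_nat_on_SucI:
  assumes "open W" "\<And>x. x \<in> W \<Longrightarrow> (f has_derivative f' x) (at x)"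
    "\<And>v. C_nat_on k W (\<lambda>x. f' x v)"
  shows "C_nat_on (Suc k) W f"
proof -
  have "C_nat_on k W (\<lambda>x. frechet f x v)" for v
    by (rule C_nat_on_cong[OF assms(1) _ assms(3)]) (simp flip: frechet_derivative_at[OF assms(2)])
  then show ?thesis using assms(2) by (auto simp: differentiable_def)
qed

lemma C_nat_on_subset: "C_nat_on k W f \<Longrightarrow> V \<subseteq> W \<Longrightarrow> C_nat_on k V f"
  by (induction k arbitrary: f) (auto intro: continuous_on_subset)

lemma C_nat_on_Suc_lower: "C_nat_on (Suc k) W f \<Longrightarrow> C_nat_on k W f"
proof (induction k arbitrary: f)
  case 0
  then show ?case
    by (auto intro!: continuous_at_imp_continuous_on differentiable_imp_continuous_within)
next
  case (Suc k)
  then show ?case by (metis C_nat_on.simps(2))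
qed

lemma C_nat_on_mono:
  assumes "C_nat_on k W f" "j \<le> k"
  shows "C_nat_on j W f"
  using assms(2,1) by (induction rule: inc_induct) (auto intro: C_nat_on_Suc_lower simp del: C_nat_on.simps)

lemma C_nat_on_imp_continuous_on: "C_nat_on k W f \<Longrightarrow> continuous_on W f"
  using C_nat_on_mono[of k W f 0] by simp

lemma C_on_enat: "C_on (enat k) W f \<longleftrightarrow> C_nat_on k W f"
  by (auto simp: C_on_def intro: C_nat_on_mono)

lemma C_on_infinity: "C_on \<infinity> W f \<longleftrightarrow> (\<forall>k. C_nat_on k W f)"
  by (auto simp: C_on_def)

lemma C_on_subset: "C_on k W f \<Longrightarrow> V \<subseteq> W \<Longrightarrow> C_on k V f"
  by (auto simp: C_on_def intro: C_nat_on_subset)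

lemma C_on_cong:
  "open W \<Longrightarrow> (\<And>x. x \<in> W \<Longrightarrow> f x = g x) \<Longrightarrow> C_on k W f \<Longrightarrow> C_on k W g"
  by (auto simp: C_on_def intro: C_nat_on_cong)

lemma C_nat_on_local:
  assumes "\<And>x. x \<in> W \<Longrightarrow> \<exists>V. open V \<and> x \<in> V \<and> C_nat_on k V f"
  shows "C_nat_on k W f"
  using assms
proof (induction k arbitrary: f)
  case 0
  have "continuous (at x) f" if "x \<in> W" for x
    using 0[OF that] by (auto simp: continuous_on_eq_continuous_at)
  then show ?case by (simp add: continuous_at_imp_continuous_on)
next
  case (Suc k)
  have "C_nat_on k W (\<lambda>x. frechet f x v)" for v
    by (rule Suc.IH) (use Suc.prems in fastforce)
  then show ?case using Suc.prems by fastforce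
qed

lemma C_on_local:
  assumes "\<And>x. x \<in> W \<Longrightarrow> \<exists>V. open V \<and> x \<in> V \<and> C_on k V f"
  shows "C_on k W f"
  unfolding C_on_def
proof (intro allI impI)
  fix j assume "enat j \<le> k"
  then show "C_nat_on j W f"
    by (intro C_nat_on_local) (use assms in \<open>unfold C_on_def, blast\<close>)
qed

lemma C_nat_on_const [simp]: "C_nat_on k W (\<lambda>x. a)"
  by (induction k arbitrary: a) auto

lemma C_nat_on_bounded_linear: "bounded_linear L \<Longrightarrow> open W \<Longrightarrow> C_nat_on k W L"
proof (cases k)
  case (Suc j)
  assume L: "bounded_linear L" "open W"
  show ?thesis unfolding Suc
    by (rule C_nat_on_SucI[OF L(2) bounded_linear_imp_has_derivative[OF L(1)]]) simp
qed (simp add: linear_continuous_on)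

lemma C_nat_on_ident: "open W \<Longrightarrow> C_nat_on k W (\<lambda>x. x)"
  by (rule C_nat_on_bounded_linear) (rule bounded_linear_ident)

lemma C_nat_on_bounded_linear_compose:
  assumes L: "bounded_linear L" and "open W" "C_nat_on k W f"
  shows "C_nat_on k W (\<lambda>x. L (f x))"
  using assms(3)
proof (induction k arbitrary: f)
  case 0
  then show ?case using L by (auto intro: bounded_linear.continuous_on)
next
  case (Suc k)
  show ?case
    by (rule C_nat_on_SucI[OF assms(2)
          bounded_linear.has_derivative[OF L C_nat_on_has_derivative[OF Suc.prems]]],
        assumption, rule Suc.IH)
      (use Suc.prems in simp)
qed

lemma C_nat_on_add:
  assumes "open W" "C_nat_on k W f" "C_nat_on k W g"
  shows "C_nat_on k W (\<lambda>x. f x + g x)"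
  using assms(2,3)
proof (induction k arbitrary: f g)
  case 0
  then show ?case by (auto intro: continuous_on_add)
next
  case (Suc k)
  show ?case
    by (rule C_nat_on_SucI[OF assms(1)
          has_derivative_add[OF C_nat_on_has_derivative[OF Suc.prems(1)] C_nat_on_has_derivative[OF Suc.prems(2)]]],
        assumption, assumption, rule Suc.IH)
      (use Suc.prems in simp_all)
qed

lemma C_nat_on_sum:
  assumes "open W" "\<And>i. i \<in> I \<Longrightarrow> C_nat_on k W (f i)"
  shows "C_nat_on k W (\<lambda>x. \<Sum>i\<in>I. f i x)"
  using assms(2) by (induction I rule: infinite_finite_induct) (auto intro: C_nat_on_add assms(1))

lemma C_nat_on_uminus: "open W \<Longrightarrow> C_nat_on k W f \<Longrightarrow> C_nat_on k W (\<lambda>x. - f x)"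
  by (rule C_nat_on_bounded_linear_compose) (auto intro: bounded_linear_minus bounded_linear_ident)

lemma C_nat_on_diff:
  "open W \<Longrightarrow> C_nat_on k W f \<Longrightarrow> C_nat_on k W g \<Longrightarrow> C_nat_on k W (\<lambda>x. f x - g x)"
  using C_nat_on_add[of W k f "\<lambda>x. - g x"] by (simp add: C_nat_on_uminus)

lemma C_nat_on_bilinear:
  assumes P: "bounded_bilinear P" and "open W" "C_nat_on k W f" "C_nat_on k W g"
  shows "C_nat_on k W (\<lambda>x. P (f x) (g x))"
  using assms(3,4)
proof (induction k arbitrary: f g)
  case 0
  then show ?case using P by (auto intro: bounded_bilinear.continuous_on)
next
  case (Suc k)
  note l = Suc.prems[THEN C_nat_on_Suc_lower]
  have d: "C_nat_on k W (\<lambda>x. frechet f x v)"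
    "C_nat_on k W (\<lambda>x. frechet g x v)" for v
    using Suc.prems by simp_all
  show ?case
    by (rule C_nat_on_SucI[OF assms(2)
          bounded_bilinear.FDERIV[OF P C_nat_on_has_derivative[OF Suc.prems(1)] C_nat_on_has_derivative[OF Suc.prems(2)]]])
      (assumption, assumption, intro C_nat_on_add Suc.IH assms(2) l d)
qed

lemma C_nat_on_scaleR:
  "open W \<Longrightarrow> C_nat_on k W f \<Longrightarrow> C_nat_on k W g \<Longrightarrow> C_nat_on k W (\<lambda>x. f x *\<^sub>R g x)"
  by (rule C_nat_on_bilinear[OF bounded_bilinear_scaleR])

lemma C_nat_on_mult:
  fixes f g :: "'a::real_normed_vector \<Rightarrow> real"
  shows "open W \<Longrightarrow> C_nat_on k W f \<Longrightarrow> C_nat_on k W g \<Longrightarrow> C_nat_on k W (\<lambda>x. f x * g x)"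
  by (rule C_nat_on_bilinear[OF bounded_bilinear_mult])

lemma C_nat_on_inner_left:
  "open W \<Longrightarrow> C_nat_on k W f \<Longrightarrow> C_nat_on k W (\<lambda>x. f x \<bullet> b)"
  by (rule C_nat_on_bounded_linear_compose[OF bounded_linear_inner_left])

lemma C_nat_on_prod:
  fixes f :: "'i \<Rightarrow> 'a::real_normed_vector \<Rightarrow> real"
  assumes "open W" "\<And>i. i \<in> I \<Longrightarrow> C_nat_on k W (f i)"
  shows "C_nat_on k W (\<lambda>x. \<Prod>i\<in>I. f i x)"
  using assms(2) by (induction I rule: infinite_finite_induct) (auto intro: C_nat_on_mult assms(1))

lemma C_nat_on_inverse:
  fixes f :: "'a::real_normed_vector \<Rightarrow> real"
  assumes "open W" "\<And>x. x \<in> W \<Longrightarrow> f x \<noteq> 0" "C_nat_on k W f"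
  shows "C_nat_on k W (\<lambda>x. inverse (f x))"
  using assms(3)
proof (induction k)
  case 0
  then show ?case using assms by (auto intro: continuous_on_inverse)
next
  case (Suc k)
  have I: "C_nat_on k W (\<lambda>x. inverse (f x))" by (rule Suc.IH[OF C_nat_on_Suc_lower[OF Suc.prems]])
  have d: "C_nat_on k W (\<lambda>x. frechet f x v)" for v
    using Suc.prems by simp
  show ?case
    by (rule C_nat_on_SucI[OF assms(1)
          Deriv.has_derivative_inverse[OF assms(2) C_nat_on_has_derivative[OF Suc.prems]]])
      (assumption, assumption, intro C_nat_on_uminus C_nat_on_mult I assms(1) d)
qed

lemma C_nat_on_vec:
  fixes f :: "'a::real_normed_vector \<Rightarrow> real ^ 'n"
  assumes "open W" "\<And>i. C_nat_on k W (\<lambda>x. f x $ i)"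
  shows "C_nat_on k W f"
proof -
  have "(\<Sum>i\<in>UNIV. f x $ i *\<^sub>R (axis i 1 :: real ^ 'n)) = f x" for x
    by (auto simp: vec_eq_iff axis_def if_distrib cong: if_cong)
  moreover have "C_nat_on k W (\<lambda>x. \<Sum>i\<in>UNIV. f x $ i *\<^sub>R (axis i 1 :: real ^ 'n))"
    by (intro C_nat_on_sum C_nat_on_scaleR assms C_nat_on_const)
  ultimately show ?thesis by simp
qed

lemma C_nat_on_nth: 
  fixes f :: "'a::real_normed_vector \<Rightarrow> real ^ 'n"
  shows "open W \<Longrightarrow> C_nat_on k W f \<Longrightarrow> C_nat_on k W (\<lambda>x. f x $ i)"
  by (rule C_nat_on_bounded_linear_compose[OF bounded_linear_vec_nth])

lemma C_nat_on_Pair: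
  assumes "open W" "C_nat_on k W f" "C_nat_on k W g"
  shows "C_nat_on k W (\<lambda>x. (f x, g x))"
proof -
  have "C_nat_on k W (\<lambda>x. (\<lambda>u. (u, 0)) (f x) + (\<lambda>u. (0, u)) (g x))"
    by (intro C_nat_on_add C_nat_on_bounded_linear_compose[OF bounded_linear_Pair] assms
        bounded_linear_ident bounded_linear_zero
        C_nat_on_bounded_linear_compose[of "\<lambda>u. (u, 0)"] C_nat_on_bounded_linear_compose[of "\<lambda>u. (0,u)"])
  then show ?thesis by simp
qed

lemma linear_sum_Basis:
  fixes L :: "'a::euclidean_space \<Rightarrow> 'b::real_vector"
  assumes "linear L"
  shows "L v = (\<Sum>b\<in>Basis. (v \<bullet> b) *\<^sub>R L b)"
proof -
  have "L v = L (\<Sum>b\<in>Basis. (v \<bullet> b) *\<^sub>R b)" by (simp add: euclidean_representation)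
  also have "\<dots> = (\<Sum>b\<in>Basis. (v \<bullet> b) *\<^sub>R L b)" using assms by (simp add: linear_sum linear_cmul)
  finally show ?thesis .
qed

lemma frechet_sum_Basis:
  fixes f :: "'a::euclidean_space \<Rightarrow> 'b::real_normed_vector"
  assumes "f differentiable (at x)"
  shows "frechet f x v = (\<Sum>b\<in>Basis. (v \<bullet> b) *\<^sub>R frechet f x b)"
  by (rule linear_sum_Basis[OF linear_frechet_derivative[OF assms]])

text \<open>In the chain rule the direction \<open>Dg(x) v\<close> moves with \<open>x\<close>,
  while \<open>C_nat_on\<close> controls derivatives in fixed directions only. Expanding the
  direction in \<open>Basis\<close> separates the two dependences; this is why the middle space is
  Euclidean. The induction generalises over \<open>f\<close>, since \<open>g\<close> merely drops a
  class.\<close>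

lemma C_nat_on_compose:
  fixes f :: "'b::euclidean_space \<Rightarrow> 'c::real_normed_vector"
    and g :: "'a::real_normed_vector \<Rightarrow> 'b"
  assumes "open W" "C_nat_on k V f" "C_nat_on k W g" "g ` W \<subseteq> V"
  shows "C_nat_on k W (\<lambda>x. f (g x))"
  using assms(2,3)
proof (induction k arbitrary: f)
  case 0
  then show ?case using assms(4) by (auto intro: continuous_on_compose2)
next
  case (Suc k)
  have g: "g x \<in> V" if "x \<in> W" for x using that assms(4) by auto
  have df: "f differentiable (at (g x))" if "x \<in> W" for x using g[OF that] Suc.prems(1) by simp
  show ?case
  proof (rule C_nat_on_SucI[OF assms(1)])
    show "((\<lambda>x. f (g x)) has_derivative
       (\<lambda>v. \<Sum>b\<in>Basis. (frechet g x v \<bullet> b) *\<^sub>R frechet f (g x) b)) (at x)"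
      if x: "x \<in> W" for x
    proof -
      have "((\<lambda>x. f (g x)) has_derivative
       (\<lambda>v. frechet f (g x) (frechet g x v))) (at x)"
        using diff_chain_at[OF C_nat_on_has_derivative[OF Suc.prems(2) x] C_nat_on_has_derivative[OF Suc.prems(1) g[OF x]]]
        by (simp add: o_def)
      then show ?thesis by (simp add: frechet_sum_Basis[OF df[OF x], symmetric])
    qed
    fix v
    have "C_nat_on k W (\<lambda>x. frechet f (g x) b)" for b
      using Suc.prems(1) by (intro Suc.IH C_nat_on_Suc_lower[OF Suc.prems(2)]) simp
    moreover have "C_nat_on k W (\<lambda>x. frechet g x v)"
      using Suc.prems by simp
    ultimately show "C_nat_on k W (\<lambda>x. \<Sum>b\<in>Basis. (frechet g x v \<bullet> b) *\<^sub>R frechet f (g x) b)"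
      by (intro C_nat_on_sum C_nat_on_scaleR C_nat_on_inner_left assms(1))
  qed
qed

lemma C_on_compose:
  fixes f :: "'b::euclidean_space \<Rightarrow> 'c::real_normed_vector"
    and g :: "'a::real_normed_vector \<Rightarrow> 'b"
  shows "open W \<Longrightarrow> C_on k V f \<Longrightarrow> C_on k W g \<Longrightarrow> g ` W \<subseteq> V \<Longrightarrow> C_on k W (\<lambda>x. f (g x))"
  unfolding C_on_def by (blast intro: C_nat_on_compose)

lemma C_nat_on_det:
  fixes A :: "'a::real_normed_vector \<Rightarrow> real ^ 'n ^ 'n"
  assumes "open W" "\<And>i j. C_nat_on k W (\<lambda>x. A x $ i $ j)"
  shows "C_nat_on k W (\<lambda>x. det (A x))"
  unfolding det_def
  by (intro C_nat_on_sum C_nat_on_mult C_nat_on_prod assms C_nat_on_const)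

text \<open>\<open>inverse_function_theorem\<close> gives a differentiable local inverse
  \<open>g\<close>; its class is bootstrapped from \<open>Dg(y) = Df(g y)^-1\<close>. If
  \<open>g\<close> is C^j, so are the entries of the matrix \<open>A\<close> of
  \<open>Df(g y)\<close>, and Cramer's rule expresses \<open>Dg\<close> rationally through them,
  hence \<open>g\<close> is C^(j+1). The process ends at \<open>Suc k\<close> because
  \<open>Df\<close> is of class \<open>k\<close>.\<close>

lemma C_inverse_function:
  fixes f :: "real ^ 'k \<Rightarrow> real ^ 'k"
  assumes f: "C_nat_on (Suc k) U f" and U: "open U" "x0 \<in> U"
    and inj: "inj (frechet f x0)"
  obtains U' V g where "open U'" "U' \<subseteq> U" "x0 \<in> U'" "open V" "f x0 \<in> V" "homeomorphism U' V f g"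
    "C_nat_on (Suc k) V g" "\<And>x. x \<in> U' \<Longrightarrow> bij (frechet f x)"
proof -
  define f' where "f' = (\<lambda>x. Blinfun (frechet f x))"
  have hd: "(f has_derivative frechet f x) (at x)" if "x \<in> U" for x
    using C_nat_on_has_derivative[OF f that] .
  have bl: "blinfun_apply (f' x) = frechet f x" if "x \<in> U" for x
    unfolding f'_def using hd[OF that] by (intro bounded_linear_Blinfun_apply has_derivative_bounded_linear)
  have cont: "continuous_on U f'"
  proof (rule continuous_on_blinfun_componentwise)
    fix i :: "real ^ 'k"
    have "C_nat_on k U (\<lambda>x. frechet f x i)" using f by simp
    then have "continuous_on U (\<lambda>x. frechet f x i)"
      by (rule C_nat_on_imp_continuous_on)
    then show "continuous_on U (\<lambda>x. blinfun_apply (f' x) i)"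
      by (rule continuous_on_eq) (simp add: bl)
  qed
  have lin0: "linear (frechet f x0)"
    by (rule has_derivative_linear[OF hd[OF U(2)]])
  obtain h where h: "linear h" "h \<circ> frechet f x0 = id"
    using linear_injective_left_inverse[OF lin0 inj] by blast
  have inv: "Blinfun h o\<^sub>L f' x0 = id_blinfun"
  proof (rule blinfun_eqI)
    fix i
    have "blinfun_apply (Blinfun h) = h"
      using h(1) by (intro bounded_linear_Blinfun_apply) (simp add: linear_conv_bounded_linear)
    then show "blinfun_apply (Blinfun h o\<^sub>L f' x0) i = blinfun_apply id_blinfun i"
      using h(2) by (simp add: bl[OF U(2)] fun_eq_iff)
  qed
  have hd': "(f has_derivative blinfun_apply (f' x)) (at x)" if "x \<in> U" for x
    using hd[OF that] bl[OF that] by simp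
  obtain U' V g g' where g: "open U'" "U' \<subseteq> U" "x0 \<in> U'" "open V" "f x0 \<in> V" "homeomorphism U' V f g"
    and gd: "\<And>y. y \<in> V \<Longrightarrow> (g has_derivative (g' y)) (at y)"
    and g': "\<And>y. y \<in> V \<Longrightarrow> g' y = inv (blinfun_apply (f' (g y)))"
    and bij: "\<And>y. y \<in> V \<Longrightarrow> bij (blinfun_apply (f' (g y)))"
    by (rule inverse_function_theorem[OF U(1) hd' cont U(2) inv]) (assumption | rule that)+
  have gU: "g y \<in> U'" if "y \<in> V" for y using homeomorphism_image2[OF g(6)] that by blast
  define A where "A = (\<lambda>y. matrix (frechet f (g y)))"
  have A_nth: "A y $ i $ j = frechet f (g y) (axis j 1) $ i" for y i j
    by (simp add: A_def matrix_def)
  have bijA: "bij (frechet f (g y))" if "y \<in> V" for y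
    using bij[OF that] bl[OF subsetD[OF g(2) gU[OF that]]] by simp
  have linA: "linear (frechet f (g y))" if "y \<in> V" for y
    using has_derivative_linear[OF hd[OF subsetD[OF g(2) gU[OF that]]]] .
  have Av: "A y *v w = frechet f (g y) w" if "y \<in> V" for y w
    unfolding A_def using linA[OF that] by (simp add: matrix_works)
  have detA: "det (A y) \<noteq> 0" if "y \<in> V" for y
  proof -
    show ?thesis unfolding A_def using bij_is_inj[OF bijA[OF that]] det_nz_iff_inj[OF linA[OF that]] by simp
  qed
  have cr: "g' y w = (\<chi> k. det (\<chi> i j. if j = k then w $ i else A y $ i $ j) / det (A y))" if y: "y \<in> V" for y w
  proof -
    have "g' y w = inv (frechet f (g y)) w"
      using g'[OF y] bl[OF subsetD[OF g(2) gU[OF y]]] by simp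
    then have "A y *v g' y w = w"
      unfolding Av[OF y] using bijA[OF y] by (simp add: bij_is_surj surj_f_inv_f)
    then show ?thesis using cramer[OF detA[OF y]] by blast
  qed
  have "C_nat_on j V g" if "j \<le> Suc k" for j
    using that
  proof (induction j)
    case 0
    then show ?case using g(6) by (simp add: homeomorphism_def)
  next
    case (Suc j)
    then have gj: "C_nat_on j V g" by simp
    have "C_nat_on j U (\<lambda>x. frechet f x w)" for w
      using f Suc.prems by (auto intro: C_nat_on_mono)
    then have e: "C_nat_on j V (\<lambda>y. frechet f (g y) w)" for w
      using gU g(2) by (intro C_nat_on_compose[OF g(4) _ gj]) auto
    then have Aj: "C_nat_on j V (\<lambda>y. A y $ a $ b)" for a b
      unfolding A_nth by (rule C_nat_on_nth[OF g(4)])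
    have "C_nat_on j V (\<lambda>y. g' y w)" for w
    proof (rule C_nat_on_cong[OF g(4)])
      show "(\<chi> k. det (\<chi> i j. if j = k then w $ i else A y $ i $ j) * inverse (det (A y))) = g' y w" if "y \<in> V" for y
        using cr[OF that] by (simp add: divide_inverse)
      have "C_nat_on j V (\<lambda>y. if b then w $ a else A y $ a $ d)" for b a d
        using Aj by (cases b) auto
      then show "C_nat_on j V (\<lambda>y. \<chi> k. det (\<chi> i j. if j = k then w $ i else A y $ i $ j) * inverse (det (A y)))"
        by (intro C_nat_on_vec[OF g(4)])
         (simp, intro C_nat_on_mult C_nat_on_det C_nat_on_inverse g(4) Aj detA, simp_all)
    qed
    then show ?case by (intro C_nat_on_SucI[OF g(4) gd])
  qed
  moreover have "bij (frechet f x)" if "x \<in> U'" for x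
    using bijA[of "f x"] homeomorphism_apply1[OF g(6) that] homeomorphism_image1[OF g(6)] that by auto
  ultimately show ?thesis using that[OF g] by blast
qed

section \<open>Derivatives along curves and the symmetry of second derivatives\<close>

lemma has_real_derivative_along_curve:
  fixes f :: "'a::real_normed_vector \<Rightarrow> real"
  assumes "(f has_derivative D) (at (\<gamma> s))" "(\<gamma> has_vector_derivative v) (at s)"
  shows "((\<lambda>s. f (\<gamma> s)) has_real_derivative D v) (at s)"
proof -
  have l: "linear D" using assms(1) has_derivative_linear by blast
  have "((\<lambda>s. f (\<gamma> s)) has_derivative (\<lambda>x. D (x *\<^sub>R v))) (at s)"
    using diff_chain_at[OF assms(2)[unfolded has_vector_derivative_def] assms(1)] by (simp add: o_def)
  then show ?thesis
    by (simp add: has_field_derivative_def linear_cmul[OF l] mult.commute[of _ "D v"])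
qed

text \<open>The mean value theorem is applied twice: to the increment of \<open>f\<close> in
  direction \<open>w\<close> as a function of \<open>s\<close>, then to the derivative in direction
  \<open>v\<close> as a function of \<open>t\<close>. The second difference on the left is symmetric
  in \<open>v\<close> and \<open>w\<close>, the right side is not visibly so.\<close>

lemma second_difference_mvt:
  fixes f :: "'a::real_normed_vector \<Rightarrow> real"
  assumes f: "C_nat_on 2 W f" and h: "0 < h"
    and W: "\<And>s t. 0 \<le> s \<Longrightarrow> s \<le> h \<Longrightarrow> 0 \<le> t \<Longrightarrow> t \<le> h \<Longrightarrow> x + s *\<^sub>R v + t *\<^sub>R w \<in> W"
  obtains s t where "0 < s" "s < h" "0 < t" "t < h"
    "f (x + h *\<^sub>R v + h *\<^sub>R w) - f (x + h *\<^sub>R v) - f (x + h *\<^sub>R w) + f x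
      = h * h * frechet (\<lambda>y. frechet f y v) (x + s *\<^sub>R v + t *\<^sub>R w) w"
proof -
  let ?D = "\<lambda>y. frechet f y"
  let ?E = "\<lambda>y. frechet (\<lambda>y. ?D y v) y"
  have f1: "(f has_derivative ?D y) (at y)" if "y \<in> W" for y
    using f that by (intro C_nat_on_has_derivative[of 1]) (auto simp: numeral_2_eq_2)
  have f2: "((\<lambda>y. ?D y v) has_derivative ?E y) (at y)" if "y \<in> W" for y
    using f that by (intro C_nat_on_has_derivative[of 0]) (auto simp: numeral_2_eq_2)
  have l: "((\<lambda>s. a + s *\<^sub>R u + b) has_vector_derivative u) (at s)" for a b u :: 'a and s
    by (auto intro!: derivative_eq_intros simp: has_vector_derivative_def)
  have l': "((\<lambda>s. a + s *\<^sub>R u) has_vector_derivative u) (at s)" for a u :: 'a and s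
    using l[of a u 0 s] by simp
  have "\<exists>s. 0 < s \<and> s < h \<and>
    (f (x + h *\<^sub>R v + h *\<^sub>R w) - f (x + h *\<^sub>R v)) - (f (x + 0 *\<^sub>R v + h *\<^sub>R w) - f (x + 0 *\<^sub>R v))
     = (h - 0) * (?D (x + s *\<^sub>R v + h *\<^sub>R w) v - ?D (x + s *\<^sub>R v) v)"
  proof (rule MVT2[OF h])
    fix s assume s: "0 \<le> s" "s \<le> h"
    have "((\<lambda>s. f (x + s *\<^sub>R v + h *\<^sub>R w)) has_real_derivative ?D (x + s *\<^sub>R v + h *\<^sub>R w) v) (at s)"
      by (rule has_real_derivative_along_curve[OF f1 l]) (use W[OF s, of h] h in auto)
    moreover have "((\<lambda>s. f (x + s *\<^sub>R v)) has_real_derivative ?D (x + s *\<^sub>R v) v) (at s)"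
      by (rule has_real_derivative_along_curve[OF f1 l']) (use W[OF s, of 0] h in auto)
    ultimately show "((\<lambda>s. f (x + s *\<^sub>R v + h *\<^sub>R w) - f (x + s *\<^sub>R v)) has_real_derivative
       ?D (x + s *\<^sub>R v + h *\<^sub>R w) v - ?D (x + s *\<^sub>R v) v) (at s)"
      by (rule DERIV_diff)
  qed
  then obtain s where s: "0 < s" "s < h" and
    es: "(f (x + h *\<^sub>R v + h *\<^sub>R w) - f (x + h *\<^sub>R v)) - (f (x + h *\<^sub>R w) - f x)
     = h * (?D (x + s *\<^sub>R v + h *\<^sub>R w) v - ?D (x + s *\<^sub>R v) v)" by auto
  have "\<exists>t. 0 < t \<and> t < h \<and> ?D (x + s *\<^sub>R v + h *\<^sub>R w) v - ?D (x + s *\<^sub>R v + 0 *\<^sub>R w) v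
     = (h - 0) * ?E (x + s *\<^sub>R v + t *\<^sub>R w) w"
  proof (rule MVT2[OF h])
    fix t assume t: "0 \<le> t" "t \<le> h"
    show "((\<lambda>t. ?D (x + s *\<^sub>R v + t *\<^sub>R w) v) has_real_derivative ?E (x + s *\<^sub>R v + t *\<^sub>R w) w) (at t)"
      by (rule has_real_derivative_along_curve[OF f2 l']) (use W[of s t] t s in auto)
  qed
  then obtain t where t: "0 < t" "t < h" and
    et: "?D (x + s *\<^sub>R v + h *\<^sub>R w) v - ?D (x + s *\<^sub>R v) v = h * ?E (x + s *\<^sub>R v + t *\<^sub>R w) w" by auto
  show ?thesis
    by (rule that[OF s t]) (use es et in \<open>simp add: algebra_simps\<close>)
qed

text \<open>The same second difference is \<open>h * h\<close> times either mixed derivative, each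
  at some point of a small parallelogram; continuity of both mixed derivatives at \<open>x\<close>
  then forces equality.\<close>

lemma mixed_derivatives_commute:
  fixes f :: "'a::real_normed_vector \<Rightarrow> real"
  assumes W: "open W" and f: "C_nat_on 2 W f" and x: "x \<in> W"
  shows "frechet (\<lambda>y. frechet f y v) x w
       = frechet (\<lambda>y. frechet f y w) x v"
proof (rule ccontr)
  let ?P = "\<lambda>v w y. frechet (\<lambda>y. frechet f y v) y w"
  assume neq: "?P v w x \<noteq> ?P w v x"
  \<comment> \<open>Half the gap: two numbers within \<open>e\<close> of the two derivatives at
    \<open>x\<close> cannot coincide.\<close>
  define e where "e = \<bar>?P v w x - ?P w v x\<bar> / 2"
  have e: "0 < e" using neq by (simp add: e_def)
  have cont: "continuous_on W (?P v w)" for v w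
    using f by (simp add: numeral_2_eq_2)
  obtain d0 where d0: "0 < d0" "ball x d0 \<subseteq> W" using W x open_contains_ball by blast
  have "\<exists>d>0. \<forall>y\<in>W. dist y x < d \<longrightarrow> dist (?P v w y) (?P v w x) < e" for v w
    using cont[of v w] x e unfolding continuous_on_iff by blast
  then obtain d1 d2 where d1: "0 < d1" "\<And>y. y\<in>W \<Longrightarrow> dist y x < d1 \<Longrightarrow> dist (?P v w y) (?P v w x) < e"
    and d2: "0 < d2" "\<And>y. y\<in>W \<Longrightarrow> dist y x < d2 \<Longrightarrow> dist (?P w v y) (?P w v x) < e"
    by metis
  define d where "d = min d0 (min d1 d2)"
  \<comment> \<open>This size keeps the whole parallelogram within distance \<open>d\<close> of
    \<open>x\<close>; the summand 1 guards against \<open>v = w = 0\<close>.\<close>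
  define h where "h = d / (norm v + norm w + 1)"
  have dpos: "0 < d" using d0 d1 d2 by (simp add: d_def)
  have npos: "0 < norm v + norm w + 1" by (simp add: add_nonneg_pos)
  have h: "0 < h" using dpos npos by (simp add: h_def)
  have close: "dist (x + s *\<^sub>R v + t *\<^sub>R w) x < d" if "0 \<le> s" "s \<le> h" "0 \<le> t" "t \<le> h" for s t
  proof -
    have "dist (x + s *\<^sub>R v + t *\<^sub>R w) x = norm (s *\<^sub>R v + t *\<^sub>R w)" by (simp add: dist_norm add.assoc)
    also have "\<dots> \<le> s * norm v + t * norm w" using norm_triangle_ineq[of "s *\<^sub>R v" "t *\<^sub>R w"] that by simp
    also have "\<dots> \<le> h * norm v + h * norm w" using that by (intro add_mono mult_right_mono) auto
    also have "\<dots> < h * (norm v + norm w + 1)" using h by (simp add: algebra_simps)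
    also have "\<dots> = d" using npos by (simp add: h_def)
    finally show ?thesis .
  qed
  have inW: "x + s *\<^sub>R v + t *\<^sub>R w \<in> W" if "0 \<le> s" "s \<le> h" "0 \<le> t" "t \<le> h" for s t
    using close[OF that] d0(2) by (auto simp: d_def dist_commute)
  obtain s t where st: "0 < s" "s < h" "0 < t" "t < h"
    "f (x + h *\<^sub>R v + h *\<^sub>R w) - f (x + h *\<^sub>R v) - f (x + h *\<^sub>R w) + f x
      = h * h * ?P v w (x + s *\<^sub>R v + t *\<^sub>R w)"
    by (rule second_difference_mvt[OF f h inW]) auto
  have inW': "x + s *\<^sub>R w + t *\<^sub>R v \<in> W" if "0 \<le> s" "s \<le> h" "0 \<le> t" "t \<le> h" for s t
    using inW[of t s] that by (simp add: algebra_simps)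
  obtain s' t' where st': "0 < s'" "s' < h" "0 < t'" "t' < h"
    "f (x + h *\<^sub>R w + h *\<^sub>R v) - f (x + h *\<^sub>R w) - f (x + h *\<^sub>R v) + f x
      = h * h * ?P w v (x + s' *\<^sub>R w + t' *\<^sub>R v)"
    by (rule second_difference_mvt[OF f h inW']) auto
  let ?y = "x + s *\<^sub>R v + t *\<^sub>R w" and ?z = "x + t' *\<^sub>R v + s' *\<^sub>R w"
  have z: "x + s' *\<^sub>R w + t' *\<^sub>R v = ?z" by (simp add: algebra_simps)
  have "f (x + h *\<^sub>R w + h *\<^sub>R v) = f (x + h *\<^sub>R v + h *\<^sub>R w)" by (simp add: algebra_simps)
  then have "h * h * ?P v w ?y = h * h * ?P w v ?z"
    using st(5) st'(5) unfolding z by linarith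
  then have eq: "?P v w ?y = ?P w v ?z" using h by simp
  have "dist (?P v w ?y) (?P v w x) < e"
    using close[of s t] inW[of s t] st by (intro d1(2)) (auto simp: d_def)
  moreover have "dist (?P w v ?z) (?P w v x) < e"
    using close[of t' s'] inW[of t' s'] st' by (intro d2(2)) (auto simp: d_def)
  ultimately show False unfolding eq e_def dist_real_def by (auto simp: abs_if split: if_splits)
qed

section \<open>Iterated derivatives in one real variable\<close>

lemma deriv_eq_on_open:
  assumes "open T" "t \<in> T" "\<And>t. t \<in> T \<Longrightarrow> f t = g t"
  shows "deriv f t = deriv g t"
  using assms by (intro deriv_cong_ev) (auto simp: eventually_nhds)

lemma deriv2_eq_on_open:
  assumes "open T" "t \<in> T" "\<And>t. t \<in> T \<Longrightarrow> f t = g t"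
  shows "(deriv ^^ 2) f t = (deriv ^^ 2) g t"
  using assms deriv_eq_on_open[of T _ f g] by (auto simp: numeral_2_eq_2 intro!: deriv_eq_on_open[of T])

text \<open>Adding a constant does not change which numbers are derivatives, so the two choices made
  by \<open>deriv\<close> coincide even where \<open>f\<close> is not differentiable. The terms
  independent of \<open>t\<close> can thus be dropped from curvatures unconditionally.\<close>

lemma deriv_add_const: "deriv (\<lambda>t. f t + a) t = deriv f t" for f :: "real \<Rightarrow> real"
proof -
  have "((\<lambda>t. f t + a) has_real_derivative D) (at t) \<longleftrightarrow> (f has_real_derivative D) (at t)" for D
    using DERIV_add[of "\<lambda>t. f t + a" D t UNIV "\<lambda>_. - a" 0] DERIV_add[of f D t UNIV "\<lambda>_. a" 0] by auto
  then show ?thesis by (simp add: deriv_def)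
qed

lemma deriv2_add_const: "(deriv ^^ 2) (\<lambda>t. f t + a) t = (deriv ^^ 2) f t" for f :: "real \<Rightarrow> real"
proof -
  have "deriv (\<lambda>t. f t + a) = deriv f" by (rule ext) (rule deriv_add_const)
  then show ?thesis by (simp add: numeral_2_eq_2)
qed

text \<open>The result separates a term linear in the acceleration of \<open>\<gamma>\<close> from
  one quadratic in its velocity. At a critical point of \<open>f\<close> the first vanishes and only
  the velocity matters.\<close>

lemma deriv2_compose:
  fixes f :: "'a::euclidean_space \<Rightarrow> real" and \<gamma> :: "real \<Rightarrow> 'a"
  assumes f: "C_nat_on 2 W f" and T: "open T" "0 \<in> T" and \<gamma>: "C_nat_on 2 T \<gamma>" "\<gamma> ` T \<subseteq> W"
  shows "(deriv ^^ 2) (\<lambda>t. f (\<gamma> t)) 0 =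
    frechet f (\<gamma> 0) (frechet (\<lambda>t. frechet \<gamma> t 1) 0 1)
    + (\<Sum>i\<in>Basis. \<Sum>j\<in>Basis. (frechet \<gamma> 0 1 \<bullet> i) * (frechet \<gamma> 0 1 \<bullet> j)
        * frechet (\<lambda>x. frechet f x i) (\<gamma> 0) j)"
proof -
  define g where "g = (\<lambda>t. frechet \<gamma> t 1)"
  define g' where "g' = frechet g 0 1"
  let ?D = "\<lambda>x. frechet f x"
  let ?E = "\<lambda>i x. frechet (\<lambda>y. ?D y i) x"
  have fd: "f differentiable (at x)" if "x \<in> W" for x using f that by (simp add: numeral_2_eq_2)
  have f1: "(f has_derivative ?D x) (at x)" if "x \<in> W" for x
    using fd[OF that] by (simp add: frechet_derivative_works)
  have fd2: "(\<lambda>y. ?D y i) differentiable (at x)" if "x \<in> W" for x i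
    using f that by (simp add: numeral_2_eq_2)
  have f2: "((\<lambda>y. ?D y i) has_derivative ?E i x) (at x)" if "x \<in> W" for x i
    using fd2[OF that] by (simp add: frechet_derivative_works)
  have vd: "(h has_vector_derivative frechet h t 1) (at t)"
    if "h differentiable (at t)" for h :: "real \<Rightarrow> 'a" and t
    using that by (simp add: frechet_derivative_eq_vector_derivative vector_derivative_works[symmetric])
  have g1: "(\<gamma> has_vector_derivative g t) (at t)" if "t \<in> T" for t
    using \<gamma> that unfolding g_def by (intro vd) (simp add: numeral_2_eq_2)
  have g2: "(g has_vector_derivative g') (at 0)"
    using \<gamma>(1) T(2) unfolding g'_def by (intro vd) (simp add: numeral_2_eq_2 g_def)
  have in_W: "\<gamma> t \<in> W" if "t \<in> T" for t using \<gamma>(2) that by auto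
  have d1: "deriv (\<lambda>t. f (\<gamma> t)) t = (\<Sum>i\<in>Basis. (g t \<bullet> i) * ?D (\<gamma> t) i)" if "t \<in> T" for t
    using DERIV_imp_deriv[OF has_real_derivative_along_curve[OF f1[OF in_W[OF that]] g1[OF that]]]
      frechet_sum_Basis[OF fd[OF in_W[OF that]], of "g t"] by simp
  have s: "((\<lambda>t. (g t \<bullet> i) * ?D (\<gamma> t) i) has_real_derivative
      ((g' \<bullet> i) * ?D (\<gamma> 0) i + (g 0 \<bullet> i) * ?E i (\<gamma> 0) (g 0))) (at 0)" for i
  proof -
    have "((\<lambda>t. g t \<bullet> i) has_real_derivative g' \<bullet> i) (at 0)"
      by (rule has_real_derivative_along_curve[OF _ g2])
        (rule bounded_linear_imp_has_derivative[OF bounded_linear_inner_left])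
    from DERIV_mult[OF this has_real_derivative_along_curve[OF f2[OF in_W[OF T(2)]] g1[OF T(2)], of i]]
    show ?thesis by (simp add: algebra_simps)
  qed
  have "(deriv ^^ 2) (\<lambda>t. f (\<gamma> t)) 0 = deriv (deriv (\<lambda>t. f (\<gamma> t))) 0" by (simp add: numeral_2_eq_2)
  also have "\<dots> = deriv (\<lambda>t. \<Sum>i\<in>Basis. (g t \<bullet> i) * ?D (\<gamma> t) i) 0"
    by (rule deriv_eq_on_open[OF T d1])
  also have "\<dots> = (\<Sum>i\<in>Basis. (g' \<bullet> i) * ?D (\<gamma> 0) i + (g 0 \<bullet> i) * ?E i (\<gamma> 0) (g 0))"
    by (rule DERIV_imp_deriv[OF DERIV_sum[OF s]])
  also have "\<dots> = ?D (\<gamma> 0) g' + (\<Sum>i\<in>Basis. (g 0 \<bullet> i) * ?E i (\<gamma> 0) (g 0))"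
    using frechet_sum_Basis[OF fd[OF in_W[OF T(2)]], of g'] by (simp add: sum.distrib)
  also have "(\<Sum>i\<in>Basis. (g 0 \<bullet> i) * ?E i (\<gamma> 0) (g 0)) =
     (\<Sum>i\<in>Basis. \<Sum>j\<in>Basis. (g 0 \<bullet> i) * (g 0 \<bullet> j) * ?E i (\<gamma> 0) j)"
    by (subst frechet_sum_Basis[OF fd2[OF in_W[OF T(2)]], of _ "g 0"]) (simp add: sum_distrib_left mult.assoc)
  finally show ?thesis unfolding g'_def g_def .
qed

lemma C_on_imp_continuous_on: "C_on k W f \<Longrightarrow> continuous_on W f"
  unfolding C_on_def by (metis C_nat_on.simps(1) zero_enat_def zero_le)

subsection \<open>Atlases\<close>

text \<open>Smooth dependence of the charts of \<open>A\<close> on the charts of \<open>B\<close>: for \<open>A = B\<close> this is the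
  compatibility condition of a smooth atlas, in general it says that the inclusion of the points of
  \<open>B\<close> is smooth.\<close>

definition smooth_transitions ::
  "('a, 'e::euclidean_space) atlas \<Rightarrow> ('a, 'f::euclidean_space) atlas \<Rightarrow> bool" where
  "smooth_transitions B A \<longleftrightarrow> (\<forall>U \<phi> V \<psi>. (U, \<phi>) \<in> B \<longrightarrow> (V, \<psi>) \<in> A \<longrightarrow>
     open (\<phi> ` (U \<inter> V)) \<and> C_on \<infinity> (\<phi> ` (U \<inter> V)) (\<psi> \<circ> inv_into U \<phi>))"

lemma smooth_atlas_iff:
  "smooth_atlas A \<longleftrightarrow> (\<forall>U \<phi>. (U, \<phi>) \<in> A \<longrightarrow> inj_on \<phi> U) \<and> smooth_transitions A A"
  unfolding smooth_atlas_def smooth_transitions_def by (force simp: Ball_def)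

lemma smooth_atlasD:
  assumes "smooth_atlas A" "(U, \<phi>) \<in> A"
  shows "inj_on \<phi> U" "open (\<phi> ` U)"
  using assms unfolding smooth_atlas_def by auto

lemma smooth_transitionsD:
  assumes "smooth_transitions B A" "(U, \<phi>) \<in> B" "(V, \<psi>) \<in> A"
  shows "open (\<phi> ` (U \<inter> V))" "C_on \<infinity> (\<phi> ` (U \<inter> V)) (\<psi> \<circ> inv_into U \<phi>)"
  using assms unfolding smooth_transitions_def by blast+

lemma smooth_transitions_refl: "smooth_atlas A \<Longrightarrow> smooth_transitions A A"
  by (simp add: smooth_atlas_iff)

lemma topspace_manifold [simp]: "topspace (manifold_topology A) = points A"
proof -
  let ?S = "{{x \<in> U. \<phi> x \<in> W} | U \<phi> W. (U, \<phi>) \<in> A \<and> open W}"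
  have "U \<in> ?S" if "(U, \<phi>) \<in> A" for U \<phi>
  proof -
    have "U = {x \<in> U. \<phi> x \<in> UNIV} \<and> (U, \<phi>) \<in> A \<and> open (UNIV :: 'b set)" using that by simp
    then show ?thesis by blast
  qed
  then have "points A \<subseteq> \<Union>?S" unfolding points_def by (intro subsetI) (elim UN_E, clarify, erule UnionI[rotated])
  moreover have "\<Union>?S \<subseteq> points A" unfolding points_def by auto
  ultimately show ?thesis
    unfolding manifold_topology_def topology_generated_by_topspace by (rule equalityI[rotated])
qed

lemma pointsI: "(U, \<phi>) \<in> A \<Longrightarrow> x \<in> U \<Longrightarrow> x \<in> points A"
  by (auto simp: points_def)

lemma pointsE: assumes "x \<in> points A" obtains U \<phi> where "(U, \<phi>) \<in> A" "x \<in> U"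
  using assms by (auto simp: points_def)

lemma openin_chart_preimage:
  assumes "(U, \<phi>) \<in> A" "open W"
  shows "openin (manifold_topology A) {x \<in> U. \<phi> x \<in> W}"
  unfolding manifold_topology_def by (rule topology_generated_by_Basis) (use assms in blast)

lemma openin_chart_domain: "(U, \<phi>) \<in> A \<Longrightarrow> openin (manifold_topology A) U"
  using openin_chart_preimage[of U \<phi> A UNIV] by simp

lemma open_preimage_within:
  assumes "open T" "continuous_on T f" "open W"
  shows "open {t \<in> T. f t \<in> W}"
proof -
  have "{t \<in> T. f t \<in> W} = T \<inter> f -` W" by auto
  then show ?thesis using continuous_open_preimage[OF assms(2,1,3)] by simp
qed

text \<open>Induction over the generation of the topology: injectivity of \<open>\<phi>\<close>
  makes the image commute with intersections, and a generating set of another chart is reached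
  through the continuous transition map.\<close>

lemma open_chart_image:
  assumes A: "smooth_atlas A" and G: "openin (manifold_topology A) G" and ch: "(U, \<phi>) \<in> A"
  shows "open (\<phi> ` (U \<inter> G))"
proof -
  have inj: "inj_on \<phi> U" using smooth_atlasD[OF A ch] by simp
  have "generate_topology_on {{x \<in> U. \<phi> x \<in> W} | U \<phi> W. (U, \<phi>) \<in> A \<and> open W} G"
    using G unfolding manifold_topology_def by (rule openin_topology_generated_by)
  then show ?thesis
  proof induction
    case (Int a b)
    have "\<phi> ` (U \<inter> (a \<inter> b)) = \<phi> ` (U \<inter> a) \<inter> \<phi> ` (U \<inter> b)"
      using inj by (auto simp: inj_on_def)
    then show ?case using Int by (auto intro: open_Int)
  next
    case (UN K)
    have "\<phi> ` (U \<inter> \<Union>K) = (\<Union>k\<in>K. \<phi> ` (U \<inter> k))" by auto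
    then show ?case using UN by auto
  next
    case (Basis s)
    then obtain V \<psi> W where s: "s = {x \<in> V. \<psi> x \<in> W}" "(V, \<psi>) \<in> A" "open W" by blast
    note t = smooth_transitionsD[OF smooth_transitions_refl[OF A] ch s(2)]
    have "continuous_on (\<phi> ` (U \<inter> V)) (\<psi> \<circ> inv_into U \<phi>)"
      by (rule C_on_imp_continuous_on[OF t(2)])
    moreover have "\<phi> ` (U \<inter> s) = {t \<in> \<phi> ` (U \<inter> V). (\<psi> \<circ> inv_into U \<phi>) t \<in> W}"
      using inj by (auto simp: s(1))
    ultimately show ?case using open_preimage_within[OF t(1) _ s(3)] by simp
  qed simp
qed

text \<open>One chart suffices. \<open>C_fun_on\<close> quantifies over all charts of the atlas, but
  on the preimage of \<open>T\<close> the function in any other chart is a transition map followed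
  by its expression in \<open>\<phi>\<close>.\<close>

lemma C_near_iff:
  assumes A: "smooth_atlas A" and ch: "(U, \<phi>) \<in> A" and p: "p \<in> U"
  shows "C_near k A p f \<longleftrightarrow> (\<exists>T. open T \<and> \<phi> p \<in> T \<and> T \<subseteq> \<phi> ` U \<and> C_on k T (f \<circ> inv_into U \<phi>))"
    (is "_ = ?R")
proof
  assume "C_near k A p f"
  then obtain W where W: "p \<in> W" "openin (manifold_topology A) W" "C_on k (\<phi> ` (U \<inter> W)) (f \<circ> inv_into U \<phi>)"
    unfolding C_near_def C_fun_on_def using ch by blast
  then show ?R using open_chart_image[OF A W(2) ch] p by blast
next
  assume ?R
  then obtain T where T: "open T" "\<phi> p \<in> T" "T \<subseteq> \<phi> ` U" "C_on k T (f \<circ> inv_into U \<phi>)" by blast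
  define W where "W = {x \<in> U. \<phi> x \<in> T}"
  have W: "openin (manifold_topology A) W" unfolding W_def by (rule openin_chart_preimage[OF ch T(1)])
  have inj: "inj_on \<phi> U" using smooth_atlasD[OF A ch] by simp
  have "C_on k (\<psi> ` (V \<inter> W)) (f \<circ> inv_into V \<psi>)" if ch': "(V, \<psi>) \<in> A" for V \<psi>
  proof -
    have inj': "inj_on \<psi> V" using smooth_atlasD[OF A ch'] by simp
    have o: "open (\<psi> ` (V \<inter> W))" by (rule open_chart_image[OF A W ch'])
    have "C_on \<infinity> (\<psi> ` (V \<inter> U)) (\<phi> \<circ> inv_into V \<psi>)"
      by (rule smooth_transitionsD[OF smooth_transitions_refl[OF A] ch' ch])
    then have "C_on k (\<psi> ` (V \<inter> W)) (\<phi> \<circ> inv_into V \<psi>)"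
      by (rule_tac C_on_subset[of _ "\<psi> ` (V \<inter> U)"]) (auto simp: C_on_def W_def)
    then have "C_on k (\<psi> ` (V \<inter> W)) (\<lambda>t. (f \<circ> inv_into U \<phi>) ((\<phi> \<circ> inv_into V \<psi>) t))"
      by (rule C_on_compose[OF o T(4)]) (use inj' in \<open>auto simp: W_def\<close>)
    then show ?thesis
      by (rule C_on_cong[OF o, rotated]) (use inj inj' in \<open>auto simp: W_def\<close>)
  qed
  then have "C_fun_on k A W f" unfolding C_fun_on_def using W by auto
  then show "C_near k A p f" unfolding C_near_def using T(2) p by (intro exI[of _ W]) (simp add: W_def)
qed

text \<open>\<open>f\<close> and \<open>g\<close> have to agree only on the points of
  \<open>B\<close> within \<open>W\<close>. This covers both the restriction of functions on
  \<open>X\<close> to a surface and the passage from a local extension of the cost in the ambient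
  manifolds to the cost on \<open>X\<close> and \<open>Y\<close>.\<close>

lemma C_near_transfer:
  assumes A: "smooth_atlas A" and B: "smooth_atlas B" and t: "smooth_transitions B A"
    and p: "p \<in> points A" "p \<in> points B"
    and W: "p \<in> W" "C_fun_on k A W g" "\<And>x. x \<in> W \<Longrightarrow> x \<in> points B \<Longrightarrow> g x = f x"
  shows "C_near k B p f"
proof -
  obtain U \<phi> where ch: "(U, \<phi>) \<in> B" "p \<in> U" using p(2) by (rule pointsE)
  obtain V \<psi> where ch': "(V, \<psi>) \<in> A" "p \<in> V" using p(1) by (rule pointsE)
  have inj: "inj_on \<phi> U" "inj_on \<psi> V" using smooth_atlasD[OF B ch(1)] smooth_atlasD[OF A ch'(1)] by auto
  have o: "open (\<psi> ` (V \<inter> W))" and g: "C_on k (\<psi> ` (V \<inter> W)) (g \<circ> inv_into V \<psi>)"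
    using W(2) ch'(1) open_chart_image[OF A _ ch'(1)] unfolding C_fun_on_def by auto
  note tt = smooth_transitionsD[OF t ch(1) ch'(1)]
  define T where "T = {s \<in> \<phi> ` (U \<inter> V). (\<psi> \<circ> inv_into U \<phi>) s \<in> \<psi> ` (V \<inter> W)}"
  have T: "open T"
    unfolding T_def by (rule open_preimage_within[OF tt(1) C_on_imp_continuous_on[OF tt(2)] o])
  have "C_on k T (\<psi> \<circ> inv_into U \<phi>)"
    by (rule C_on_subset[of _ "\<phi> ` (U \<inter> V)"]) (use tt in \<open>auto simp: C_on_def T_def\<close>)
  then have "C_on k T (\<lambda>s. (g \<circ> inv_into V \<psi>) ((\<psi> \<circ> inv_into U \<phi>) s))"
    by (rule C_on_compose[OF T g]) (auto simp: T_def)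
  then have "C_on k T (f \<circ> inv_into U \<phi>)"
  proof (rule C_on_cong[OF T, rotated])
    fix s assume "s \<in> T"
    then obtain x where x: "x \<in> U" "x \<in> V" "s = \<phi> x" "\<psi> x \<in> \<psi> ` (V \<inter> W)" using inj by (auto simp: T_def)
    then have "x \<in> W" using inj by (auto dest: inj_onD)
    then show "(g \<circ> inv_into V \<psi>) ((\<psi> \<circ> inv_into U \<phi>) s) = (f \<circ> inv_into U \<phi>) s"
      using x inj W(3) pointsI[OF ch(1)] by simp
  qed
  moreover have "\<phi> p \<in> T" using ch ch' W(1) inj by (auto simp: T_def)
  ultimately show ?thesis using C_near_iff[OF B ch] T by (auto simp: T_def)
qed

lemma C_near_mono: "C_near k A p f \<Longrightarrow> j \<le> k \<Longrightarrow> C_near j A p f"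
  unfolding C_near_def C_fun_on_def C_on_def using order_trans by fastforce

section \<open>Products of atlases and embedded submanifolds\<close>

lemma product_atlas_image:
  "map_prod \<phi> \<psi> ` ((U \<times> V) \<inter> (U' \<times> V')) = \<phi> ` (U \<inter> U') \<times> \<psi> ` (V \<inter> V')"
  by (force simp: map_prod_def image_iff)

lemma inv_into_map_prod:
  assumes "inj_on \<phi> U" "inj_on \<psi> V" "s \<in> \<phi> ` U" "t \<in> \<psi> ` V"
  shows "inv_into (U \<times> V) (map_prod \<phi> \<psi>) (s, t) = (inv_into U \<phi> s, inv_into V \<psi> t)"
proof (rule inv_into_f_eq)
  show "inj_on (map_prod \<phi> \<psi>) (U \<times> V)" using assms by (intro map_prod_inj_on)
qed (use assms in \<open>auto simp: inv_into_into f_inv_into_f\<close>)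

lemma smooth_transitions_product:
  assumes t: "smooth_transitions B A" "smooth_transitions B' A'"
    and inj: "\<And>U \<phi>. (U, \<phi>) \<in> B \<Longrightarrow> inj_on \<phi> U" "\<And>U \<phi>. (U, \<phi>) \<in> B' \<Longrightarrow> inj_on \<phi> U"
  shows "smooth_transitions (product_atlas B B') (product_atlas A A')"
  unfolding smooth_transitions_def
proof (intro allI impI)
  fix W \<theta> W' \<theta>' assume "(W, \<theta>) \<in> product_atlas B B'" "(W', \<theta>') \<in> product_atlas A A'"
  then obtain U \<phi> V \<psi> U' \<phi>' V' \<psi>' where 1: "W = U \<times> V" "\<theta> = map_prod \<phi> \<psi>" "(U, \<phi>) \<in> B" "(V, \<psi>) \<in> B'"
    and 2: "W' = U' \<times> V'" "\<theta>' = map_prod \<phi>' \<psi>'" "(U', \<phi>') \<in> A" "(V', \<psi>') \<in> A'"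
    unfolding product_atlas_def by auto
  let ?S = "\<phi> ` (U \<inter> U')" and ?T = "\<psi> ` (V \<inter> V')"
  note ta = smooth_transitionsD[OF t(1) 1(3) 2(3)] and tb = smooth_transitionsD[OF t(2) 1(4) 2(4)]
  have o: "open (?S \<times> ?T)" using ta tb by (intro open_Times)
  have "C_nat_on k (?S \<times> ?T) (\<lambda>z. ((\<phi>' \<circ> inv_into U \<phi>) (fst z), (\<psi>' \<circ> inv_into V \<psi>) (snd z)))" for k
  proof (rule C_nat_on_Pair[OF o])
    show "C_nat_on k (?S \<times> ?T) (\<lambda>z. (\<phi>' \<circ> inv_into U \<phi>) (fst z))"
      by (rule C_nat_on_compose[OF o _ C_nat_on_bounded_linear[OF bounded_linear_fst o], where V="?S"])
        (use ta(2) in \<open>auto simp only: C_on_infinity fst_conv\<close>)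
    show "C_nat_on k (?S \<times> ?T) (\<lambda>z. (\<psi>' \<circ> inv_into V \<psi>) (snd z))"
      by (rule C_nat_on_compose[OF o _ C_nat_on_bounded_linear[OF bounded_linear_snd o], where V="?T"])
        (use tb(2) in \<open>auto simp only: C_on_infinity snd_conv\<close>)
  qed
  then have "C_on \<infinity> (?S \<times> ?T) (\<lambda>z. ((\<phi>' \<circ> inv_into U \<phi>) (fst z), (\<psi>' \<circ> inv_into V \<psi>) (snd z)))"
    by (simp add: C_on_infinity)
  then have "C_on \<infinity> (?S \<times> ?T) (\<theta>' \<circ> inv_into W \<theta>)"
    by (rule C_on_cong[OF o, rotated]) (auto simp: 1 2 inv_into_map_prod inj)
  then show "open (\<theta> ` (W \<inter> W')) \<and> C_on \<infinity> (\<theta> ` (W \<inter> W')) (\<theta>' \<circ> inv_into W \<theta>)"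
    using o by (simp add: 1 2 product_atlas_image)
qed

lemma smooth_atlas_product:
  assumes "smooth_atlas A" "smooth_atlas B"
  shows "smooth_atlas (product_atlas A B)"
  using assms smooth_transitions_product[of A A B B] map_prod_inj_on
  unfolding smooth_atlas_iff product_atlas_def by blast

lemma points_product_atlas: "points (product_atlas A B) = points A \<times> points B"
proof (intro equalityI subsetI)
  fix z assume "z \<in> points A \<times> points B"
  then obtain x y where z: "z = (x, y)" "x \<in> points A" "y \<in> points B" by auto
  from z(2) obtain U \<phi> where U: "(U, \<phi>) \<in> A" "x \<in> U" by (rule pointsE)
  from z(3) obtain V \<psi> where V: "(V, \<psi>) \<in> B" "y \<in> V" by (rule pointsE)
  have "(U \<times> V, map_prod \<phi> \<psi>) \<in> product_atlas A B" using U V unfolding product_atlas_def by blast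
  then show "z \<in> points (product_atlas A B)" by (rule pointsI) (use z U V in simp)
qed (auto simp: points_def product_atlas_def)

lemma smoothly_embedded_transitions:
  assumes emb: "smoothly_embedded B A" and A: "smooth_atlas A" and B: "smooth_atlas B"
  shows "smooth_transitions B A"
  unfolding smooth_transitions_def
proof (intro allI impI)
  fix U \<phi> V \<psi> assume ch: "(U, \<phi>) \<in> B" "(V, \<psi>) \<in> A"
  have "openin (manifold_topology B) (points B \<inter> V)"
    using emb openin_chart_domain[OF ch(2)] unfolding smoothly_embedded_def
    by (metis openin_subtopology_Int2)
  from open_chart_image[OF B this ch(1)] have "open (\<phi> ` (U \<inter> (points B \<inter> V)))" .
  moreover have "U \<inter> (points B \<inter> V) = U \<inter> V" using pointsI[OF ch(1)] by auto
  ultimately show "open (\<phi> ` (U \<inter> V)) \<and> C_on \<infinity> (\<phi> ` (U \<inter> V)) (\<psi> \<circ> inv_into U \<phi>)"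
    using emb ch unfolding smoothly_embedded_def by auto
qed

subsection \<open>Tangent vectors in charts\<close>

text \<open>The value 0 on functions that are not C^1 copies the convention of
  \<open>velocity\<close>; chart vectors and velocities can then be compared by plain
  equality.\<close>

definition chart_vector ::
  "('a, 'e::euclidean_space) atlas \<Rightarrow> 'a set \<Rightarrow> ('a \<Rightarrow> 'e) \<Rightarrow> 'a \<Rightarrow> 'e \<Rightarrow> 'a tangent" where
  "chart_vector A U \<phi> p a =
     (\<lambda>f. if C_near 1 A p f then frechet (f \<circ> inv_into U \<phi>) (\<phi> p) a else 0)"

lemma C_on_1: "C_on 1 W f \<longleftrightarrow> C_nat_on 1 W f"
  using C_on_enat[of 1] by (simp add: one_enat_def)

lemma C_nat_on_1_differentiable: "C_nat_on 1 W f \<Longrightarrow> x \<in> W \<Longrightarrow> f differentiable (at x)"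
  by simp

lemma C_near_1_differentiable:
  assumes "smooth_atlas A" "(U, \<phi>) \<in> A" "p \<in> U" "C_near 1 A p f"
  shows "(f \<circ> inv_into U \<phi>) differentiable (at (\<phi> p))"
  using assms(4) unfolding C_near_iff[OF assms(1-3)] C_on_1
  by (metis C_nat_on_1_differentiable)

lemma C_near_1_has_derivative:
  assumes "smooth_atlas A" "(U, \<phi>) \<in> A" "p \<in> U" "C_near 1 A p f"
  shows "((f \<circ> inv_into U \<phi>) has_derivative frechet (f \<circ> inv_into U \<phi>) (\<phi> p)) (at (\<phi> p))"
  using C_near_1_differentiable[OF assms] by (simp add: frechet_derivative_works)

lemma chart_vector_sum:
  assumes "smooth_atlas A" "(U, \<phi>) \<in> A" "p \<in> U"
  shows "chart_vector A U \<phi> p (\<Sum>i\<in>I. r i *\<^sub>R a i) = (\<lambda>f. \<Sum>i\<in>I. r i * chart_vector A U \<phi> p (a i) f)"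
proof
  fix f
  show "chart_vector A U \<phi> p (\<Sum>i\<in>I. r i *\<^sub>R a i) f = (\<Sum>i\<in>I. r i * chart_vector A U \<phi> p (a i) f)"
  proof (cases "C_near 1 A p f")
    case True
    then have "linear (frechet (f \<circ> inv_into U \<phi>) (\<phi> p))"
      by (intro linear_frechet_derivative C_near_1_differentiable[OF assms])
    then show ?thesis using True by (simp add: chart_vector_def linear_sum linear_cmul)
  qed (simp add: chart_vector_def)
qed

lemma chart_vector_add:
  assumes "smooth_atlas A" "(U, \<phi>) \<in> A" "p \<in> U"
  shows "chart_vector A U \<phi> p (a + a') = (\<lambda>f. chart_vector A U \<phi> p a f + chart_vector A U \<phi> p a' f)"
  using chart_vector_sum[OF assms, of "\<lambda>_. 1" "\<lambda>b. if b then a else a'" UNIV] by (simp add: UNIV_bool add.commute)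

lemma chart_vector_0:
  assumes "smooth_atlas A" "(U, \<phi>) \<in> A" "p \<in> U"
  shows "chart_vector A U \<phi> p 0 = (\<lambda>f. 0)"
  using chart_vector_sum[OF assms, of _ _ "{}"] by simp

lemma C_near_chart_component:
  assumes "smooth_atlas A" "(U, \<phi>) \<in> A" "p \<in> U"
  shows "C_near k A p (\<lambda>x. \<phi> x \<bullet> v)"
    "frechet ((\<lambda>x. \<phi> x \<bullet> v) \<circ> inv_into U \<phi>) (\<phi> p) a = a \<bullet> v"
proof -
  note o = smooth_atlasD[OF assms(1,2)]
  have eq: "s \<bullet> v = ((\<lambda>x. \<phi> x \<bullet> v) \<circ> inv_into U \<phi>) s" if "s \<in> \<phi> ` U" for s
    using that by (simp add: f_inv_into_f)
  have "C_nat_on j (\<phi> ` U) ((\<lambda>x. \<phi> x \<bullet> v) \<circ> inv_into U \<phi>)" for j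
    by (rule C_nat_on_cong[OF o(2) eq C_nat_on_bounded_linear[OF bounded_linear_inner_left o(2)]])
  then have "C_on k (\<phi> ` U) ((\<lambda>x. \<phi> x \<bullet> v) \<circ> inv_into U \<phi>)" by (simp add: C_on_def)
  then show "C_near k A p (\<lambda>x. \<phi> x \<bullet> v)" unfolding C_near_iff[OF assms] using o assms(3) by blast
  have "((\<lambda>s. s \<bullet> v) has_derivative (\<lambda>s. s \<bullet> v)) (at (\<phi> p))"
    by (rule bounded_linear_imp_has_derivative[OF bounded_linear_inner_left])
  then have "(((\<lambda>x. \<phi> x \<bullet> v) \<circ> inv_into U \<phi>) has_derivative (\<lambda>s. s \<bullet> v)) (at (\<phi> p))"
    by (rule has_derivative_transform_within_open[OF _ o(2) _ eq]) (use assms(3) in auto)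
  then show "frechet ((\<lambda>x. \<phi> x \<bullet> v) \<circ> inv_into U \<phi>) (\<phi> p) a = a \<bullet> v"
    by (simp flip: frechet_derivative_at)
qed

text \<open>The coordinate functions \<open>x \<mapsto> \<phi> x \<bullet> v\<close> are C^1 near
  \<open>p\<close> and separate the vectors of the chart.\<close>

lemma chart_vector_inj:
  assumes "smooth_atlas A" "(U, \<phi>) \<in> A" "p \<in> U" "chart_vector A U \<phi> p a = chart_vector A U \<phi> p a'"
  shows "a = a'"
proof (rule euclidean_eqI)
  fix v :: 'b
  have "chart_vector A U \<phi> p a (\<lambda>x. \<phi> x \<bullet> v) = chart_vector A U \<phi> p a' (\<lambda>x. \<phi> x \<bullet> v)"
    using assms(4) by simp
  then show "a \<bullet> v = a' \<bullet> v"
    by (simp add: chart_vector_def C_near_chart_component[OF assms(1-3)])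
qed

lemma velocity_eq_chart_vector:
  assumes A: "smooth_atlas A" "(U, \<phi>) \<in> A" "p \<in> U"
    and \<gamma>: "\<gamma> 0 = p" "0 < \<epsilon>" "\<gamma> ` {-\<epsilon><..<\<epsilon>} \<subseteq> U" "((\<phi> \<circ> \<gamma>) has_vector_derivative a) (at 0)"
  shows "velocity A \<gamma> = chart_vector A U \<phi> p a"
proof
  fix f
  show "velocity A \<gamma> f = chart_vector A U \<phi> p a f"
  proof (cases "C_near 1 A p f")
    case True
    have "deriv (f \<circ> \<gamma>) 0 = deriv (\<lambda>t. (f \<circ> inv_into U \<phi>) ((\<phi> \<circ> \<gamma>) t)) 0"
      by (rule deriv_eq_on_open[of "{-\<epsilon><..<\<epsilon>}"])
        (use \<gamma> smooth_atlasD(1)[OF A(1,2)] in \<open>auto simp: inv_into_f_f image_subset_iff\<close>)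
    also have "\<dots> = frechet (f \<circ> inv_into U \<phi>) (\<phi> p) a"
      by (rule DERIV_imp_deriv[OF has_real_derivative_along_curve[OF _ \<gamma>(4)]])
        (use C_near_1_has_derivative[OF A True] \<gamma>(1) in \<open>simp add: o_def\<close>)
    finally show ?thesis using True \<gamma>(1) by (simp add: velocity_def chart_vector_def)
  qed (use \<gamma>(1) in \<open>simp add: velocity_def chart_vector_def\<close>)
qed

text \<open>\<open>C_curve\<close> speaks of some chart. By continuity the curve stays for a short
  time in the overlap with the given one, and the transition map transports its class.\<close>

lemma C_curve_chart:
  assumes A: "smooth_atlas A" "(U, \<phi>) \<in> A" and \<gamma>: "\<gamma> 0 \<in> U" "C_curve k A \<gamma>"
  obtains \<epsilon> where "0 < \<epsilon>" "\<gamma> ` {-\<epsilon><..<\<epsilon>} \<subseteq> U" "C_on k {-\<epsilon><..<\<epsilon>} (\<phi> \<circ> \<gamma>)"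
proof -
  obtain V \<psi> e where e: "(V, \<psi>) \<in> A" "0 < e" "\<gamma> ` {-e<..<e} \<subseteq> V" "C_on k {-e<..<e} (\<psi> \<circ> \<gamma>)"
    using \<gamma>(2) unfolding C_curve_def by auto
  note t = smooth_transitionsD[OF smooth_transitions_refl[OF A(1)] e(1) A(2)]
  have inj: "inj_on \<phi> U" "inj_on \<psi> V" using smooth_atlasD[OF A] smooth_atlasD[OF A(1) e(1)] by auto
  define T where "T = {t \<in> {-e<..<e}. (\<psi> \<circ> \<gamma>) t \<in> \<psi> ` (V \<inter> U)}"
  have T: "open T" unfolding T_def
    by (rule open_preimage_within[OF _ C_on_imp_continuous_on[OF e(4)] t(1)]) simp
  have U: "\<gamma> t \<in> U" if "t \<in> T" for t
  proof -
    have "\<gamma> t \<in> V" "\<psi> (\<gamma> t) \<in> \<psi> ` (V \<inter> U)" using that e(3) by (auto simp: T_def)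
    then show ?thesis using inj(2) by (auto dest: inj_onD)
  qed
  have "C_on k (\<psi> ` (V \<inter> U)) (\<phi> \<circ> inv_into V \<psi>)" using t(2) by (simp add: C_on_def)
  moreover have "C_on k T (\<psi> \<circ> \<gamma>)" by (rule C_on_subset[OF e(4)]) (auto simp: T_def)
  moreover have "(\<psi> \<circ> \<gamma>) ` T \<subseteq> \<psi> ` (V \<inter> U)" by (auto simp: T_def)
  ultimately have "C_on k T (\<lambda>t. (\<phi> \<circ> inv_into V \<psi>) ((\<psi> \<circ> \<gamma>) t))"
    by (rule C_on_compose[OF T])
  then have C: "C_on k T (\<phi> \<circ> \<gamma>)"
    by (rule C_on_cong[OF T, rotated]) (use inj e(3) in \<open>auto simp: T_def image_subset_iff\<close>)
  have "\<gamma> 0 \<in> V" using e(2,3) by (simp add: image_subset_iff)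
  then have "0 \<in> T" using e(2) \<gamma>(1) by (simp add: T_def)
  then obtain \<epsilon> where \<epsilon>: "0 < \<epsilon>" "ball 0 \<epsilon> \<subseteq> T" using T open_contains_ball by blast
  have b: "ball 0 \<epsilon> = {-\<epsilon><..<\<epsilon>}" by (auto simp: dist_real_def)
  show ?thesis
    by (rule that[OF \<epsilon>(1)]) (use \<epsilon>(2) U C in \<open>auto simp: b intro: C_on_subset\<close>)
qed

lemma C_on_mono: "C_on k W f \<Longrightarrow> j \<le> k \<Longrightarrow> C_on j W f"
  unfolding C_on_def by (meson order_trans)

lemma C_curve_mono:
  assumes "C_curve k A \<gamma>" "j \<le> k"
  shows "C_curve j A \<gamma>"
proof -
  obtain U \<phi> e where "(U, \<phi>) \<in> A" "0 < e" "\<gamma> ` {-e<..<e} \<subseteq> U" "C_on k {-e<..<e} (\<phi> \<circ> \<gamma>)"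
    using assms(1) unfolding C_curve_def by blast
  then show ?thesis using C_on_mono[OF _ assms(2)] unfolding C_curve_def by blast
qed

lemma has_vector_derivative_frechet:
  assumes "C_on 1 T \<gamma>" "t \<in> T"
  shows "(\<gamma> has_vector_derivative frechet \<gamma> t 1) (at t)"
  using C_nat_on_1_differentiable[OF assms(1)[unfolded C_on_1] assms(2)]
  by (simp add: frechet_derivative_eq_vector_derivative vector_derivative_works[symmetric])

lemma velocity_C_curve:
  assumes A: "smooth_atlas A" "(U, \<phi>) \<in> A" "p \<in> U" and \<gamma>: "\<gamma> 0 = p" "C_curve 1 A \<gamma>"
  shows "velocity A \<gamma> = chart_vector A U \<phi> p (frechet (\<phi> \<circ> \<gamma>) 0 1)"
proof -
  obtain \<epsilon> where "0 < \<epsilon>" "\<gamma> ` {-\<epsilon><..<\<epsilon>} \<subseteq> U" "C_on 1 {-\<epsilon><..<\<epsilon>} (\<phi> \<circ> \<gamma>)"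
    using C_curve_chart[OF A(1,2) _ \<gamma>(2)] \<gamma>(1) A(3) by auto
  then show ?thesis
    by (intro velocity_eq_chart_vector[OF A, where \<gamma>=\<gamma>] \<gamma>(1) has_vector_derivative_frechet) auto
qed

lemma chart_curve:
  assumes A: "smooth_atlas A" "(U, \<phi>) \<in> A" "p \<in> U"
    and g: "open T" "0 \<in> T" "C_on k T g" "g 0 = \<phi> p" "g ` T \<subseteq> \<phi> ` U" and k: "1 \<le> k"
  shows "C_curve k A (\<lambda>t. inv_into U \<phi> (g t))" "inv_into U \<phi> (g 0) = p"
    "velocity A (\<lambda>t. inv_into U \<phi> (g t)) = chart_vector A U \<phi> p (frechet g 0 1)"
proof -
  obtain \<epsilon> where \<epsilon>: "0 < \<epsilon>" "ball 0 \<epsilon> \<subseteq> T" using g(1,2) open_contains_ball by blast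
  have b: "ball 0 \<epsilon> = {-\<epsilon><..<\<epsilon>}" by (auto simp: dist_real_def)
  have im: "(\<lambda>t. inv_into U \<phi> (g t)) ` {-\<epsilon><..<\<epsilon>} \<subseteq> U"
    using \<epsilon>(2) g(5) by (auto simp: b image_subset_iff intro!: inv_into_into)
  have eq: "g t = (\<phi> \<circ> (\<lambda>t. inv_into U \<phi> (g t))) t" if "t \<in> {-\<epsilon><..<\<epsilon>}" for t
    using that \<epsilon>(2) g(5) by (auto simp: b image_subset_iff f_inv_into_f)
  have "C_on k {-\<epsilon><..<\<epsilon>} g" using \<epsilon>(2) by (intro C_on_subset[OF g(3)]) (simp add: b)
  then have "C_on k {-\<epsilon><..<\<epsilon>} (\<phi> \<circ> (\<lambda>t. inv_into U \<phi> (g t)))"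
    by (rule C_on_cong[where f=g, rotated 2], simp) (erule eq)
  then show "C_curve k A (\<lambda>t. inv_into U \<phi> (g t))"
    unfolding C_curve_def using A(2) \<epsilon>(1) im by blast
  show p: "inv_into U \<phi> (g 0) = p" using smooth_atlasD(1)[OF A(1,2)] A(3) g(4) by simp
  have "C_on 1 T g" using g(3) k unfolding C_on_def by (meson order_trans)
  then have "(g has_vector_derivative frechet g 0 1) (at 0)"
    by (rule has_vector_derivative_frechet[OF _ g(2)])
  then have "((\<phi> \<circ> (\<lambda>t. inv_into U \<phi> (g t))) has_vector_derivative frechet g 0 1) (at 0)"
    by (rule has_vector_derivative_transform_within_open[of _ _ _ "{-\<epsilon><..<\<epsilon>}"]) (simp_all only: eq, use \<epsilon>(1) in auto)
  then show "velocity A (\<lambda>t. inv_into U \<phi> (g t)) = chart_vector A U \<phi> p (frechet g 0 1)"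
    using p \<epsilon>(1) im by (intro velocity_eq_chart_vector[OF A, where \<epsilon>=\<epsilon>])
qed

text \<open>Common source of all curves constructed below, as the image of a straight line under
  \<open>g\<close>: with the identity it realises tangent vectors, with the inclusion it gives
  curves in a surface, with a straightening map curves in a leaf.\<close>

lemma chart_line_curve:
  fixes g :: "'v::euclidean_space \<Rightarrow> 'e::euclidean_space"
  assumes A: "smooth_atlas A" "(U, \<phi>) \<in> A" "p \<in> U"
    and N: "open N" "s0 \<in> N" and g: "C_on k N g" "g s0 = \<phi> p" "g ` N \<subseteq> \<phi> ` U"
    and D: "(g has_derivative D) (at s0)" and k: "1 \<le> k"
  obtains \<gamma> \<epsilon> where "C_curve k A \<gamma>" "\<gamma> 0 = p" "0 < \<epsilon>" "velocity A \<gamma> = chart_vector A U \<phi> p (D a)"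
    "\<And>t. t \<in> {-\<epsilon><..<\<epsilon>} \<Longrightarrow> s0 + t *\<^sub>R a \<in> N \<and> \<gamma> t = inv_into U \<phi> (g (s0 + t *\<^sub>R a))"
proof -
  let ?l = "\<lambda>t::real. s0 + t *\<^sub>R a"
  define T where "T = ?l -` N"
  have T: "open T" unfolding T_def
    by (rule open_vimage[OF N(1)]) (auto intro!: continuous_intros)
  have T0: "0 \<in> T" using N(2) by (simp add: T_def)
  have l: "(?l has_derivative (\<lambda>t. t *\<^sub>R a)) (at t)" for t by (auto intro!: derivative_eq_intros)
  have "C_nat_on j UNIV ?l" for j
    by (intro C_nat_on_add C_nat_on_scaleR C_nat_on_ident C_nat_on_const) auto
  then have "C_on k T ?l" unfolding C_on_def by (blast intro: C_nat_on_subset)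
  then have C: "C_on k T (\<lambda>t. g (?l t))"
    by (rule C_on_compose[OF T g(1)]) (auto simp: T_def)
  have im: "(\<lambda>t. g (?l t)) ` T \<subseteq> \<phi> ` U" using g(3) by (auto simp: T_def)
  have 0: "g (?l 0) = \<phi> p" using g(2) by simp
  note cc = chart_curve[OF A T T0 C 0 im k]
  have "((g \<circ> ?l) has_derivative (D \<circ> (\<lambda>t. t *\<^sub>R a))) (at 0)"
    by (rule diff_chain_at[OF l]) (use D in simp)
  from fun_cong[OF frechet_derivative_at[OF this], of 1]
  have d: "frechet (\<lambda>t. g (?l t)) 0 1 = D a" by (simp add: o_def)
  obtain \<epsilon> where \<epsilon>: "0 < \<epsilon>" "ball 0 \<epsilon> \<subseteq> T" using T T0 open_contains_ball by blast
  have b: "ball 0 \<epsilon> = {-\<epsilon><..<\<epsilon>}" by (auto simp: dist_real_def)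
  show ?thesis
    using cc d \<epsilon> by (intro that[of "\<lambda>t. inv_into U \<phi> (g (?l t))" \<epsilon>]) (auto simp: b T_def)
qed

lemma chart_vector_curve:
  assumes A: "smooth_atlas A" "(U, \<phi>) \<in> A" "p \<in> U"
  obtains \<gamma> where "C_curve \<infinity> A \<gamma>" "\<gamma> 0 = p" "velocity A \<gamma> = chart_vector A U \<phi> p a"
proof -
  note o = smooth_atlasD(2)[OF A(1,2)]
  have "C_on \<infinity> (\<phi> ` U) (\<lambda>s. s)" by (simp add: C_on_infinity C_nat_on_ident[OF o])
  from chart_line_curve[OF A o _ this, of "\<phi> p" "\<lambda>h. h" a] that show ?thesis
    using A(3) has_derivative_ident by force
qed

text \<open>Tangent vectors are defined by C^1 curves, but straight lines in a chart already realise
  every velocity, so smooth curves give the same space.\<close>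

lemma tangent_space_eq:
  assumes A: "smooth_atlas A" "(U, \<phi>) \<in> A" "p \<in> U"
  shows "tangent_space A p = range (chart_vector A U \<phi> p)"
proof (intro equalityI subsetI)
  fix u assume "u \<in> tangent_space A p"
  then obtain \<gamma> where "u = velocity A \<gamma>" "C_curve 1 A \<gamma>" "\<gamma> 0 = p" unfolding tangent_space_def by blast
  then show "u \<in> range (chart_vector A U \<phi> p)" using velocity_C_curve[OF A] by simp
next
  fix u assume "u \<in> range (chart_vector A U \<phi> p)"
  then obtain a where "u = chart_vector A U \<phi> p a" by auto
  moreover obtain \<gamma> where "C_curve \<infinity> A \<gamma>" "\<gamma> 0 = p" "velocity A \<gamma> = chart_vector A U \<phi> p a"
    by (rule chart_vector_curve[OF A])
  ultimately show "u \<in> tangent_space A p" unfolding tangent_space_def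
    using C_curve_mono[of \<infinity> A _ 1] by force
qed

lemma C_near_cong:
  assumes "smooth_atlas A" "p \<in> points A" "\<And>x. x \<in> points A \<Longrightarrow> f x = g x"
  shows "C_near k A p f \<longleftrightarrow> C_near k A p g"
proof -
  obtain U \<phi> where ch: "(U, \<phi>) \<in> A" "p \<in> U" using assms(2) by (rule pointsE)
  have eq: "(f \<circ> inv_into U \<phi>) s = (g \<circ> inv_into U \<phi>) s" if "s \<in> \<phi> ` U" for s
    using assms(3) pointsI[OF ch(1) inv_into_into[OF that]] by simp
  have "C_on k T (f \<circ> inv_into U \<phi>) \<longleftrightarrow> C_on k T (g \<circ> inv_into U \<phi>)" if "open T" "T \<subseteq> \<phi> ` U" for T
    using C_on_cong[OF that(1), of "f \<circ> inv_into U \<phi>" "g \<circ> inv_into U \<phi>" k]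
      C_on_cong[OF that(1), of "g \<circ> inv_into U \<phi>" "f \<circ> inv_into U \<phi>" k] eq subsetD[OF that(2)]
    by (auto simp del: o_apply)
  then show ?thesis unfolding C_near_iff[OF assms(1) ch] by blast
qed

text \<open>Functions are total on the type, while identities such as the formula for
  \<open>b\<close> hold only on points of the manifold. Values elsewhere have no influence on
  tangent vectors.\<close>

lemma chart_vector_cong:
  assumes "smooth_atlas A" "(U, \<phi>) \<in> A" "p \<in> U" "\<And>x. x \<in> points A \<Longrightarrow> f x = g x"
  shows "chart_vector A U \<phi> p a f = chart_vector A U \<phi> p a g"
proof (cases "C_near 1 A p f")
  case True
  have eq: "(f \<circ> inv_into U \<phi>) s = (g \<circ> inv_into U \<phi>) s" if "s \<in> \<phi> ` U" for s
    using assms(4) pointsI[OF assms(2) inv_into_into[OF that]] by simp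
  have "frechet (f \<circ> inv_into U \<phi>) (\<phi> p) = frechet (g \<circ> inv_into U \<phi>) (\<phi> p)"
    by (rule frechet_derivative_transform_within_open[OF C_near_1_differentiable[OF assms(1-3) True]
          smooth_atlasD(2)[OF assms(1,2)] _ eq]) (use assms(3) in auto)
  then show ?thesis using C_near_cong[OF assms(1) pointsI[OF assms(2,3)] assms(4)] by (simp add: chart_vector_def)
qed (use C_near_cong[OF assms(1) pointsI[OF assms(2,3)] assms(4)] in \<open>simp add: chart_vector_def\<close>)

lemma tangent_cong:
  assumes "smooth_atlas A" "p \<in> points A" "u \<in> tangent_space A p" "\<And>x. x \<in> points A \<Longrightarrow> f x = g x"
  shows "u f = u g"
proof -
  obtain U \<phi> where ch: "(U, \<phi>) \<in> A" "p \<in> U" using assms(2) by (rule pointsE)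
  obtain a where a: "u = chart_vector A U \<phi> p a" using assms(3) unfolding tangent_space_eq[OF assms(1) ch] by blast
  show ?thesis unfolding a by (rule chart_vector_cong[OF assms(1) ch assms(4)])
qed

lemma C_near_add:
  assumes "smooth_atlas A" "p \<in> points A" "C_near k A p f" "C_near k A p g"
  shows "C_near k A p (\<lambda>x. f x + g x)"
proof -
  obtain U \<phi> where ch: "(U, \<phi>) \<in> A" "p \<in> U" using assms(2) by (rule pointsE)
  obtain T T' where T: "open T" "\<phi> p \<in> T" "T \<subseteq> \<phi> ` U" "C_on k T (f \<circ> inv_into U \<phi>)"
    and T': "open T'" "\<phi> p \<in> T'" "T' \<subseteq> \<phi> ` U" "C_on k T' (g \<circ> inv_into U \<phi>)"
    using assms(3,4) unfolding C_near_iff[OF assms(1) ch] by blast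
  have "C_on k (T \<inter> T') ((\<lambda>x. f x + g x) \<circ> inv_into U \<phi>)"
    unfolding C_on_def o_def
  proof (intro allI impI)
    fix j assume j: "enat j \<le> k"
    have "C_nat_on j T (\<lambda>x. f (inv_into U \<phi> x))" "C_nat_on j T' (\<lambda>x. g (inv_into U \<phi> x))"
      using T(4) T'(4) j by (simp_all add: C_on_def o_def)
    then have "C_nat_on j (T \<inter> T') (\<lambda>x. f (inv_into U \<phi> x))" "C_nat_on j (T \<inter> T') (\<lambda>x. g (inv_into U \<phi> x))"
      by (auto elim: C_nat_on_subset)
    then show "C_nat_on j (T \<inter> T') (\<lambda>x. f (inv_into U \<phi> x) + g (inv_into U \<phi> x))"
      using T(1) T'(1) by (intro C_nat_on_add) auto
  qed
  then show ?thesis unfolding C_near_iff[OF assms(1) ch] using T T' by blast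
qed

lemma C_near_const: "smooth_atlas A \<Longrightarrow> p \<in> points A \<Longrightarrow> C_near k A p (\<lambda>x. a)"
  unfolding C_near_def C_fun_on_def
  by (intro exI[of _ "points A"]) (use openin_topspace[of "manifold_topology A"] in \<open>auto simp: C_on_def o_def\<close>)

lemma chart_vector_apply_add:
  assumes "smooth_atlas A" "(U, \<phi>) \<in> A" "p \<in> U" "C_near 1 A p f" "C_near 1 A p g"
  shows "chart_vector A U \<phi> p a (\<lambda>x. f x + g x) = chart_vector A U \<phi> p a f + chart_vector A U \<phi> p a g"
proof -
  have "((\<lambda>s. (f \<circ> inv_into U \<phi>) s + (g \<circ> inv_into U \<phi>) s) has_derivative
    (\<lambda>v. frechet (f \<circ> inv_into U \<phi>) (\<phi> p) v + frechet (g \<circ> inv_into U \<phi>) (\<phi> p) v))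
    (at (\<phi> p))"
    by (intro has_derivative_add C_near_1_has_derivative[OF assms(1-3)] assms)
  from frechet_derivative_at[OF this] show ?thesis
    using assms C_near_add[OF assms(1) pointsI[OF assms(2,3)] assms(4,5)]
    by (simp add: chart_vector_def o_def fun_eq_iff)
qed

text \<open>Holds for arbitrary \<open>f\<close>: if \<open>f\<close> is not C^1 near
  \<open>p\<close>, neither is the sum, and both sides are the default value 0.\<close>

lemma tangent_apply_add_const:
  assumes "u \<in> tangent_space A p" "smooth_atlas A" "p \<in> points A"
  shows "u (\<lambda>x. f x + a) = u f"
proof -
  obtain \<gamma> where g: "u = velocity A \<gamma>" "\<gamma> 0 = p" using assms(1) unfolding tangent_space_def by blast
  have "C_near 1 A p (\<lambda>x. f x + a) \<longleftrightarrow> C_near 1 A p f"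
    using C_near_add[OF assms(2,3) _ C_near_const[OF assms(2,3)], of 1 f a]
      C_near_add[OF assms(2,3) _ C_near_const[OF assms(2,3)], of 1 "\<lambda>x. f x + a" "- a"] by auto
  then show ?thesis using g deriv_add_const[of "\<lambda>t. f (\<gamma> t)" a 0] by (simp add: velocity_def o_def)
qed

lemma C_on_numeral: "C_on (numeral n) W f \<longleftrightarrow> C_nat_on (numeral n) W f"
  unfolding numeral_eq_enat by (rule C_on_enat)

lemma C_nat_on_derivative: "C_nat_on (Suc k) W f \<Longrightarrow> C_nat_on k W (\<lambda>x. frechet f x v)"
  by simp

subsection \<open>Straightening of submersions\<close>

text \<open>The normal form is arranged with the identity as derivative of \<open>g\<close> at
  \<open>s0\<close>, so that straight lines keep their velocity: a line in a kernel direction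
  becomes a curve in the level set of \<open>q\<close> with that velocity, and an affine right
  inverse of the derivative becomes a local section.\<close>

lemma submersion_straightening:
  fixes q :: "real ^ 'm \<Rightarrow> real ^ 'n"
  assumes q: "C_nat_on (Suc k) S q" and S: "open S" "s0 \<in> S"
    and surj: "surj (frechet q s0)"
  obtains V g where "open V" "s0 \<in> V" "C_nat_on (Suc k) V g" "g s0 = s0" "g ` V \<subseteq> S"
    "(g has_derivative (\<lambda>h. h)) (at s0)"
    "\<And>v. v \<in> V \<Longrightarrow> q (g v) = q s0 + frechet q s0 (v - s0)"
proof -
  define L where "L = frechet q s0"
  have hq: "(q has_derivative L) (at s0)" unfolding L_def by (rule C_nat_on_has_derivative[OF q S(2)])
  have L: "bounded_linear L" by (rule has_derivative_bounded_linear[OF hq])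
  obtain A where A: "linear A" "L \<circ> A = id"
    using linear_surjective_right_inverse[OF bounded_linear.linear[OF L] surj[folded L_def]] by blast
  have bA: "bounded_linear A" using A(1) by (simp add: linear_conv_bounded_linear)
  txt \<open>With this choice \<open>D\<Phi>(s0)\<close> is the identity and \<open>q = q s0 + L \<circ> (\<Phi> - s0)\<close>, so the local inverse
    of \<open>\<Phi>\<close> straightens \<open>q\<close>.\<close>
  define \<Phi> where "\<Phi> = (\<lambda>x. x + A (q x - q s0 - L (x - s0)))"
  have "C_nat_on (Suc k) S (\<lambda>x. L (x - s0))"
    by (rule C_nat_on_bounded_linear_compose[OF L S(1)])
      (rule C_nat_on_diff[OF S(1) C_nat_on_ident[OF S(1)] C_nat_on_const])
  then have "C_nat_on (Suc k) S (\<lambda>x. q x - q s0 - L (x - s0))"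
    by (intro C_nat_on_diff S(1) q C_nat_on_const)
  then have C: "C_nat_on (Suc k) S \<Phi>"
    unfolding \<Phi>_def by (intro C_nat_on_add[OF S(1) C_nat_on_ident[OF S(1)]] C_nat_on_bounded_linear_compose[OF bA S(1)])
  have "(\<Phi> has_derivative (\<lambda>h. h + A (L h - 0 - L (h - 0)))) (at s0)"
    unfolding \<Phi>_def
    by (intro has_derivative_add has_derivative_ident bounded_linear.has_derivative[OF bA]
        has_derivative_diff has_derivative_const hq bounded_linear.has_derivative[OF L])
  then have D: "(\<Phi> has_derivative (\<lambda>h. h)) (at s0)"
    using linear_0[OF A(1)] by simp
  have "inj (frechet \<Phi> s0)"
    using frechet_derivative_at[OF D] by (metis injI)
  then obtain U' V g where g: "open U'" "U' \<subseteq> S" "s0 \<in> U'" "open V" "\<Phi> s0 \<in> V" "homeomorphism U' V \<Phi> g"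
    "C_nat_on (Suc k) V g"
    using C_inverse_function[OF C S] by metis
  have \<Phi>0: "\<Phi> s0 = s0" using linear_0[OF A(1)] linear_0[OF bounded_linear.linear[OF L]] by (simp add: \<Phi>_def)
  have gU: "g v \<in> U'" "\<Phi> (g v) = v" if "v \<in> V" for v
    using g(6) that by (auto simp: homeomorphism_def)
  have g\<Phi>: "g (\<Phi> x) = x" if "x \<in> U'" for x using g(6) that by (auto simp: homeomorphism_def)
  have dg: "(g has_derivative frechet g s0) (at s0)"
    by (rule C_nat_on_has_derivative[OF g(7)]) (use g(5) \<Phi>0 in simp)
  have "((\<lambda>x. g (\<Phi> x)) has_derivative frechet g s0) (at s0)"
    using diff_chain_at[OF D, of g "frechet g s0"] dg \<Phi>0 by (simp add: o_def)
  then have "((\<lambda>x. x) has_derivative frechet g s0) (at s0)"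
    by (rule has_derivative_transform_within_open[OF _ g(1,3) g\<Phi>])
  then have "frechet g s0 = (\<lambda>h. h)"
    using has_derivative_unique has_derivative_ident by blast
  then have dg': "(g has_derivative (\<lambda>h. h)) (at s0)" using dg by simp
  have "q (g v) = q s0 + L (v - s0)" if v: "v \<in> V" for v
  proof -
    have LA: "L (A w) = w" for w using A(2) by (metis comp_apply id_apply)
    have "L (v - s0) = L (\<Phi> (g v) - s0)" using gU[OF v] by simp
    also have "\<dots> = L ((g v - s0) + A (q (g v) - q s0 - L (g v - s0)))" by (simp add: \<Phi>_def algebra_simps)
    also have "\<dots> = q (g v) - q s0"
      unfolding linear_add[OF bounded_linear.linear[OF L]] LA by simp
    finally show ?thesis by simp
  qed
  then show ?thesis
    using g gU(1) g\<Phi>[OF g(3)] \<Phi>0 dg' by (intro that[of V g]) (auto simp: L_def)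
qed

subsection \<open>Costs in local coordinates\<close>

lemma has_derivative_partial_fst:
  assumes "(F has_derivative D) (at (s, t))"
  shows "((\<lambda>s. F (s, t)) has_derivative (\<lambda>a. D (a, 0))) (at s)"
proof -
  have "((\<lambda>s. (s, t)) has_derivative (\<lambda>a. (a, 0))) (at s)" by (auto intro!: derivative_eq_intros)
  from diff_chain_at[OF this assms] show ?thesis by (simp add: o_def)
qed

lemma has_derivative_partial_snd:
  assumes "(F has_derivative D) (at (s, t))"
  shows "((\<lambda>t. F (s, t)) has_derivative (\<lambda>a. D (0, a))) (at t)"
proof -
  have "((\<lambda>t. (s, t)) has_derivative (\<lambda>a. (0, a))) (at t)" by (auto intro!: derivative_eq_intros)
  from diff_chain_at[OF this assms] show ?thesis by (simp add: o_def)
qed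

lemma C_nat_on_partial_fst:
  fixes F :: "'a::euclidean_space \<times> 'b::euclidean_space \<Rightarrow> 'c::real_normed_vector"
  assumes "C_nat_on k (S \<times> T) F" "open S" "t \<in> T"
  shows "C_nat_on k S (\<lambda>s. F (s, t))"
  by (rule C_nat_on_compose[OF assms(2,1) C_nat_on_Pair[OF assms(2) C_nat_on_ident[OF assms(2)] C_nat_on_const]])
    (use assms(3) in auto)

lemma C_nat_on_partial_snd:
  fixes F :: "'a::euclidean_space \<times> 'b::euclidean_space \<Rightarrow> 'c::real_normed_vector"
  assumes "C_nat_on k (S \<times> T) F" "open T" "s \<in> S"
  shows "C_nat_on k T (\<lambda>t. F (s, t))"
  by (rule C_nat_on_compose[OF assms(2,1) C_nat_on_Pair[OF assms(2) C_nat_on_const C_nat_on_ident[OF assms(2)]]])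
    (use assms(3) in auto)

text \<open>Only the regularity of the cost is assumed, symmetrically in the two variables, so that
  the locale can be interpreted again with the roles of \<open>X\<close> and \<open>Y\<close>
  exchanged.\<close>

locale smooth_cost =
  fixes X :: "('a, 'e::euclidean_space) atlas" and Y :: "('b, 'f::euclidean_space) atlas"
    and c :: "'a \<Rightarrow> 'b \<Rightarrow> real"
  assumes X: "smooth_atlas X" and Y: "smooth_atlas Y"
    and c: "\<And>x y. x \<in> points X \<Longrightarrow> y \<in> points Y \<Longrightarrow> C_near 4 (product_atlas X Y) (x, y) (\<lambda>(x, y). c x y)"
begin

definition local_cost where
  "local_cost U \<phi> V \<psi> = (\<lambda>z. c (inv_into U \<phi> (fst z)) (inv_into V \<psi> (snd z)))"

lemma local_cost_smooth:
  assumes x: "(U, \<phi>) \<in> X" "x \<in> U" and y: "(V, \<psi>) \<in> Y" "y \<in> V"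
  obtains S T where "open S" "\<phi> x \<in> S" "S \<subseteq> \<phi> ` U" "open T" "\<psi> y \<in> T" "T \<subseteq> \<psi> ` V"
    "C_nat_on 4 (S \<times> T) (local_cost U \<phi> V \<psi>)"
proof -
  have ch: "(U \<times> V, map_prod \<phi> \<psi>) \<in> product_atlas X Y" using x y unfolding product_atlas_def by blast
  have inj: "inj_on \<phi> U" "inj_on \<psi> V" using smooth_atlasD X Y x y by blast+
  have "C_near 4 (product_atlas X Y) (x, y) (\<lambda>(x, y). c x y)"
    by (rule c[OF pointsI[OF x] pointsI[OF y]])
  moreover have "(x, y) \<in> U \<times> V" using x y by simp
  ultimately obtain W where W: "open W" "map_prod \<phi> \<psi> (x, y) \<in> W" "W \<subseteq> map_prod \<phi> \<psi> ` (U \<times> V)"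
    "C_on 4 W ((\<lambda>(x, y). c x y) \<circ> inv_into (U \<times> V) (map_prod \<phi> \<psi>))"
    unfolding C_near_iff[OF smooth_atlas_product[OF X Y] ch \<open>(x, y) \<in> U \<times> V\<close>] by blast
  obtain S T where ST: "open S" "open T" "(\<phi> x, \<psi> y) \<in> S \<times> T" "S \<times> T \<subseteq> W"
    using open_prod_elim[OF W(1,2)] by auto
  have sub: "s \<in> \<phi> ` U" "t \<in> \<psi> ` V" if "s \<in> S" "t \<in> T" for s t
  proof -
    have "(s, t) \<in> map_prod \<phi> \<psi> ` (U \<times> V)" using that ST(4) W(3) by auto
    then show "s \<in> \<phi> ` U" "t \<in> \<psi> ` V" by auto
  qed
  have "C_nat_on 4 W ((\<lambda>(x, y). c x y) \<circ> inv_into (U \<times> V) (map_prod \<phi> \<psi>))"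
    using W(4) by (simp only: C_on_numeral)
  then have "C_nat_on 4 (S \<times> T) ((\<lambda>(x, y). c x y) \<circ> inv_into (U \<times> V) (map_prod \<phi> \<psi>))"
    by (rule C_nat_on_subset) (rule ST(4))
  then have "C_nat_on 4 (S \<times> T) (local_cost U \<phi> V \<psi>)"
    by (rule C_nat_on_cong[rotated 2])
      (use ST sub inj in \<open>auto simp: inv_into_map_prod local_cost_def intro: open_Times\<close>)
  then show ?thesis using ST sub by (intro that[of S T]) auto
qed

text \<open>The dictionary between iterated tangent vectors and partial derivatives of the cost in
  charts. One derivative in \<open>x\<close> leaves a C^3 function of \<open>y\<close>; with the
  variables exchanged this is the source of the class 3 of the quotient map.\<close>

lemma local_cost_derivatives:
  assumes x: "(U, \<phi>) \<in> X" "x \<in> U" and y: "(V, \<psi>) \<in> Y" "y \<in> V"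
    and S: "open S" "\<phi> x \<in> S" "S \<subseteq> \<phi> ` U" and T: "open T" "\<psi> y \<in> T" "T \<subseteq> \<psi> ` V"
    and F: "C_nat_on 4 (S \<times> T) (local_cost U \<phi> V \<psi>)"
  shows "t \<in> T \<Longrightarrow> C_near 4 X x (\<lambda>x'. c x' (inv_into V \<psi> t))"
    "t \<in> T \<Longrightarrow> chart_vector X U \<phi> x a (\<lambda>x'. c x' (inv_into V \<psi> t))
       = frechet (local_cost U \<phi> V \<psi>) (\<phi> x, t) (a, 0)"
    "C_near 3 Y y (\<lambda>y'. chart_vector X U \<phi> x a (\<lambda>x'. c x' y'))"
    "chart_vector Y V \<psi> y b (\<lambda>y'. chart_vector X U \<phi> x a (\<lambda>x'. c x' y'))
      = frechet (\<lambda>z. frechet (local_cost U \<phi> V \<psi>) z (a, 0)) (\<phi> x, \<psi> y) (0, b)"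
proof -
  let ?F = "local_cost U \<phi> V \<psi>"
  note chX = X x and chY = Y y
  have F': "C_nat_on (Suc 3) (S \<times> T) ?F" using F by (simp add: eval_nat_numeral)
  have 1: "C_near 4 X x (\<lambda>x'. c x' (inv_into V \<psi> t))" if t: "t \<in> T" for t
  proof -
    have "C_nat_on 4 S ((\<lambda>x'. c x' (inv_into V \<psi> t)) \<circ> inv_into U \<phi>)"
      using C_nat_on_partial_fst[OF F S(1) t] by (simp add: local_cost_def o_def)
    then have "C_on 4 S ((\<lambda>x'. c x' (inv_into V \<psi> t)) \<circ> inv_into U \<phi>)"
      by (simp only: C_on_numeral)
    then show ?thesis unfolding C_near_iff[OF chX] using S by blast
  qed
  have 2: "chart_vector X U \<phi> x a (\<lambda>x'. c x' (inv_into V \<psi> t)) = frechet ?F (\<phi> x, t) (a, 0)"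
    if t: "t \<in> T" for t
  proof -
    have "(?F has_derivative frechet ?F (\<phi> x, t)) (at (\<phi> x, t))"
      by (rule C_nat_on_has_derivative[OF F']) (use S t in auto)
    from frechet_derivative_at[OF has_derivative_partial_fst[OF this]]
    have "frechet ((\<lambda>x'. c x' (inv_into V \<psi> t)) \<circ> inv_into U \<phi>) (\<phi> x) a
      = frechet ?F (\<phi> x, t) (a, 0)"
      by (simp add: local_cost_def o_def fun_eq_iff)
    moreover have "C_near 1 X x (\<lambda>x'. c x' (inv_into V \<psi> t))"
      by (rule C_near_mono[OF 1[OF t]]) (simp add: one_enat_def numeral_eq_enat)
    ultimately show ?thesis by (simp add: chart_vector_def)
  qed
  let ?h = "\<lambda>y'. chart_vector X U \<phi> x a (\<lambda>x'. c x' y')"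
  let ?D = "\<lambda>z. frechet ?F z (a, 0)"
  have D: "C_nat_on (Suc 2) (S \<times> T) ?D" using F' by (simp add: eval_nat_numeral)
  have eq: "?D (\<phi> x, t) = (?h \<circ> inv_into V \<psi>) t" if "t \<in> T" for t using 2[OF that] by simp
  have "C_nat_on 3 T (\<lambda>t. ?D (\<phi> x, t))"
    using C_nat_on_partial_snd[OF D T(1) S(2)] by (simp add: eval_nat_numeral)
  then have "C_nat_on 3 T (?h \<circ> inv_into V \<psi>)" by (rule C_nat_on_cong[OF T(1), rotated]) (rule eq)
  then have "C_on 3 T (?h \<circ> inv_into V \<psi>)" by (simp only: C_on_numeral)
  then show 3: "C_near 3 Y y ?h" unfolding C_near_iff[OF chY] using T by blast
  have "(?D has_derivative frechet ?D (\<phi> x, \<psi> y)) (at (\<phi> x, \<psi> y))"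
    by (rule C_nat_on_has_derivative[OF D]) (use S T in auto)
  from has_derivative_transform_within_open[OF has_derivative_partial_snd[OF this] T(1,2) eq]
  have "((?h \<circ> inv_into V \<psi>) has_derivative (\<lambda>b. frechet ?D (\<phi> x, \<psi> y) (0, b))) (at (\<psi> y))" .
  from frechet_derivative_at[OF this]
  have "frechet (?h \<circ> inv_into V \<psi>) (\<psi> y) b = frechet ?D (\<phi> x, \<psi> y) (0, b)"
    by (simp add: fun_eq_iff)
  moreover have "C_near 1 Y y ?h"
    by (rule C_near_mono[OF 3]) (simp add: one_enat_def numeral_eq_enat)
  ultimately show "chart_vector Y V \<psi> y b ?h = frechet ?D (\<phi> x, \<psi> y) (0, b)"
    by (simp add: chart_vector_def)
  show "t \<in> T \<Longrightarrow> C_near 4 X x (\<lambda>x'. c x' (inv_into V \<psi> t))" by (rule 1)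
  show "t \<in> T \<Longrightarrow> chart_vector X U \<phi> x a (\<lambda>x'. c x' (inv_into V \<psi> t)) = frechet ?F (\<phi> x, t) (a, 0)"
    by (rule 2)
qed

end

lemma frechet_derivative_swap:
  fixes F :: "'a::real_normed_vector \<times> 'b::real_normed_vector \<Rightarrow> 'c::real_normed_vector"
  assumes "F differentiable (at (prod.swap z))"
  shows "frechet (\<lambda>z. F (prod.swap z)) z h = frechet F (prod.swap z) (prod.swap h)"
proof -
  have "bounded_linear (prod.swap :: 'b \<times> 'a \<Rightarrow> 'a \<times> 'b)"
    unfolding prod.swap_def by (intro bounded_linear_Pair bounded_linear_snd bounded_linear_fst)
  then have "(prod.swap has_derivative prod.swap) (at z)" by (rule bounded_linear_imp_has_derivative)
  from diff_chain_at[OF this assms[unfolded frechet_derivative_works]]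
  have "((\<lambda>z. F (prod.swap z)) has_derivative (\<lambda>h. frechet F (prod.swap z) (prod.swap h))) (at z)"
    by (simp add: o_def)
  from fun_cong[OF frechet_derivative_at[OF this]] show ?thesis by (rule sym)
qed

lemma C_nat_on_swap:
  fixes F :: "'a::euclidean_space \<times> 'b::euclidean_space \<Rightarrow> 'c::real_normed_vector"
  assumes "C_nat_on k (S \<times> T) F" "open S" "open T"
  shows "C_nat_on k (T \<times> S) (\<lambda>z. F (prod.swap z))"
proof -
  have "bounded_linear (prod.swap :: 'b \<times> 'a \<Rightarrow> 'a \<times> 'b)"
    unfolding prod.swap_def by (intro bounded_linear_Pair bounded_linear_snd bounded_linear_fst)
  with assms show ?thesis
    by (intro C_nat_on_compose[OF _ assms(1)] C_nat_on_bounded_linear) (auto intro: open_Times)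
qed

context smooth_cost
begin

lemma swap: "smooth_cost Y X (\<lambda>y x. c x y)"
proof
  fix y x assume xy: "y \<in> points Y" "x \<in> points X"
  obtain U \<phi> where x: "(U, \<phi>) \<in> X" "x \<in> U" using xy(2) by (rule pointsE)
  obtain V \<psi> where y: "(V, \<psi>) \<in> Y" "y \<in> V" using xy(1) by (rule pointsE)
  obtain S T where ST: "open S" "\<phi> x \<in> S" "S \<subseteq> \<phi> ` U" "open T" "\<psi> y \<in> T" "T \<subseteq> \<psi> ` V"
    "C_nat_on 4 (S \<times> T) (local_cost U \<phi> V \<psi>)" by (rule local_cost_smooth[OF x y])
  have inj: "inj_on \<phi> U" "inj_on \<psi> V" using smooth_atlasD X Y x y by blast+
  have ch: "(V \<times> U, map_prod \<psi> \<phi>) \<in> product_atlas Y X" using x y unfolding product_atlas_def by blast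
  have o: "open (T \<times> S)" using ST by (intro open_Times)
  have p: "(y, x) \<in> V \<times> U" using x y by simp
  have "C_nat_on 4 (T \<times> S) ((\<lambda>(y, x). c x y) \<circ> inv_into (V \<times> U) (map_prod \<psi> \<phi>))"
    by (rule C_nat_on_cong[OF o _ C_nat_on_swap[OF ST(7,1,4)]])
      (use ST inj in \<open>auto simp: local_cost_def inv_into_map_prod subset_iff\<close>)
  then have "C_on 4 (T \<times> S) ((\<lambda>(y, x). c x y) \<circ> inv_into (V \<times> U) (map_prod \<psi> \<phi>))"
    by (simp only: C_on_numeral)
  then show "C_near 4 (product_atlas Y X) (y, x) (\<lambda>(y, x). c x y)"
    unfolding C_near_iff[OF smooth_atlas_product[OF Y X] ch p]
    using ST o map_prod_surj_on[of \<psi> V "\<psi> ` V" \<phi> U "\<phi> ` U"] by (intro exI[of _ "T \<times> S"]) auto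
qed (rule Y X)+

lemma C_near_cost: 
  assumes "x \<in> points X" "y \<in> points Y"
  shows "C_near 4 X x (\<lambda>x'. c x' y)"
proof -
  obtain U \<phi> where x: "(U, \<phi>) \<in> X" "x \<in> U" using assms(1) by (rule pointsE)
  obtain V \<psi> where y: "(V, \<psi>) \<in> Y" "y \<in> V" using assms(2) by (rule pointsE)
  obtain S T where ST: "open S" "\<phi> x \<in> S" "S \<subseteq> \<phi> ` U" "open T" "\<psi> y \<in> T" "T \<subseteq> \<psi> ` V"
    "C_nat_on 4 (S \<times> T) (local_cost U \<phi> V \<psi>)" by (rule local_cost_smooth[OF x y])
  show ?thesis using local_cost_derivatives(1)[OF x y ST(1-7) ST(5)] smooth_atlasD(1)[OF Y y(1)] y(2) by simp
qed

lemma C_near_1_cost: "x \<in> points X \<Longrightarrow> y \<in> points Y \<Longrightarrow> C_near 1 X x (\<lambda>x'. c x' y)"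
  by (rule C_near_mono[OF C_near_cost]) (simp_all add: one_enat_def numeral_eq_enat)

lemma C_near_tangent_cost: 
  assumes "x \<in> points X" "y \<in> points Y" "u \<in> tangent_space X x"
  shows "C_near 3 Y y (\<lambda>y'. u (\<lambda>x'. c x' y'))"
proof -
  obtain U \<phi> where x: "(U, \<phi>) \<in> X" "x \<in> U" using assms(1) by (rule pointsE)
  obtain V \<psi> where y: "(V, \<psi>) \<in> Y" "y \<in> V" using assms(2) by (rule pointsE)
  obtain S T where ST: "open S" "\<phi> x \<in> S" "S \<subseteq> \<phi> ` U" "open T" "\<psi> y \<in> T" "T \<subseteq> \<psi> ` V"
    "C_nat_on 4 (S \<times> T) (local_cost U \<phi> V \<psi>)" by (rule local_cost_smooth[OF x y])
  obtain a where "u = chart_vector X U \<phi> x a" using assms(3) unfolding tangent_space_eq[OF X x] by blast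
  then show ?thesis using local_cost_derivatives(3)[OF x y ST] by simp
qed

text \<open>On the left the derivative in \<open>y\<close> is taken first, which belongs to the
  local cost with its variables exchanged. Undoing the exchange turns both sides into mixed
  derivatives of one function on the product of the chart images, where
  \<open>mixed_derivatives_commute\<close> applies.\<close>

lemma tangent_derivatives_commute:
  assumes "x \<in> points X" "y \<in> points Y" "u \<in> tangent_space X x" "v \<in> tangent_space Y y"
  shows "u (\<lambda>x'. v (\<lambda>y'. c x' y')) = v (\<lambda>y'. u (\<lambda>x'. c x' y'))"
proof -
  obtain U \<phi> where x: "(U, \<phi>) \<in> X" "x \<in> U" using assms(1) by (rule pointsE)
  obtain V \<psi> where y: "(V, \<psi>) \<in> Y" "y \<in> V" using assms(2) by (rule pointsE)
  obtain S T where ST: "open S" "\<phi> x \<in> S" "S \<subseteq> \<phi> ` U" "open T" "\<psi> y \<in> T" "T \<subseteq> \<psi> ` V"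
    "C_nat_on 4 (S \<times> T) (local_cost U \<phi> V \<psi>)" by (rule local_cost_smooth[OF x y])
  obtain a where a: "u = chart_vector X U \<phi> x a" using assms(3) unfolding tangent_space_eq[OF X x] by blast
  obtain b where b: "v = chart_vector Y V \<psi> y b" using assms(4) unfolding tangent_space_eq[OF Y y] by blast
  interpret s: smooth_cost Y X "\<lambda>y x. c x y" by (rule swap)
  let ?F = "local_cost U \<phi> V \<psi>"
  let ?G = "s.local_cost V \<psi> U \<phi>"
  have G: "?G = (\<lambda>z. ?F (prod.swap z))" by (simp add: local_cost_def s.local_cost_def prod.swap_def)
  have G4: "C_nat_on 4 (T \<times> S) ?G" unfolding G by (rule C_nat_on_swap[OF ST(7,1,4)])
  have o: "open (S \<times> T)" "open (T \<times> S)" using ST by (auto intro: open_Times)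
  have F1: "?F differentiable (at z)" if "z \<in> S \<times> T" for z
    by (rule C_nat_on_1_differentiable[OF C_nat_on_mono[OF ST(7)] that]) simp
  let ?D = "\<lambda>z. frechet ?F z (0, b)"
  have D1: "?D differentiable (at z)" if "z \<in> S \<times> T" for z
  proof -
    have "C_nat_on 3 (S \<times> T) ?D" by (rule C_nat_on_derivative) (use ST(7) in \<open>simp add: eval_nat_numeral\<close>)
    from C_nat_on_1_differentiable[OF C_nat_on_mono[OF this] that] show ?thesis by simp
  qed
  have e: "frechet ?G z (b, 0) = ?D (prod.swap z)" if "z \<in> T \<times> S" for z
    unfolding G by (subst frechet_derivative_swap[OF F1]) (use that in auto)
  have "u (\<lambda>x'. v (\<lambda>y'. c x' y')) =
    frechet (\<lambda>z. frechet ?G z (b, 0)) (\<psi> y, \<phi> x) (0, a)"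
    unfolding a b by (rule s.local_cost_derivatives(4)[OF y x ST(4-6) ST(1-3) G4])
  also have "\<dots> = frechet (\<lambda>z. ?D (prod.swap z)) (\<psi> y, \<phi> x) (0, a)"
  proof -
    have "(\<lambda>z. frechet ?G z (b, 0)) differentiable (at (\<psi> y, \<phi> x))"
    proof -
      have "C_nat_on 3 (T \<times> S) (\<lambda>z. frechet ?G z (b, 0))"
        by (rule C_nat_on_derivative) (use G4 in \<open>simp add: eval_nat_numeral\<close>)
      from C_nat_on_1_differentiable[OF C_nat_on_mono[OF this]] show ?thesis using ST by simp
    qed
    from frechet_derivative_transform_within_open[OF this o(2) _ e] ST show ?thesis by simp
  qed
  also have "\<dots> = frechet ?D (\<phi> x, \<psi> y) (a, 0)"
    by (subst frechet_derivative_swap) (use D1 ST in auto)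
  also have "\<dots> = frechet (\<lambda>z. frechet ?F z (a, 0)) (\<phi> x, \<psi> y) (0, b)"
    by (rule mixed_derivatives_commute[OF o(1) C_nat_on_mono[OF ST(7)]]) (use ST in auto)
  also have "\<dots> = v (\<lambda>y'. u (\<lambda>x'. c x' y'))"
    unfolding a b by (rule local_cost_derivatives(4)[OF x y ST, symmetric])
  finally show ?thesis .
qed

end

subsection \<open>The quotient\<close>

lemma C_on_chart_image:
  assumes A: "smooth_atlas A" "(U, \<phi>) \<in> A" and f: "\<And>x. x \<in> U \<Longrightarrow> C_near k A x f"
  shows "C_on k (\<phi> ` U) (f \<circ> inv_into U \<phi>)"
proof (rule C_on_local)
  fix s assume "s \<in> \<phi> ` U"
  then obtain x where x: "x \<in> U" "s = \<phi> x" by auto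
  show "\<exists>T. open T \<and> s \<in> T \<and> C_on k T (f \<circ> inv_into U \<phi>)"
    using f[OF x(1)] unfolding C_near_iff[OF A x(1)] x(2) by blast
qed

lemma C_near_uminus:
  assumes "smooth_atlas A" "p \<in> points A" "C_near k A p f"
  shows "C_near k A p (\<lambda>x. - f x)"
proof -
  obtain U \<phi> where ch: "(U, \<phi>) \<in> A" "p \<in> U" using assms(2) by (rule pointsE)
  obtain T where T: "open T" "\<phi> p \<in> T" "T \<subseteq> \<phi> ` U" "C_on k T (f \<circ> inv_into U \<phi>)"
    using assms(3) unfolding C_near_iff[OF assms(1) ch] by blast
  have "C_on k T ((\<lambda>x. - f x) \<circ> inv_into U \<phi>)"
    using T(4) unfolding C_on_def o_def by (intro allI impI C_nat_on_uminus[OF T(1)]) simp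
  then show ?thesis unfolding C_near_iff[OF assms(1) ch] using T by blast
qed

lemma basis_at_nonzero:
  fixes a :: "real ^ 'n"
  assumes e: "basis_at B y e" "(\<lambda>f. \<Sum>i\<in>UNIV. a $ i * e i f) = (\<lambda>f. 0)" and 0: "(\<lambda>f. 0) \<in> tangent_space B y"
  shows "a = 0"
proof -
  have "\<exists>!a::real^'n. (\<lambda>f. 0) = (\<lambda>f. \<Sum>i\<in>UNIV. a $ i * e i f)"
    using e(1) 0 unfolding basis_at_def by blast
  moreover have "(\<lambda>f. 0) = (\<lambda>f. \<Sum>i\<in>UNIV. a $ i * e i f)" using e(2) by simp
  moreover have "(\<lambda>f. 0) = (\<lambda>f. \<Sum>i\<in>UNIV. (0::real^'n) $ i * e i f)" by simp
  ultimately show ?thesis by blast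
qed

lemma tangent_space_sum:
  assumes "smooth_atlas A" "p \<in> points A" "\<And>i. i \<in> I \<Longrightarrow> u i \<in> tangent_space A p"
  shows "(\<lambda>f. \<Sum>i\<in>I. r i * u i f) \<in> tangent_space A p"
proof -
  obtain U \<phi> where ch: "(U, \<phi>) \<in> A" "p \<in> U" using assms(2) by (rule pointsE)
  have "\<forall>i\<in>I. \<exists>a. u i = chart_vector A U \<phi> p a"
    using assms(3) unfolding tangent_space_eq[OF assms(1) ch] by blast
  then obtain a where a: "\<And>i. i \<in> I \<Longrightarrow> u i = chart_vector A U \<phi> p (a i)" by metis
  have "(\<lambda>f. \<Sum>i\<in>I. r i * u i f) = chart_vector A U \<phi> p (\<Sum>i\<in>I. r i *\<^sub>R a i)"
    unfolding chart_vector_sum[OF assms(1) ch] using a by (simp cong: sum.cong)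
  then show ?thesis unfolding tangent_space_eq[OF assms(1) ch] by simp
qed

lemma tangent_space_0: "smooth_atlas A \<Longrightarrow> p \<in> points A \<Longrightarrow> (\<lambda>f. 0) \<in> tangent_space A p"
  using tangent_space_sum[of A p "{}"] by simp

lemma locally_constant_imp_constant:
  assumes "connected_space T" "y0 \<in> topspace T" "y \<in> topspace T"
    and loc: "\<And>y. y \<in> topspace T \<Longrightarrow> \<exists>W. openin T W \<and> y \<in> W \<and> (\<forall>y'\<in>W. h y' = h y)"
  shows "h y = h y0"
proof (rule ccontr)
  assume neq: "h y \<noteq> h y0"
  let ?A = "{y \<in> topspace T. h y = h y0}" and ?B = "{y \<in> topspace T. h y \<noteq> h y0}"
  have o: "openin T {y \<in> topspace T. P (h y)}" (is "openin T ?S") for P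
    unfolding openin_subopen[of T ?S]
  proof
    fix y assume y: "y \<in> ?S"
    then obtain W where W: "openin T W" "y \<in> W" "\<forall>y'\<in>W. h y' = h y" using loc by blast
    have "W \<subseteq> ?S"
    proof
      fix y' assume y': "y' \<in> W"
      then have "h y' = h y" using W(3) by blast
      then show "y' \<in> ?S" using y subsetD[OF openin_subset[OF W(1)] y'] by simp
    qed
    then show "\<exists>T'. openin T T' \<and> y \<in> T' \<and> T' \<subseteq> ?S" using W by blast
  qed
  have "openin T ?A" "openin T ?B" by (rule o)+
  moreover have "topspace T \<subseteq> ?A \<union> ?B" "?A \<inter> ?B = {}" "?A \<noteq> {}" "?B \<noteq> {}" using assms(2,3) neq by auto
  ultimately show False using assms(1) unfolding connected_space_def by blast
qed

text \<open>On a ball inside a chart the difference has zero derivative, and convexity of the ball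
  makes it constant. Connectedness of the manifold is brought in separately.\<close>

lemma chart_coincide_locally:
  fixes f g :: "'b \<Rightarrow> real"
  assumes A: "smooth_atlas A" and y: "y \<in> points A"
    and f: "\<And>y. y \<in> points A \<Longrightarrow> C_near 1 A y f" and g: "\<And>y. y \<in> points A \<Longrightarrow> C_near 1 A y g"
    and eq: "\<And>y u. y \<in> points A \<Longrightarrow> u \<in> tangent_space A y \<Longrightarrow> u f = u g"
  shows "\<exists>W. openin (manifold_topology A) W \<and> y \<in> W \<and> (\<forall>y'\<in>W. f y' - g y' = f y - g y)"
proof -
  obtain V \<psi> where ch: "(V, \<psi>) \<in> A" "y \<in> V" using y by (rule pointsE)
  note o = smooth_atlasD[OF A ch(1)]
  obtain r where r: "0 < r" "ball (\<psi> y) r \<subseteq> \<psi> ` V" using o(2) ch(2) open_contains_ball by blast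
  let ?h = "\<lambda>t. (f \<circ> inv_into V \<psi>) t - (g \<circ> inv_into V \<psi>) t"
  have d: "(?h has_derivative (\<lambda>_. 0)) (at t within ball (\<psi> y) r)" if t: "t \<in> ball (\<psi> y) r" for t
  proof -
    obtain y' where y': "y' \<in> V" "t = \<psi> y'" using r(2) t by blast
    note p = pointsI[OF ch(1) y'(1)]
    have "frechet (f \<circ> inv_into V \<psi>) t a = frechet (g \<circ> inv_into V \<psi>) t a" for a
      using eq[OF p, of "chart_vector A V \<psi> y' a"] f[OF p] g[OF p] y'(2)
      by (simp add: tangent_space_eq[OF A ch(1) y'(1)] chart_vector_def)
    then have "frechet (f \<circ> inv_into V \<psi>) t = frechet (g \<circ> inv_into V \<psi>) t" by blast
    then have "(?h has_derivative (\<lambda>a. frechet (f \<circ> inv_into V \<psi>) t a - frechet (f \<circ> inv_into V \<psi>) t a)) (at t)"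
      using C_near_1_has_derivative[OF A ch(1) y'(1) f[OF p]] C_near_1_has_derivative[OF A ch(1) y'(1) g[OF p]] y'(2)
      by (intro has_derivative_diff) (auto simp: o_def)
    then show ?thesis by (simp add: has_derivative_at_withinI)
  qed
  have "\<exists>k. \<forall>t\<in>ball (\<psi> y) r. ?h t = k"
    by (rule has_derivative_zero_constant[OF convex_ball d])
  then obtain k where k: "\<And>t. t \<in> ball (\<psi> y) r \<Longrightarrow> ?h t = k" by blast
  have "f y' - g y' = k" if "y' \<in> V" "\<psi> y' \<in> ball (\<psi> y) r" for y'
    using k[OF that(2)] that(1) o(1) by simp
  moreover have "\<psi> y \<in> ball (\<psi> y) r" using r(1) by simp
  ultimately show ?thesis
    using openin_chart_preimage[OF ch(1) open_ball, of "\<psi> y" r] ch(2)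
    by (intro exI[of _ "{y' \<in> V. \<psi> y' \<in> ball (\<psi> y) r}"]) auto
qed

text \<open>The common ground of \<open>X\<close> inside itself and of an embedded surface, so that
  the comparison with the reduced cost is proved once for both.\<close>

definition smooth_inclusion where
  "smooth_inclusion S A \<longleftrightarrow> smooth_atlas S \<and> smooth_transitions S A \<and> points S \<subseteq> points A"

locale reduction = smooth_cost X Y c
  for X :: "('a, real ^ 'm::finite) atlas" and Y :: "('b, real ^ 'n::finite) atlas" and c +
  fixes y\<^sub>0 :: 'b and b :: "'a set \<Rightarrow> 'b \<Rightarrow> real"
  assumes y0: "y\<^sub>0 \<in> points Y" and twist: "twisted X (points Y) c" and nondeg: "nondegenerate X Y c"
    and conn: "connected_space (manifold_topology Y)" and red: "reduced_cost X Y c y\<^sub>0 b"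
begin

interpretation yx: smooth_cost Y X "\<lambda>y x. c x y" by (rule swap)

section \<open>Leaves and the explicit formula for the reduced cost\<close>

definition "leaf x = level_set X Y c x y\<^sub>0"

definition "Zchart e z = (\<chi> i. leaf_covector Y c y\<^sub>0 z (e i))" for e :: "'n \<Rightarrow> 'b tangent"

abbreviation "Z \<equiv> quotient_atlas X Y c y\<^sub>0"
abbreviation "Zset \<equiv> leaves X Y c y\<^sub>0"

lemma mem_leaf: "x' \<in> leaf x \<longleftrightarrow> x' \<in> points X \<and> Dy Y c x' y\<^sub>0 = Dy Y c x y\<^sub>0"
  by (simp add: leaf_def level_set_def)

lemma leaf_self: "x \<in> points X \<Longrightarrow> x \<in> leaf x" by (simp add: mem_leaf)

lemma leaf_eq: "x' \<in> leaf x \<Longrightarrow> leaf x' = leaf x" by (auto simp: mem_leaf leaf_def level_set_def)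

lemma leaves_eq: "Zset = leaf ` points X"
  unfolding leaves_def quotient_def by (auto simp: leaf_def level_set_def)

lemma Zcharts: "(W, \<theta>) \<in> Z \<longleftrightarrow> (\<exists>e. basis_at Y y\<^sub>0 e \<and> W = Zset \<and> \<theta> = Zchart e)"
  unfolding quotient_atlas_def Zchart_def by auto

lemma ZchartI: "basis_at Y y\<^sub>0 e \<Longrightarrow> (Zset, Zchart e) \<in> Z"
  by (auto simp: Zcharts)

lemma tangent_apply_b:
  assumes "x \<in> points X" "y \<in> points Y" "v \<in> tangent_space Y y"
  shows "v (b (leaf x)) = v (c x)"
proof -
  have "Dy Y b (leaf x) y = Dy Y c x y"
    using red assms leaf_self[OF assms(1)] unfolding reduced_cost_def leaves_eq by blast
  from fun_cong[OF this, of v] show ?thesis using assms(3) by (simp add: Dy_def differential_def)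
qed

text \<open>The y-differentials of \<open>b (leaf x)\<close> and \<open>c x\<close> agree by the
  definition of the reduced cost, so the difference is locally constant on \<open>Y\<close>; the
  normalisation at \<open>y\<^sub>0\<close> fixes the constant.\<close>

lemma b_leaf:
  assumes x: "x \<in> points X" and y: "y \<in> points Y"
  shows "b (leaf x) y = c x y - c x y\<^sub>0"
proof -
  have "b (leaf x) y - c x y = b (leaf x) y\<^sub>0 - c x y\<^sub>0"
  proof (rule locally_constant_imp_constant[OF conn])
    fix y assume "y \<in> topspace (manifold_topology Y)"
    then have y: "y \<in> points Y" by simp
    show "\<exists>W. openin (manifold_topology Y) W \<and> y \<in> W \<and> (\<forall>y'\<in>W. b (leaf x) y' - c x y' = b (leaf x) y - c x y)"
    proof (rule chart_coincide_locally[OF Y y])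
      show "C_near 1 Y y (b (leaf x))" if "y \<in> points Y" for y
        using red x that unfolding reduced_cost_def leaves_eq by blast
      show "C_near 1 Y y (c x)" if "y \<in> points Y" for y by (rule yx.C_near_1_cost[OF that x])
    qed (rule tangent_apply_b[OF x])
  qed (use y y0 in auto)
  moreover have "b (leaf x) y\<^sub>0 = 0" using red x unfolding reduced_cost_def leaves_eq by blast
  ultimately show ?thesis by simp
qed

lemma leaf_covector_leaf: 
  assumes "x \<in> points X"
  shows "leaf_covector Y c y\<^sub>0 (leaf x) = Dy Y c x y\<^sub>0"
proof -
  have "(SOME x'. x' \<in> leaf x) \<in> leaf x" by (rule someI) (rule leaf_self[OF assms])
  then show ?thesis by (simp add: leaf_covector_def mem_leaf)
qed

lemma basis_tangent: "basis_at Y y\<^sub>0 e \<Longrightarrow> e i \<in> tangent_space Y y\<^sub>0"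
  by (simp add: basis_at_def)

lemma Zchart_leaf:
  assumes "basis_at Y y\<^sub>0 e" "x \<in> points X"
  shows "Zchart e (leaf x) $ i = e i (c x)"
  using basis_tangent[OF assms(1)] by (simp add: Zchart_def leaf_covector_leaf[OF assms(2)] Dy_def differential_def)

lemma basis_exists: "\<exists>e. basis_at Y y\<^sub>0 (e :: 'n \<Rightarrow> 'b tangent)"
proof -
  obtain V \<psi> where ch: "(V, \<psi>) \<in> Y" "y\<^sub>0 \<in> V" using y0 by (rule pointsE)
  let ?e = "\<lambda>i. chart_vector Y V \<psi> y\<^sub>0 (axis i 1)"
  have eq: "(\<lambda>f. \<Sum>i\<in>UNIV. a $ i * ?e i f) = chart_vector Y V \<psi> y\<^sub>0 a" for a
    using chart_vector_sum[OF Y ch, of "\<lambda>i. a $ i" "\<lambda>i. axis i 1" UNIV] basis_expansion[of a]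
    by (simp add: scalar_mult_eq_scaleR)
  have "basis_at Y y\<^sub>0 ?e"
    unfolding basis_at_def eq tangent_space_eq[OF Y ch] using chart_vector_inj[OF Y ch] by blast
  then show ?thesis by blast
qed

text \<open>A leaf is determined by its covector at \<open>y\<^sub>0\<close>, and a covector by its
  values on a basis.\<close>

lemma Zchart_inj: "basis_at Y y\<^sub>0 e \<Longrightarrow> inj_on (Zchart e) Zset"
proof (rule inj_onI)
  fix z z' assume e: "basis_at Y y\<^sub>0 e" and z: "z \<in> Zset" "z' \<in> Zset" and eq: "Zchart e z = Zchart e z'"
  obtain x x' where x: "x \<in> points X" "z = leaf x" "x' \<in> points X" "z' = leaf x'" using z leaves_eq by auto
  have ei: "e i (c x) = e i (c x')" for i
    using Zchart_leaf[OF e x(1), of i] Zchart_leaf[OF e x(3), of i] eq x by simp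
  have "Dy Y c x y\<^sub>0 v = Dy Y c x' y\<^sub>0 v" for v
  proof (cases "v \<in> tangent_space Y y\<^sub>0")
    case True
    then obtain a :: "real^'n" where "v = (\<lambda>f. \<Sum>i\<in>UNIV. a $ i * e i f)"
      using e unfolding basis_at_def by blast
    then show ?thesis using ei by (simp add: Dy_def differential_def)
  qed (simp add: Dy_def differential_def)
  then show "z = z'" unfolding x leaf_def level_set_def by auto
qed

lemma Z_points: "points Z = Zset"
  using basis_exists Zcharts by (auto simp: points_def)

section \<open>The quotient map in charts\<close>

definition "coord e U \<phi> = (\<lambda>s. Zchart e (leaf (inv_into U \<phi> s)))"

abbreviation "dcoord e U \<phi> x \<equiv> frechet (coord e U \<phi>) (\<phi> x)"
abbreviation "Zvector e x \<equiv> chart_vector Z Zset (Zchart e) (leaf x)"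

text \<open>\<open>coord\<close> is \<open>Q\<close> read in a chart of a submanifold and in the
  basis \<open>e\<close>. Its components are derivatives of \<open>c\<close> at
  \<open>y\<^sub>0\<close> in the directions \<open>e i\<close>, and this one derivative lowers the
  class from 4 to 3.\<close>

lemma coord_smooth:
  assumes inc: "smooth_inclusion S X" and ch: "(U, \<phi>) \<in> S" and e: "basis_at Y y\<^sub>0 e"
  shows "C_nat_on 3 (\<phi> ` U) (coord e U \<phi>)"
proof (rule C_nat_on_vec)
  have S: "smooth_atlas S" "smooth_transitions S X" "points S \<subseteq> points X"
    using inc by (simp_all add: smooth_inclusion_def)
  show o: "open (\<phi> ` U)" by (rule smooth_atlasD(2)[OF S(1) ch])
  fix i
  have "C_on 3 (\<phi> ` U) ((\<lambda>x. e i (c x)) \<circ> inv_into U \<phi>)"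
  proof (rule C_on_chart_image[OF S(1) ch])
    fix x assume x: "x \<in> U"
    then have xS: "x \<in> points S" "x \<in> points X" using pointsI[OF ch] S(3) by auto
    have "C_near 3 X x (\<lambda>x. e i (c x))"
      by (rule yx.C_near_tangent_cost[OF y0 xS(2) basis_tangent[OF e]])
    then obtain W where "x \<in> W" "C_fun_on 3 X W (\<lambda>x. e i (c x))" unfolding C_near_def by blast
    then show "C_near 3 S x (\<lambda>x. e i (c x))"
      by (rule C_near_transfer[OF X S(1,2) xS(2,1)]) simp
  qed
  then have "C_nat_on 3 (\<phi> ` U) ((\<lambda>x. e i (c x)) \<circ> inv_into U \<phi>)" by (simp only: C_on_numeral)
  then show "C_nat_on 3 (\<phi> ` U) (\<lambda>s. coord e U \<phi> s $ i)"
    by (rule C_nat_on_cong[OF o, rotated])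
      (use pointsI[OF ch] S(3) in \<open>auto simp: coord_def Zchart_leaf[OF e] inv_into_into subset_iff\<close>)
qed

lemma smooth_inclusion_refl: "smooth_inclusion X X"
  by (simp add: smooth_inclusion_def X smooth_transitions_refl)

lemma coord_derivative:
  assumes "smooth_inclusion S X" "(U, \<phi>) \<in> S" "p \<in> U" "basis_at Y y\<^sub>0 e"
  shows "(coord e U \<phi> has_derivative dcoord e U \<phi> p) (at (\<phi> p))"
proof (rule C_nat_on_has_derivative)
  show "C_nat_on (Suc 2) (\<phi> ` U) (coord e U \<phi>)"
    using coord_smooth[OF assms(1,2,4)] by (simp add: eval_nat_numeral)
qed (use assms(3) in simp)

text \<open>Surjectivity of \<open>DQ\<close> is the transpose of non-degeneracy. A vector
  \<open>l\<close> orthogonal to the range of \<open>DQ\<close> yields the tangent vector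
  \<open>v\<close> of \<open>Y\<close> with components \<open>l\<close> in the basis
  \<open>e\<close>; by the symmetry of mixed derivatives \<open>v\<close> is annihilated by
  \<open>Dxy X c x y\<^sub>0\<close>, so it is zero.\<close>

lemma coord_submersion:
  assumes ch: "(U, \<phi>) \<in> X" "x \<in> U" and e: "basis_at Y y\<^sub>0 e"
  shows "surj (dcoord e U \<phi> x)"
proof (rule ccontr)
  let ?L = "dcoord e U \<phi> x"
  assume "\<not> surj ?L"
  note p = pointsI[OF ch]
  have hd: "(coord e U \<phi> has_derivative ?L) (at (\<phi> x))"
    by (rule coord_derivative[OF smooth_inclusion_refl ch e])
  have "subspace (range ?L)"
    using linear_subspace_image[OF has_derivative_linear[OF hd]] by simp
  then have "span (range ?L) \<noteq> UNIV" using \<open>\<not> surj ?L\<close> by (metis span_eq_iff)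
  then obtain l where l: "l \<noteq> 0" "\<And>w. w \<in> span (range ?L) \<Longrightarrow> orthogonal l w"
    using orthogonal_to_subspace_exists_gen[of "range ?L" UNIV] by (auto simp: psubset_eq)
  have l0: "l \<bullet> ?L a = 0" for a using l(2)[OF span_base] by (simp add: orthogonal_def)
  define v where "v = (\<lambda>f. \<Sum>i\<in>UNIV. l $ i * e i f)"
  have v: "v \<in> tangent_space Y y\<^sub>0"
    unfolding v_def by (rule tangent_space_sum[OF Y y0]) (rule basis_tangent[OF e])
  have "Dxy X c x y\<^sub>0 v u = 0" for u
  proof (cases "u \<in> tangent_space X x")
    case True
    then obtain a where a: "u = chart_vector X U \<phi> x a" unfolding tangent_space_eq[OF X ch] by blast
    have "v (\<lambda>y'. u (\<lambda>x'. c x' y')) = u (\<lambda>x'. v (c x'))"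
      by (rule tangent_derivatives_commute[OF p y0 True v, symmetric])
    moreover have "((\<lambda>s. l \<bullet> coord e U \<phi> s) has_derivative (\<lambda>a. l \<bullet> ?L a)) (at (\<phi> x))"
      by (rule bounded_linear.has_derivative[OF bounded_linear_inner_right hd])
    then have "((\<lambda>s. l \<bullet> coord e U \<phi> s) has_derivative (\<lambda>a. 0)) (at (\<phi> x))" by (simp add: l0)
    then have "(((\<lambda>x'. v (c x')) \<circ> inv_into U \<phi>) has_derivative (\<lambda>a. 0)) (at (\<phi> x))"
      by (rule has_derivative_transform_within_open[OF _ smooth_atlasD(2)[OF X ch(1)]])
        (use ch pointsI[OF ch(1)] smooth_atlasD(1)[OF X ch(1)] in \<open>auto simp: coord_def v_def inner_vec_def Zchart_leaf[OF e]\<close>)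
    then have "u (\<lambda>x'. v (c x')) = 0"
      unfolding a chart_vector_def by (simp flip: frechet_derivative_at)
    ultimately show ?thesis using True by (simp add: Dxy_def)
  qed (simp add: Dxy_def)
  moreover have "Dxy X c x y\<^sub>0 (\<lambda>f. 0) u = 0" for u by (simp add: Dxy_def)
  ultimately have "Dxy X c x y\<^sub>0 v = Dxy X c x y\<^sub>0 (\<lambda>f. 0)" by (intro ext) simp
  then have "v = (\<lambda>f. 0)"
    using nondeg p y0 v tangent_space_0[OF Y y0] unfolding nondegenerate_def by (blast dest: inj_onD)
  then have "l = 0" using basis_at_nonzero[OF e _ tangent_space_0[OF Y y0]] by (simp add: v_def)
  then show False using l(1) by simp
qed

lemma coord_straightening:
  assumes ch: "(U, \<phi>) \<in> X" "x \<in> U" and e: "basis_at Y y\<^sub>0 e"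
  obtains V g where "open V" "\<phi> x \<in> V" "C_nat_on 3 V g" "g (\<phi> x) = \<phi> x" "g ` V \<subseteq> \<phi> ` U"
    "(g has_derivative (\<lambda>h. h)) (at (\<phi> x))"
    "\<And>v. v \<in> V \<Longrightarrow> coord e U \<phi> (g v) = coord e U \<phi> (\<phi> x) + dcoord e U \<phi> x (v - \<phi> x)"
proof -
  have q: "C_nat_on (Suc 2) (\<phi> ` U) (coord e U \<phi>)"
    using coord_smooth[OF smooth_inclusion_refl ch(1) e] by (simp add: eval_nat_numeral)
  have "\<phi> x \<in> \<phi> ` U" using ch by simp
  from submersion_straightening[OF q smooth_atlasD(2)[OF X ch(1)] this coord_submersion[OF ch e]]
  obtain V g where "open V" "\<phi> x \<in> V" "C_nat_on (Suc 2) V g" "g (\<phi> x) = \<phi> x" "g ` V \<subseteq> \<phi> ` U"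
    "(g has_derivative (\<lambda>h. h)) (at (\<phi> x))"
    "\<And>v. v \<in> V \<Longrightarrow> coord e U \<phi> (g v) = coord e U \<phi> (\<phi> x) + dcoord e U \<phi> x (v - \<phi> x)"
    by blast
  then show ?thesis by (intro that[of V g]) (simp_all add: eval_nat_numeral)
qed

text \<open>The affine map \<open>\<tau>\<close>, built from a right inverse of \<open>DQ\<close>,
  is followed by the straightening map, along which \<open>Q\<close> is affine. Such sections show
  that the chart images of \<open>Z\<close> are open, and they let functions on \<open>Z\<close> be
  computed on \<open>X\<close>.\<close>

lemma local_section:
  assumes ch: "(U, \<phi>) \<in> X" "x \<in> U" and e: "basis_at Y y\<^sub>0 e"
  obtains N \<sigma> where "open N" "Zchart e (leaf x) \<in> N" "C_nat_on 3 N \<sigma>" "\<sigma> ` N \<subseteq> \<phi> ` U"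
    "\<sigma> (Zchart e (leaf x)) = \<phi> x" "\<And>\<zeta>. \<zeta> \<in> N \<Longrightarrow> coord e U \<phi> (\<sigma> \<zeta>) = \<zeta>"
proof -
  obtain V g where g: "open V" "\<phi> x \<in> V" "C_nat_on 3 V g" "g (\<phi> x) = \<phi> x" "g ` V \<subseteq> \<phi> ` U"
    "(g has_derivative (\<lambda>h. h)) (at (\<phi> x))"
    "\<And>v. v \<in> V \<Longrightarrow> coord e U \<phi> (g v) = coord e U \<phi> (\<phi> x) + dcoord e U \<phi> x (v - \<phi> x)"
    by (rule coord_straightening[OF assms]) (rule that)
  let ?L = "dcoord e U \<phi> x"
  have "linear ?L"
    by (rule has_derivative_linear[OF coord_derivative[OF smooth_inclusion_refl ch e]])
  then obtain A where A: "linear A" "?L \<circ> A = id"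
    using linear_surjective_right_inverse coord_submersion[OF assms] by blast
  have LA: "?L (A w) = w" for w using A(2) by (metis comp_apply id_apply)
  define z0 where "z0 = Zchart e (leaf x)"
  have z0: "coord e U \<phi> (\<phi> x) = z0" using ch smooth_atlasD(1)[OF X ch(1)] by (simp add: coord_def z0_def)
  define \<tau> where "\<tau> = (\<lambda>\<zeta>. \<phi> x + A (\<zeta> - z0))"
  define N where "N = \<tau> -` V"
  have bA: "bounded_linear A" using A(1) by (simp add: linear_conv_bounded_linear)
  have C\<tau>: "C_nat_on k UNIV \<tau>" for k unfolding \<tau>_def
    by (intro C_nat_on_add[OF open_UNIV C_nat_on_const] C_nat_on_bounded_linear_compose[OF bA open_UNIV]
        C_nat_on_diff[OF open_UNIV C_nat_on_ident[OF open_UNIV] C_nat_on_const])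
  have N: "open N" unfolding N_def
    using C_nat_on_imp_continuous_on[OF C\<tau>] g(1) by (intro open_vimage) auto
  show ?thesis
  proof (rule that[of N "\<lambda>\<zeta>. g (\<tau> \<zeta>)"])
    show "C_nat_on 3 N (\<lambda>\<zeta>. g (\<tau> \<zeta>))"
      by (rule C_nat_on_compose[OF N g(3) C_nat_on_subset[OF C\<tau>]]) (auto simp: N_def)
    show "coord e U \<phi> (g (\<tau> \<zeta>)) = \<zeta>" if "\<zeta> \<in> N" for \<zeta>
      using g(7)[of "\<tau> \<zeta>"] that by (simp add: N_def z0 \<tau>_def LA)
  qed (use N g linear_0[OF A(1)] in \<open>auto simp: N_def \<tau>_def z0_def\<close>)
qed

section \<open>Smooth structure of the quotient\<close>

lemma open_Zchart_image:
  assumes e: "basis_at Y y\<^sub>0 e"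
  shows "open (Zchart e ` Zset)"
  unfolding open_subopen[of "Zchart e ` Zset"]
proof
  fix \<zeta> assume "\<zeta> \<in> Zchart e ` Zset"
  then obtain x where x: "x \<in> points X" "\<zeta> = Zchart e (leaf x)" using leaves_eq by auto
  obtain U \<phi> where ch: "(U, \<phi>) \<in> X" "x \<in> U" using x(1) by (rule pointsE)
  obtain N \<sigma> where N: "open N" "Zchart e (leaf x) \<in> N" "C_nat_on 3 N \<sigma>" "\<sigma> ` N \<subseteq> \<phi> ` U"
    "\<sigma> (Zchart e (leaf x)) = \<phi> x" "\<And>\<zeta>. \<zeta> \<in> N \<Longrightarrow> coord e U \<phi> (\<sigma> \<zeta>) = \<zeta>"
    by (rule local_section[OF ch e]) blast
  have "N \<subseteq> Zchart e ` Zset"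
  proof
    fix \<zeta> assume \<zeta>: "\<zeta> \<in> N"
    have "inv_into U \<phi> (\<sigma> \<zeta>) \<in> points X" using N(4) \<zeta> by (intro pointsI[OF ch(1)] inv_into_into) auto
    then show "\<zeta> \<in> Zchart e ` Zset" using N(6)[OF \<zeta>] unfolding coord_def leaves_eq by force
  qed
  then show "\<exists>T. open T \<and> \<zeta> \<in> T \<and> T \<subseteq> Zchart e ` Zset" using N x by blast
qed

lemma Zchart_change:
  assumes e: "basis_at Y y\<^sub>0 e" "basis_at Y y\<^sub>0 e'"
  obtains L where "linear L" "\<And>z. z \<in> Zset \<Longrightarrow> Zchart e' z = L (Zchart e z)"
proof -
  have "\<forall>j. \<exists>a::real^'n. e' j = (\<lambda>f. \<Sum>i\<in>UNIV. a $ i * e i f)"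
    using e basis_tangent[OF e(2)] unfolding basis_at_def by blast
  then obtain M where M: "\<And>j. e' j = (\<lambda>f. \<Sum>i\<in>UNIV. (M j :: real^'n) $ i * e i f)" by metis
  show ?thesis
  proof (rule that[of "\<lambda>w. (\<chi> j. M j) *v w"])
    fix z assume "z \<in> Zset"
    then obtain x where x: "x \<in> points X" "z = leaf x" using leaves_eq by auto
    show "Zchart e' z = (\<chi> j. M j) *v Zchart e z"
      by (simp add: vec_eq_iff x(2) Zchart_leaf[OF e(2) x(1)] Zchart_leaf[OF e(1) x(1)] matrix_vector_mult_def M)
  qed (rule matrix_vector_mul_linear)
qed

text \<open>The transition between two charts is a linear change of basis in the cotangent space at
  \<open>y\<^sub>0\<close>, so the atlas is smooth although \<open>Q\<close> is only C^3.\<close>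

lemma smooth_atlas_Z: "smooth_atlas Z"
  unfolding smooth_atlas_iff smooth_transitions_def
proof (intro conjI allI impI)
  fix U \<phi> V \<psi> assume "(U, \<phi>) \<in> Z" "(V, \<psi>) \<in> Z"
  then obtain e e' where e: "basis_at Y y\<^sub>0 e" "U = Zset" "\<phi> = Zchart e"
    and e': "basis_at Y y\<^sub>0 e'" "V = Zset" "\<psi> = Zchart e'" unfolding Zcharts by blast
  show o: "open (\<phi> ` (U \<inter> V))" unfolding e e' using open_Zchart_image[OF e(1)] by simp
  obtain L where L: "linear L" "\<And>z. z \<in> Zset \<Longrightarrow> Zchart e' z = L (Zchart e z)"
    by (rule Zchart_change[OF e(1) e'(1)]) blast
  have "C_nat_on k (\<phi> ` (U \<inter> V)) (\<psi> \<circ> inv_into U \<phi>)" for k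
    by (rule C_nat_on_cong[OF o _ C_nat_on_bounded_linear[OF _ o]])
      (use L Zchart_inj[OF e(1)] in \<open>auto simp: linear_conv_bounded_linear e e'\<close>)
  then show "C_on \<infinity> (\<phi> ` (U \<inter> V)) (\<psi> \<circ> inv_into U \<phi>)" by (simp add: C_on_infinity)
qed (auto simp: Zcharts Zchart_inj)

text \<open>In a quotient chart \<open>f\<close> is the pullback of \<open>f\<close> to
  \<open>X\<close> composed with a local section. The section is C^3, which bounds the class
  obtained.\<close>

lemma C_near_Z:
  assumes x: "x \<in> points X" and f: "C_near 3 X x (\<lambda>x. f (leaf x))"
  shows "C_near 3 Z (leaf x) f"
proof -
  obtain e :: "'n \<Rightarrow> 'b tangent" where e: "basis_at Y y\<^sub>0 e" using basis_exists by blast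
  obtain U \<phi> where ch: "(U, \<phi>) \<in> X" "x \<in> U" using x(1) by (rule pointsE)
  obtain N \<sigma> where N: "open N" "Zchart e (leaf x) \<in> N" "C_nat_on 3 N \<sigma>" "\<sigma> ` N \<subseteq> \<phi> ` U"
    "\<sigma> (Zchart e (leaf x)) = \<phi> x" "\<And>\<zeta>. \<zeta> \<in> N \<Longrightarrow> coord e U \<phi> (\<sigma> \<zeta>) = \<zeta>"
    by (rule local_section[OF ch e]) blast
  obtain T where T: "open T" "\<phi> x \<in> T" "T \<subseteq> \<phi> ` U" "C_nat_on 3 T ((\<lambda>x. f (leaf x)) \<circ> inv_into U \<phi>)"
    using f unfolding C_near_iff[OF X ch] C_on_numeral by blast
  define N' where "N' = {\<zeta> \<in> N. \<sigma> \<zeta> \<in> T}"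
  have N': "open N'" unfolding N'_def by (rule open_preimage_within[OF N(1) C_nat_on_imp_continuous_on[OF N(3)] T(1)])
  have lf: "leaf (inv_into U \<phi> (\<sigma> \<zeta>)) \<in> Zset" if "\<zeta> \<in> N" for \<zeta>
    unfolding leaves_eq using that N(4) by (intro imageI pointsI[OF ch(1)] inv_into_into) auto
  have iv: "inv_into Zset (Zchart e) \<zeta> = leaf (inv_into U \<phi> (\<sigma> \<zeta>))" if "\<zeta> \<in> N" for \<zeta>
    by (rule inv_into_f_eq[OF Zchart_inj[OF e] lf[OF that]]) (use N(6)[OF that] in \<open>simp add: coord_def\<close>)
  have "C_nat_on 3 N' (\<lambda>\<zeta>. ((\<lambda>x. f (leaf x)) \<circ> inv_into U \<phi>) (\<sigma> \<zeta>))"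
    by (rule C_nat_on_compose[OF N' T(4) C_nat_on_subset[OF N(3)]]) (auto simp: N'_def)
  then have "C_nat_on 3 N' (f \<circ> inv_into Zset (Zchart e))"
    by (rule C_nat_on_cong[OF N', rotated]) (simp add: N'_def iv)
  moreover have "N' \<subseteq> Zchart e ` Zset"
    using N(6) lf by (force simp: N'_def coord_def)
  moreover have "Zchart e (leaf x) \<in> N'" using N T by (simp add: N'_def)
  moreover have "leaf x \<in> Zset" using x leaves_eq by simp
  ultimately show ?thesis
    unfolding C_near_iff[OF smooth_atlas_Z ZchartI[OF e] \<open>leaf x \<in> Zset\<close>] C_on_numeral using N' by blast
qed

lemma C_near_1_b:
  assumes "x \<in> points X" "y \<in> points Y"
  shows "C_near 1 Z (leaf x) (\<lambda>z. b z y)"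
proof -
  have m: "C_near 3 X x (\<lambda>x. c x y)" if "y \<in> points Y" for y
    by (rule C_near_mono[OF C_near_cost[OF assms(1) that]]) (simp add: numeral_eq_enat)
  have "C_near 3 X x (\<lambda>x. c x y + - c x y\<^sub>0)"
    by (rule C_near_add[OF X assms(1) m[OF assms(2)] C_near_uminus[OF X assms(1) m[OF y0]]])
  then have "C_near 3 X x (\<lambda>x. b (leaf x) y)"
    by (rule iffD1[OF C_near_cong[OF X assms(1)], rotated]) (simp add: b_leaf assms(2))
  from C_near_mono[OF C_near_Z[OF assms(1) this]] show ?thesis
    by (simp add: numeral_eq_enat one_enat_def)
qed

end

subsection \<open>Second derivatives along a curve in the second variable\<close>

lemma frechet_derivative_partial_snd:
  "F differentiable (at (s, t)) \<Longrightarrow>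
    frechet (\<lambda>t. F (s, t)) t h = frechet F (s, t) (0, h)"
  using fun_cong[OF frechet_derivative_at[OF has_derivative_partial_snd]]
  by (metis frechet_derivative_works)

lemma C_nat_on_differentiable: "C_nat_on (Suc k) W f \<Longrightarrow> x \<in> W \<Longrightarrow> f differentiable (at x)"
  by simp

text \<open>This is \<open>deriv2_compose\<close> with \<open>s\<close> frozen, but expressed
  through joint derivatives of \<open>F\<close> at \<open>(s, \<gamma> 0)\<close>. In this form the
  dependence on \<open>s\<close> is explicit and can be differentiated further.\<close>

lemma deriv2_partial_compose:
  fixes F :: "'a::euclidean_space \<times> 'b::euclidean_space \<Rightarrow> real" and \<gamma> :: "real \<Rightarrow> 'b"
  assumes F: "C_nat_on 2 (P \<times> R) F" and R: "open R" and s: "s \<in> P"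
    and J: "open J" "0 \<in> J" and \<gamma>: "C_nat_on 2 J \<gamma>" "\<gamma> ` J \<subseteq> R"
  shows "(deriv ^^ 2) (\<lambda>t. F (s, \<gamma> t)) 0 =
    frechet F (s, \<gamma> 0) (0, frechet (\<lambda>t. frechet \<gamma> t 1) 0 1)
    + (\<Sum>i\<in>Basis. \<Sum>j\<in>Basis. (frechet \<gamma> 0 1 \<bullet> i) * (frechet \<gamma> 0 1 \<bullet> j)
        * frechet (\<lambda>z. frechet F z (0, i)) (s, \<gamma> 0) (0, j))"
proof -
  let ?f = "\<lambda>t. F (s, t)"
  have f: "C_nat_on 2 R ?f" by (rule C_nat_on_partial_snd[OF F R s])
  have F2: "C_nat_on (Suc (Suc 0)) (P \<times> R) F" using F by (simp only: numeral_2_eq_2)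
  have \<gamma>0: "\<gamma> 0 \<in> R" using \<gamma>(2) J(2) by auto
  have d1: "frechet ?f t h = frechet F (s, t) (0, h)" if "t \<in> R" for t h
    by (rule frechet_derivative_partial_snd[OF C_nat_on_differentiable[OF F2]]) (use s that in simp)
  have D2: "(\<lambda>z. frechet F z (0, i)) differentiable (at (s, \<gamma> 0))" for i
    by (rule C_nat_on_differentiable[OF C_nat_on_derivative[OF F2]]) (use s \<gamma>0 in simp)
  have d2: "frechet (\<lambda>t. frechet ?f t i) (\<gamma> 0) j
     = frechet (\<lambda>z. frechet F z (0, i)) (s, \<gamma> 0) (0, j)" for i j
  proof -
    have "(\<lambda>t. frechet ?f t i) differentiable (at (\<gamma> 0))"
      using f \<gamma>0 by (simp add: numeral_2_eq_2)
    then have "frechet (\<lambda>t. frechet ?f t i) (\<gamma> 0)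
      = frechet (\<lambda>t. frechet F (s, t) (0, i)) (\<gamma> 0)"
      by (rule frechet_derivative_transform_within_open[OF _ R \<gamma>0]) (rule d1)
    then show ?thesis using frechet_derivative_partial_snd[OF D2] by simp
  qed
  show ?thesis
    unfolding deriv2_compose[OF f J \<gamma>] d1[OF \<gamma>0] d2 ..
qed

text \<open>Since mixed derivatives commute, the second derivative along \<open>\<gamma>\<close> may be differentiated in
  the first variable under the derivative sign.\<close>

lemma deriv2_partial_differentiable:
  fixes F :: "'a::euclidean_space \<times> 'b::euclidean_space \<Rightarrow> real" and \<gamma> :: "real \<Rightarrow> 'b"
  assumes F: "C_nat_on 4 (P \<times> R) F" and P: "open P" and R: "open R"
    and J: "open J" "0 \<in> J" and \<gamma>: "C_nat_on 2 J \<gamma>" "\<gamma> ` J \<subseteq> R"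
  shows "C_nat_on 2 P (\<lambda>s. (deriv ^^ 2) (\<lambda>t. F (s, \<gamma> t)) 0)"
    and "s \<in> P \<Longrightarrow> frechet (\<lambda>s. (deriv ^^ 2) (\<lambda>t. F (s, \<gamma> t)) 0) s h
      = (deriv ^^ 2) (\<lambda>t. frechet F (s, \<gamma> t) (h, 0)) 0"
proof -
  \<comment> \<open>\<open>\<gamma>\<close> enters only through its velocity \<open>g1\<close> and
    acceleration \<open>g2\<close> at 0. Hence a C^2 curve suffices, and the result loses just two
    of the four derivatives of \<open>F\<close>.\<close>
  define g1 where "g1 = frechet \<gamma> 0 1"
  define g2 where "g2 = frechet (\<lambda>t. frechet \<gamma> t 1) 0 1"
  let ?D = "\<lambda>F k z. frechet F z k"
  have o: "open (P \<times> R)" using P R by (rule open_Times)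
  have \<gamma>0: "\<gamma> 0 \<in> R" using \<gamma>(2) J(2) by auto
  have F1: "C_nat_on (Suc 3) (P \<times> R) F" using F by (simp add: eval_nat_numeral)
  have D1: "C_nat_on (Suc 2) (P \<times> R) (?D F k)" for k
    using C_nat_on_derivative[OF F1] by (simp add: eval_nat_numeral)
  have D2: "C_nat_on (Suc 1) (P \<times> R) (?D (?D F k) l)" for k l
    using C_nat_on_derivative[OF D1] by (simp add: eval_nat_numeral)
  have formula: "(deriv ^^ 2) (\<lambda>t. H (s, \<gamma> t)) 0 = ?D H (0, g2) (s, \<gamma> 0)
    + (\<Sum>i\<in>Basis. \<Sum>j\<in>Basis. (g1 \<bullet> i) * (g1 \<bullet> j) * ?D (?D H (0, i)) (0, j) (s, \<gamma> 0))"
    if "C_nat_on 2 (P \<times> R) H" "s \<in> P" for H s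
    unfolding deriv2_partial_compose[OF that(1) R that(2) J \<gamma>] g1_def g2_def ..
  let ?G = "\<lambda>s. ?D F (0, g2) (s, \<gamma> 0)
    + (\<Sum>i\<in>Basis. \<Sum>j\<in>Basis. (g1 \<bullet> i) * (g1 \<bullet> j) * ?D (?D F (0, i)) (0, j) (s, \<gamma> 0))"
  have eq: "?G s = (deriv ^^ 2) (\<lambda>t. F (s, \<gamma> t)) 0" if "s \<in> P" for s
    by (rule formula[OF C_nat_on_mono[OF F] that, symmetric]) simp
  have D2': "C_nat_on 2 (P \<times> R) (?D (?D F k) l)" for k l
    using D2 by (simp add: eval_nat_numeral)
  have CG: "C_nat_on 2 P ?G"
    by (intro C_nat_on_add C_nat_on_sum C_nat_on_mult C_nat_on_const P
        C_nat_on_partial_fst[OF C_nat_on_mono[OF D1] P \<gamma>0] C_nat_on_partial_fst[OF D2' P \<gamma>0]) simp_all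
  show "C_nat_on 2 P (\<lambda>s. (deriv ^^ 2) (\<lambda>t. F (s, \<gamma> t)) 0)"
    by (rule C_nat_on_cong[OF P eq CG])
  assume s: "s \<in> P"
  let ?z = "(s, \<gamma> 0)"
  have z: "?z \<in> P \<times> R" using s \<gamma>0 by simp
  have part: "((\<lambda>s. H (s, \<gamma> 0)) has_derivative (\<lambda>h. ?D H (h, 0) ?z)) (at s)"
    if "C_nat_on (Suc k) (P \<times> R) H" for H k
    by (rule has_derivative_partial_fst[OF C_nat_on_has_derivative[OF that z]])
  have "(?G has_derivative (\<lambda>h. ?D (?D F (0, g2)) (h, 0) ?z
      + (\<Sum>i\<in>Basis. \<Sum>j\<in>Basis. (g1 \<bullet> i) * (g1 \<bullet> j) * ?D (?D (?D F (0, i)) (0, j)) (h, 0) ?z))) (at s)"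
    by (intro has_derivative_add has_derivative_sum has_derivative_mult_right part[OF D1] part[OF D2])
  then have "((\<lambda>s. (deriv ^^ 2) (\<lambda>t. F (s, \<gamma> t)) 0) has_derivative (\<lambda>h. ?D (?D F (0, g2)) (h, 0) ?z
      + (\<Sum>i\<in>Basis. \<Sum>j\<in>Basis. (g1 \<bullet> i) * (g1 \<bullet> j) * ?D (?D (?D F (0, i)) (0, j)) (h, 0) ?z))) (at s)"
    by (rule has_derivative_transform_within_open[OF _ P s]) (rule eq)
  from fun_cong[OF frechet_derivative_at[OF this], symmetric]
  have D: "frechet (\<lambda>s. (deriv ^^ 2) (\<lambda>t. F (s, \<gamma> t)) 0) s h
    = ?D (?D F (0, g2)) (h, 0) ?z
      + (\<Sum>i\<in>Basis. \<Sum>j\<in>Basis. (g1 \<bullet> i) * (g1 \<bullet> j) * ?D (?D (?D F (0, i)) (0, j)) (h, 0) ?z)" .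
  \<comment> \<open>The derivative in direction \<open>(h, 0)\<close> is moved to the innermost
    place: one exchange for the acceleration term, two for each Hessian term. What results is
    \<open>formula\<close> for the first partial derivative of \<open>F\<close>, which is still
    C^3.\<close>
  have m1: "?D (?D F (0, g2)) (h, 0) ?z = ?D (?D F (h, 0)) (0, g2) ?z"
    by (rule mixed_derivatives_commute[OF o C_nat_on_mono[OF F] z]) simp
  have m2: "?D (?D (?D F (0, i)) (0, j)) (h, 0) ?z = ?D (?D (?D F (h, 0)) (0, i)) (0, j) ?z" for i j
  proof -
    have "?D (?D (?D F (0, i)) (0, j)) (h, 0) ?z = ?D (?D (?D F (0, i)) (h, 0)) (0, j) ?z"
      by (rule mixed_derivatives_commute[OF o C_nat_on_mono[OF D1] z]) simp
    also have "\<dots> = ?D (?D (?D F (h, 0)) (0, i)) (0, j) ?z"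
    proof -
      have "?D (?D F (0, i)) (h, 0) z = ?D (?D F (h, 0)) (0, i) z" if "z \<in> P \<times> R" for z
        by (rule mixed_derivatives_commute[OF o C_nat_on_mono[OF F] that]) simp
      from frechet_derivative_transform_within_open[OF C_nat_on_differentiable[OF D2 z] o z this]
      show ?thesis by simp
    qed
    finally show ?thesis .
  qed
  have "?D (?D F (h, 0)) (0, g2) ?z
      + (\<Sum>i\<in>Basis. \<Sum>j\<in>Basis. (g1 \<bullet> i) * (g1 \<bullet> j) * ?D (?D (?D F (h, 0)) (0, i)) (0, j) ?z)
    = (deriv ^^ 2) (\<lambda>t. ?D F (h, 0) (s, \<gamma> t)) 0"
    by (rule formula[OF C_nat_on_mono[OF D1] s, symmetric]) simp
  then show "frechet (\<lambda>s. (deriv ^^ 2) (\<lambda>t. F (s, \<gamma> t)) 0) s h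
      = (deriv ^^ 2) (\<lambda>t. frechet F (s, \<gamma> t) (h, 0)) 0"
    unfolding D m1 m2 .
qed

subsection \<open>Comparison of the cost on a submanifold with the reduced cost\<close>

context reduction
begin

lemma submanifold_C_near:
  assumes "smooth_inclusion S X" "p \<in> points S" "C_near k X p f"
  shows "C_near k S p f"
proof -
  obtain W where "p \<in> W" "C_fun_on k X W f" using assms(3) unfolding C_near_def by blast
  moreover have "p \<in> points X" "smooth_atlas S" "smooth_transitions S X"
    using assms(1,2) by (auto simp: smooth_inclusion_def)
  ultimately show ?thesis using C_near_transfer[OF X _ _ _ assms(2)] by blast
qed

lemma coord_chart: 
  assumes "smooth_inclusion S X" "(U, \<phi>) \<in> S" "p \<in> U"
  shows "coord e U \<phi> (\<phi> p) = Zchart e (leaf p)"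
  using assms smooth_atlasD(1)[of S U \<phi>] by (simp add: coord_def smooth_inclusion_def)

lemma leaf_in_leaves: "p \<in> points X \<Longrightarrow> leaf p \<in> Zset"
  by (simp add: leaves_eq)

text \<open>The chain rule for \<open>f\<close> in a quotient chart after \<open>coord\<close>. It
  identifies \<open>Zvector e p (dcoord e U \<phi> p a)\<close> as the image of the tangent vector
  under the differential of \<open>Q\<close> restricted to \<open>S\<close>.\<close>

lemma pushforward:
  assumes S: "smooth_inclusion S X" and ch: "(U, \<phi>) \<in> S" "p \<in> U" and e: "basis_at Y y\<^sub>0 e"
    and f: "C_near 1 Z (leaf p) f"
  shows "C_near 1 S p (\<lambda>x. f (leaf x))"
    "chart_vector S U \<phi> p a (\<lambda>x. f (leaf x)) =
      Zvector e p (dcoord e U \<phi> p a) f"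
proof -
  have SA: "smooth_atlas S" and sub: "points S \<subseteq> points X" using S by (auto simp: smooth_inclusion_def)
  have p: "p \<in> points X" using sub pointsI[OF ch] by auto
  note zc = smooth_atlas_Z ZchartI[OF e] leaf_in_leaves[OF p]
  note o = smooth_atlasD[OF SA ch(1)]
  obtain T where T: "open T" "Zchart e (leaf p) \<in> T" "T \<subseteq> Zchart e ` Zset"
    "C_nat_on 1 T (f \<circ> inv_into Zset (Zchart e))"
    using f unfolding C_near_iff[OF zc] C_on_1 by blast
  have q: "C_nat_on 3 (\<phi> ` U) (coord e U \<phi>)" by (rule coord_smooth[OF S ch(1) e])
  define N where "N = {s \<in> \<phi> ` U. coord e U \<phi> s \<in> T}"
  have N: "open N" unfolding N_def by (rule open_preimage_within[OF o(2) C_nat_on_imp_continuous_on[OF q] T(1)])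
  have eq: "(f \<circ> inv_into Zset (Zchart e)) (coord e U \<phi> s) = ((\<lambda>x. f (leaf x)) \<circ> inv_into U \<phi>) s"
    if "s \<in> \<phi> ` U" for s
  proof -
    have "leaf (inv_into U \<phi> s) \<in> Zset"
      by (intro leaf_in_leaves subsetD[OF sub] pointsI[OF ch(1)] inv_into_into that)
    then show ?thesis using Zchart_inj[OF e] by (simp add: coord_def)
  qed
  have "C_nat_on 1 N (\<lambda>s. (f \<circ> inv_into Zset (Zchart e)) (coord e U \<phi> s))"
    by (rule C_nat_on_compose[OF N T(4) C_nat_on_mono[OF C_nat_on_subset[OF q]]]) (auto simp: N_def)
  then have "C_nat_on 1 N ((\<lambda>x. f (leaf x)) \<circ> inv_into U \<phi>)"
    by (rule C_nat_on_cong[OF N, rotated]) (rule eq, simp add: N_def)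
  moreover have pN: "\<phi> p \<in> N" using T(2) ch coord_chart[OF S ch] by (simp add: N_def)
  ultimately show C: "C_near 1 S p (\<lambda>x. f (leaf x))"
    unfolding C_near_iff[OF SA ch] C_on_1 using N by (intro exI[of _ N]) (auto simp: N_def)
  let ?L = "dcoord e U \<phi> p"
  have "((\<lambda>s. (f \<circ> inv_into Zset (Zchart e)) (coord e U \<phi> s)) has_derivative
    (\<lambda>a. frechet (f \<circ> inv_into Zset (Zchart e)) (Zchart e (leaf p)) (?L a))) (at (\<phi> p))"
    using diff_chain_at[OF coord_derivative[OF S ch e], of "f \<circ> inv_into Zset (Zchart e)"]
      C_near_1_has_derivative[OF zc f] coord_chart[OF S ch] by (simp add: o_def)
  then have "(((\<lambda>x. f (leaf x)) \<circ> inv_into U \<phi>) has_derivative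
    (\<lambda>a. frechet (f \<circ> inv_into Zset (Zchart e)) (Zchart e (leaf p)) (?L a))) (at (\<phi> p))"
    by (rule has_derivative_transform_within_open[OF _ o(2)]) (use ch(2) eq in \<open>simp, blast\<close>)
  from fun_cong[OF frechet_derivative_at[OF this], of a]
  show "chart_vector S U \<phi> p a (\<lambda>x. f (leaf x)) = Zvector e p (?L a) f"
    using C f by (simp add: chart_vector_def)
qed

context
  fixes S :: "('a, 'k::euclidean_space) atlas" and U \<phi> p and e :: "'n \<Rightarrow> 'b tangent"
  assumes S: "smooth_inclusion S X" and ch: "(U, \<phi>) \<in> S" "p \<in> U" and e: "basis_at Y y\<^sub>0 e"
begin

private abbreviation "u a \<equiv> chart_vector S U \<phi> p a"
private abbreviation "L a \<equiv> dcoord e U \<phi> p a"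
private abbreviation "w a \<equiv> Zvector e p a"

private lemma SA: "smooth_atlas S" and sub: "points S \<subseteq> points X"
  using S by (auto simp: smooth_inclusion_def)

private lemma p: "p \<in> points S" "p \<in> points X" "leaf p \<in> Zset" 
  using pointsI[OF ch] sub leaf_in_leaves by auto

private lemma tangent_S: "tangent_space S p = range u"
  by (rule tangent_space_eq[OF SA ch])

private lemma tangent_Z: "tangent_space Z (leaf p) = range w"
  by (rule tangent_space_eq[OF smooth_atlas_Z ZchartI[OF e] p(3)])

lemma cost_derivative_pushforward:
  assumes y: "y \<in> points Y"
  shows "u a (\<lambda>x. c x y) = w (L a) (\<lambda>z. b z y) + u a (\<lambda>x. c x y\<^sub>0)"
proof -
  have C: "C_near 1 Z (leaf p) (\<lambda>z. b z y)" by (rule C_near_1_b[OF p(2) y])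
  have C0: "C_near 1 S p (\<lambda>x. c x y\<^sub>0)"
    by (rule submanifold_C_near[OF S p(1) C_near_1_cost[OF p(2) y0]])
  have "u a (\<lambda>x. c x y) = u a (\<lambda>x. b (leaf x) y + c x y\<^sub>0)"
    by (rule chart_vector_cong[OF SA ch]) (use sub y in \<open>auto simp: b_leaf\<close>)
  also have "\<dots> = u a (\<lambda>x. b (leaf x) y) + u a (\<lambda>x. c x y\<^sub>0)"
    by (rule chart_vector_apply_add[OF SA ch pushforward(1)[OF S ch e C] C0])
  also have "u a (\<lambda>x. b (leaf x) y) = w (L a) (\<lambda>z. b z y)"
    by (rule pushforward(2)[OF S ch e C])
  finally show ?thesis .
qed

text \<open>Covectors of \<open>c\<close> are pullbacks of covectors of \<open>b\<close> up to the
  shift \<open>u a (\<lambda>x. c x y\<^sub>0)\<close>. The shift does not involve \<open>y\<close>: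
  it cancels from the equation of the exponential and from every derivative in
  \<open>y\<close>.\<close>

lemma Dx_pushforward:
  assumes "y \<in> points Y"
  shows "Dx S c p y (u a) = Dx Z b (leaf p) y (w (L a)) + u a (\<lambda>x. c x y\<^sub>0)"
  using cost_derivative_pushforward[OF assms] by (simp add: Dx_def differential_def tangent_S tangent_Z)

lemma Dxy_pushforward:
  assumes y: "y \<in> points Y" and v: "v \<in> tangent_space Y y"
  shows "Dxy S c p y v (u a) = Dxy Z b (leaf p) y v (w (L a))"
proof -
  have "v (\<lambda>y. u a (\<lambda>x. c x y)) = v (\<lambda>y. w (L a) (\<lambda>z. b z y) + u a (\<lambda>x. c x y\<^sub>0))"
    by (rule tangent_cong[OF Y y v cost_derivative_pushforward])
  also have "\<dots> = v (\<lambda>y. w (L a) (\<lambda>z. b z y))" by (rule tangent_apply_add_const[OF v Y y])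
  finally show ?thesis by (simp add: Dxy_def tangent_S tangent_Z)
qed

text \<open>The equality holds for all \<open>t\<close>, including those where the exponential is a junk value, because
  the two choice predicates coincide.\<close>

lemma c_exp_pushforward:
  assumes y: "y \<in> points Y" and v: "v \<in> tangent_space Y y" and surj: "surj L"
  shows "c_exp S Y c p (\<lambda>w. Dx S c p y w + t * Dxy S c p y v w) =
    c_exp Z Y b (leaf p) (\<lambda>w. Dx Z b (leaf p) y w + t * Dxy Z b (leaf p) y v w)"
proof -
  \<comment> \<open>By surjectivity the vectors \<open>w (L a)\<close> exhaust the tangent space of
    \<open>Z\<close>, so an identity of covectors tested on vectors coming from \<open>S\<close> is
    an identity on \<open>Z\<close>.\<close>
  have all: "(\<forall>a. P (L a)) \<longleftrightarrow> (\<forall>a. P a)" for P using surj by (metis surjD)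
  have "(Dx S c p y' = (\<lambda>w. Dx S c p y w + t * Dxy S c p y v w)) \<longleftrightarrow>
    (Dx Z b (leaf p) y' = (\<lambda>w. Dx Z b (leaf p) y w + t * Dxy Z b (leaf p) y v w))"
    if y': "y' \<in> points Y" for y'
  proof -
    have "(Dx S c p y' = (\<lambda>w. Dx S c p y w + t * Dxy S c p y v w)) \<longleftrightarrow>
      (\<forall>a. Dx S c p y' (u a) = Dx S c p y (u a) + t * Dxy S c p y v (u a))"
      by (auto simp: fun_eq_iff Dx_def Dxy_def differential_def tangent_S)
    also have "\<dots> \<longleftrightarrow> (\<forall>a. Dx Z b (leaf p) y' (w (L a)) = Dx Z b (leaf p) y (w (L a)) + t * Dxy Z b (leaf p) y v (w (L a)))"
      by (simp add: Dx_pushforward[OF y] Dx_pushforward[OF y'] Dxy_pushforward[OF y v])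
    also have "\<dots> \<longleftrightarrow> (\<forall>a. Dx Z b (leaf p) y' (w a) = Dx Z b (leaf p) y (w a) + t * Dxy Z b (leaf p) y v (w a))"
      by (rule all[of "\<lambda>a. Dx Z b (leaf p) y' (w a) = Dx Z b (leaf p) y (w a) + t * Dxy Z b (leaf p) y v (w a)"])
    also have "\<dots> \<longleftrightarrow> (Dx Z b (leaf p) y' = (\<lambda>w. Dx Z b (leaf p) y w + t * Dxy Z b (leaf p) y v w))"
      by (auto simp: fun_eq_iff Dx_def Dxy_def differential_def tangent_Z)
    finally show ?thesis .
  qed
  then show ?thesis unfolding c_exp_def inv_into_def by (intro arg_cong[where f=Eps] ext conj_cong refl)
qed

text \<open>Composition with \<open>coord\<close> limits the class of the image curve; C^2 is
  recorded because second derivatives along it are taken later. The third claim keeps the curve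
  inside one chart domain, hence in \<open>points X\<close>.\<close>

lemma curve_pushforward:
  assumes \<beta>: "C_curve \<infinity> S \<beta>" "\<beta> 0 = p" "velocity S \<beta> = u a"
  shows "C_curve 2 Z (\<lambda>s. leaf (\<beta> s))"
    "velocity Z (\<lambda>s. leaf (\<beta> s)) = w (L a)"
    "\<exists>\<epsilon>>0. \<beta> ` {-\<epsilon><..<\<epsilon>} \<subseteq> U"
proof -
  obtain \<epsilon> where \<epsilon>: "0 < \<epsilon>" "\<beta> ` {-\<epsilon><..<\<epsilon>} \<subseteq> U" "C_on \<infinity> {-\<epsilon><..<\<epsilon>} (\<phi> \<circ> \<beta>)"
    by (rule C_curve_chart[OF SA ch(1) _ \<beta>(1)]) (use \<beta>(2) ch(2) in auto)
  then show "\<exists>\<epsilon>>0. \<beta> ` {-\<epsilon><..<\<epsilon>} \<subseteq> U" by blast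
  note o = smooth_atlasD[OF SA ch(1)]
  have eq: "coord e U \<phi> ((\<phi> \<circ> \<beta>) s) = (Zchart e \<circ> (\<lambda>s. leaf (\<beta> s))) s" if "s \<in> {-\<epsilon><..<\<epsilon>}" for s
    using \<epsilon>(2) that coord_chart[OF S ch(1)] by (auto simp: image_subset_iff)
  have "C_nat_on 2 {-\<epsilon><..<\<epsilon>} (\<lambda>s. coord e U \<phi> ((\<phi> \<circ> \<beta>) s))"
  proof (rule C_nat_on_compose[where V="\<phi> ` U" and f="coord e U \<phi>" and g="\<phi> \<circ> \<beta>"])
    show "C_nat_on 2 (\<phi> ` U) (coord e U \<phi>)"
      by (rule C_nat_on_mono[OF coord_smooth[OF S ch(1) e]]) simp
    show "C_nat_on 2 {-\<epsilon><..<\<epsilon>} (\<phi> \<circ> \<beta>)" using \<epsilon>(3) by (simp only: C_on_infinity)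
  qed (use \<epsilon>(2) in auto)
  then have "C_nat_on 2 {-\<epsilon><..<\<epsilon>} (Zchart e \<circ> (\<lambda>s. leaf (\<beta> s)))"
    by (rule C_nat_on_cong[OF open_greaterThanLessThan, rotated]) (rule eq)
  then have "C_on 2 {-\<epsilon><..<\<epsilon>} (Zchart e \<circ> (\<lambda>s. leaf (\<beta> s)))" by (simp only: C_on_numeral)
  moreover have im: "(\<lambda>s. leaf (\<beta> s)) ` {-\<epsilon><..<\<epsilon>} \<subseteq> Zset"
    using \<epsilon>(2) pointsI[OF ch(1)] sub by (auto intro!: leaf_in_leaves)
  ultimately show "C_curve 2 Z (\<lambda>s. leaf (\<beta> s))"
    unfolding C_curve_def using ZchartI[OF e] \<epsilon>(1) by blast
  have "C_on 1 {-\<epsilon><..<\<epsilon>} (\<phi> \<circ> \<beta>)" using \<epsilon>(3) by (rule C_on_mono) simp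
  then have v: "((\<phi> \<circ> \<beta>) has_vector_derivative frechet (\<phi> \<circ> \<beta>) 0 1) (at 0)"
    by (rule has_vector_derivative_frechet) (use \<epsilon>(1) in simp)
  from velocity_eq_chart_vector[OF SA ch \<beta>(2) \<epsilon>(1,2) this]
  have "frechet (\<phi> \<circ> \<beta>) 0 1 = a"
    unfolding \<beta>(3) using chart_vector_inj[OF SA ch] by metis
  with v have "((\<phi> \<circ> \<beta>) has_derivative (\<lambda>s. s *\<^sub>R a)) (at 0)" by (simp add: has_vector_derivative_def)
  moreover have "(coord e U \<phi> has_derivative L) (at ((\<phi> \<circ> \<beta>) 0))"
    using coord_derivative[OF S ch e] \<beta>(2) by simp
  ultimately have "((coord e U \<phi> \<circ> (\<phi> \<circ> \<beta>)) has_derivative (L \<circ> (\<lambda>s. s *\<^sub>R a))) (at 0)"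
    by (rule diff_chain_at)
  moreover have "linear L"
    by (rule has_derivative_linear[OF coord_derivative[OF S ch e]])
  ultimately have "((\<lambda>s. coord e U \<phi> ((\<phi> \<circ> \<beta>) s)) has_vector_derivative L a) (at 0)"
    by (simp add: has_vector_derivative_def o_def linear_cmul)
  then have "((Zchart e \<circ> (\<lambda>s. leaf (\<beta> s))) has_vector_derivative L a) (at 0)"
    by (rule has_vector_derivative_transform_within_open[of _ _ _ "{-\<epsilon><..<\<epsilon>}"]) (use \<epsilon>(1) eq in \<open>simp, simp, blast\<close>)
  then show "velocity Z (\<lambda>s. leaf (\<beta> s)) = w (L a)"
    using im \<epsilon>(1) by (intro velocity_eq_chart_vector[OF smooth_atlas_Z ZchartI[OF e] p(3), where \<epsilon>=\<epsilon>]) (simp_all add: \<beta>(2))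
qed

end

end

subsection \<open>The curvature of the reduced cost\<close>

lemma linear_vec_expand:
  fixes h :: "real ^ 'k \<Rightarrow> real"
  assumes "linear h"
  shows "h a = (\<Sum>i\<in>UNIV. a $ i * h (axis i 1))"
proof -
  have "h a = h (\<Sum>i\<in>UNIV. a $ i *\<^sub>R axis i 1)"
    using basis_expansion[of a] by (simp add: scalar_mult_eq_scaleR)
  also have "\<dots> = (\<Sum>i\<in>UNIV. a $ i * h (axis i 1))" using assms by (simp add: linear_sum linear_cmul)
  finally show ?thesis .
qed

context reduction
begin

text \<open>\<open>D_x c(x, y)\<close> is recovered from \<open>D_z b(leaf x, y)\<close> by pullback
  and a shift independent of \<open>y\<close>, so the twist condition passes from \<open>c\<close>
  to \<open>b\<close>.\<close>

lemma twisted_Z: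
  assumes x: "x \<in> points X"
  shows "inj_on (Dx Z b (leaf x)) (points Y)"
proof (rule inj_onI)
  fix y y' assume y: "y \<in> points Y" "y' \<in> points Y" and eq: "Dx Z b (leaf x) y = Dx Z b (leaf x) y'"
  obtain e :: "'n \<Rightarrow> 'b tangent" where e: "basis_at Y y\<^sub>0 e" using basis_exists by blast
  obtain U \<phi> where ch: "(U, \<phi>) \<in> X" "x \<in> U" using x by (rule pointsE)
  have "Dx X c x y = Dx X c x y'"
  proof
    fix u show "Dx X c x y u = Dx X c x y' u"
    proof (cases "u \<in> tangent_space X x")
      case True
      then obtain a where "u = chart_vector X U \<phi> x a" unfolding tangent_space_eq[OF X ch] by blast
      then show ?thesis
        using Dx_pushforward[OF smooth_inclusion_refl ch e y(1)] Dx_pushforward[OF smooth_inclusion_refl ch e y(2)] eq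
        by simp
    qed (simp add: Dx_def differential_def)
  qed
  then show "y = y'" using twist x y unfolding twisted_def by (blast dest: inj_onD)
qed

text \<open>The reduced cost need not be C^4 in \<open>z\<close>, but its second derivative along \<open>\<gamma>\<close> is still a C^2
  function \<open>G\<close> of \<open>z\<close>. Its differential vanishes at the base point because \<open>D_z b(z, \<gamma> t)\<close> is affine in
  \<open>t\<close>; hence the second derivative of \<open>G\<close> along a curve depends only on the velocity of the curve, which
  makes the curvature well defined.\<close>

lemma reduced_exp_analysis:
  assumes x: "x \<in> points X" and y: "y \<in> points Y" and v: "v \<in> tangent_space Y y" and e: "basis_at Y y\<^sub>0 e"
  defines "\<gamma> \<equiv> \<lambda>t. c_exp Z Y b (leaf x) (\<lambda>w. Dx Z b (leaf x) y w + t * Dxy Z b (leaf x) y v w)"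
  obtains J N G where "open J" "0 \<in> J" "\<And>t. t \<in> J \<Longrightarrow> \<gamma> t \<in> points Y"
    "open N" "Zchart e (leaf x) \<in> N" "C_nat_on 2 N G"
    "\<And>a. frechet G (Zchart e (leaf x)) a = 0"
    "\<And>z. z \<in> Zset \<Longrightarrow> Zchart e z \<in> N \<Longrightarrow> (deriv ^^ 2) (\<lambda>t. b z (\<gamma> t)) 0 = G (Zchart e z)"
proof -
  obtain U \<phi> where ch: "(U, \<phi>) \<in> X" "x \<in> U" using x by (rule pointsE)
  obtain V \<psi> where chy: "(V, \<psi>) \<in> Y" "y \<in> V" using y by (rule pointsE)
  obtain P R where PR: "open P" "\<phi> x \<in> P" "P \<subseteq> \<phi> ` U" "open R" "\<psi> y \<in> R" "R \<subseteq> \<psi> ` V"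
    "C_nat_on 4 (P \<times> R) (local_cost U \<phi> V \<psi>)" by (rule local_cost_smooth[OF ch chy])
  obtain N0 \<sigma> where N0: "open N0" "Zchart e (leaf x) \<in> N0" "C_nat_on 3 N0 \<sigma>" "\<sigma> ` N0 \<subseteq> \<phi> ` U"
    "\<sigma> (Zchart e (leaf x)) = \<phi> x" "\<And>\<zeta>. \<zeta> \<in> N0 \<Longrightarrow> coord e U \<phi> (\<sigma> \<zeta>) = \<zeta>"
    by (rule local_section[OF ch e]) (rule that)
  obtain d where d: "v = chart_vector Y V \<psi> y d" using v unfolding tangent_space_eq[OF Y chy] by blast
  define F where "F = local_cost U \<phi> V \<psi>"
  define z0 where "z0 = Zchart e (leaf x)"
  define s0 where "s0 = \<phi> x"
  define t0 where "t0 = \<psi> y"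
  note injy = smooth_atlasD(1)[OF Y chy(1)] and injx = smooth_atlasD(1)[OF X ch(1)]
  note zc = smooth_atlas_Z ZchartI[OF e] leaf_in_leaves[OF x]
  let ?u = "chart_vector X U \<phi> x"
  let ?w = "Zvector e x"
  let ?L = "dcoord e U \<phi> x"
  let ?S = "frechet \<sigma> z0"
  have d\<sigma>: "(\<sigma> has_derivative ?S) (at z0)"
    by (rule C_nat_on_has_derivative[of 2]) (use N0 in \<open>simp_all add: z0_def eval_nat_numeral\<close>)
  have linS: "linear ?S" by (rule has_derivative_linear[OF d\<sigma>])
  have LS: "?L (?S a) = a" for a
  proof -
    have "((coord e U \<phi> \<circ> \<sigma>) has_derivative ?L \<circ> ?S) (at z0)"
      by (rule diff_chain_at[OF d\<sigma>]) (use coord_derivative[OF smooth_inclusion_refl ch e] N0(5) in \<open>simp add: z0_def\<close>)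
    moreover have "((coord e U \<phi> \<circ> \<sigma>) has_derivative (\<lambda>a. a)) (at z0)"
      by (rule has_derivative_transform_within_open[OF has_derivative_ident N0(1)]) (use N0 in \<open>auto simp: z0_def\<close>)
    ultimately have "?L \<circ> ?S = (\<lambda>a. a)" by (rule has_derivative_unique)
    then show ?thesis by (metis comp_apply)
  qed
  have F4: "C_nat_on 4 (P \<times> R) F" using PR(7) by (simp add: F_def)
  have F1: "C_nat_on (Suc 3) (P \<times> R) F" using F4 by (simp add: eval_nat_numeral)
  have DF: "C_nat_on (Suc 2) (P \<times> R) (\<lambda>z. frechet F z k)" for k
    using C_nat_on_derivative[OF F1] by (simp add: eval_nat_numeral)
  have linF: "linear (frechet F (s, t))" if "s \<in> P" "t \<in> R" for s t
    by (rule has_derivative_linear[OF C_nat_on_has_derivative[OF F1]]) (use that in simp)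
  \<comment> \<open>\<open>?S a\<close> lifts the tangent vector \<open>a\<close> of the quotient to
    \<open>X\<close> along the section, and by \<open>LS\<close> the lift projects back to
    \<open>a\<close>. So \<open>p a\<close> is the differential of \<open>b\<close> in direction
    \<open>a\<close>, up to a number independent of the point of \<open>Y\<close>; \<open>Pv\<close>
    collects its components.\<close>
  define p where "p a t = frechet F (s0, t) (?S a, 0)" for a t
  have p_smooth: "C_nat_on (Suc 2) R (p a)" for a
    unfolding p_def by (rule C_nat_on_partial_snd[OF DF PR(4)]) (use PR(2) in \<open>simp add: s0_def\<close>)
  define Pv where "Pv t = (\<chi> i. p (axis i 1) t)" for t
  have Pv_smooth: "C_nat_on (Suc 2) R Pv"
    unfolding Pv_def by (rule C_nat_on_vec[OF PR(4)]) (simp only: vec_lambda_beta p_smooth)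
  have dPv: "(Pv has_derivative frechet Pv t) (at t)" if "t \<in> R" for t
    by (rule C_nat_on_has_derivative[OF Pv_smooth that])
  have t0: "t0 \<in> R" using PR(5) by (simp add: t0_def)
  have p_Pv: "p a t = a \<bullet> Pv t" if t: "t \<in> R" for a t
  proof -
    have "linear (\<lambda>a. (?S a, 0 :: real^'n))" using linS by (auto simp: linear_iff)
    from linear_compose[OF this linF[of s0 t]] have "linear (\<lambda>a. p a t)"
      using PR(2) t by (simp add: p_def o_def s0_def)
    from linear_vec_expand[OF this, of a] show ?thesis by (simp add: inner_vec_def Pv_def)
  qed
  let ?K = "\<lambda>a. ?u (?S a) (\<lambda>x. c x y\<^sub>0)"
  have inY: "inv_into V \<psi> t \<in> points Y" if "t \<in> R" for t
    using that PR(6) by (intro pointsI[OF chy(1)] inv_into_into) auto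
  have A: "Dx Z b (leaf x) (inv_into V \<psi> t) (?w a) = a \<bullet> Pv t - ?K a" if t: "t \<in> R" for a t
  proof -
    have "Dx X c x (inv_into V \<psi> t) (?u (?S a)) = p a t"
      using local_cost_derivatives(2)[OF ch chy PR t]
      by (simp add: Dx_def differential_def tangent_space_eq[OF X ch] p_def F_def s0_def)
    then show ?thesis
      using Dx_pushforward[OF smooth_inclusion_refl ch e inY[OF t], of "?S a"] p_Pv[OF t, of a] by (simp add: LS)
  qed
  have B: "Dxy Z b (leaf x) y (chart_vector Y V \<psi> y d') (?w a) = a \<bullet> frechet Pv t0 d'" for d' a
  proof -
    have v': "chart_vector Y V \<psi> y d' \<in> tangent_space Y y" unfolding tangent_space_eq[OF Y chy] by simp
    have "Dxy Z b (leaf x) y (chart_vector Y V \<psi> y d') (?w a)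
      = frechet (\<lambda>z. frechet F z (?S a, 0)) (s0, t0) (0, d')"
      using Dxy_pushforward[OF smooth_inclusion_refl ch e y v', of "?S a"]
        local_cost_derivatives(4)[OF ch chy PR, of d' "?S a"]
      by (simp add: LS Dxy_def tangent_space_eq[OF X ch] F_def s0_def t0_def)
    also have "\<dots> = frechet (p a) t0 d'"
      unfolding p_def
      by (rule frechet_derivative_partial_snd[OF C_nat_on_differentiable[OF DF], symmetric])
        (use PR t0 in \<open>simp add: s0_def\<close>)
    also have "((\<lambda>t. a \<bullet> Pv t) has_derivative (\<lambda>h. a \<bullet> frechet Pv t0 h)) (at t0)"
      by (rule bounded_linear.has_derivative[OF bounded_linear_inner_right dPv[OF t0]])
    then have "(p a has_derivative (\<lambda>h. a \<bullet> frechet Pv t0 h)) (at t0)"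
      by (rule has_derivative_transform_within_open[OF _ PR(4) t0]) (simp add: p_Pv)
    then have "frechet (p a) t0 d' = a \<bullet> frechet Pv t0 d'"
      using fun_cong[OF frechet_derivative_at] by metis
    finally show ?thesis .
  qed
  \<comment> \<open>A kernel vector would give a tangent vector of \<open>Y\<close> annihilated by
    \<open>Dxy X c x y\<close>, against non-degeneracy. Source and target of \<open>Pv\<close> have
    the same dimension, so \<open>Pv\<close> is invertible near \<open>t0\<close>.\<close>
  have "inj (frechet Pv t0)"
    unfolding linear_injective_0[OF has_derivative_linear[OF dPv[OF t0]]]
  proof (intro allI impI)
    fix d' assume d': "frechet Pv t0 d' = 0"
    let ?v = "chart_vector Y V \<psi> y d'"
    have v': "?v \<in> tangent_space Y y" unfolding tangent_space_eq[OF Y chy] by simp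
    have "Dxy X c x y ?v u = 0" for u
    proof (cases "u \<in> tangent_space X x")
      case True
      then obtain a where "u = ?u a" unfolding tangent_space_eq[OF X ch] by blast
      then show ?thesis
        using Dxy_pushforward[OF smooth_inclusion_refl ch e y v', of a] B[of d'] d' by simp
    qed (simp add: Dxy_def)
    moreover have "Dxy X c x y (\<lambda>f. 0) u = 0" for u by (simp add: Dxy_def)
    ultimately have "Dxy X c x y ?v = Dxy X c x y (\<lambda>f. 0)" by (intro ext) simp
    then have "?v = (\<lambda>f. 0)"
      using nondeg x y v' tangent_space_0[OF Y y] unfolding nondegenerate_def by (blast dest: inj_onD)
    then have "?v = chart_vector Y V \<psi> y 0" by (simp add: chart_vector_0[OF Y chy])
    then show "d' = 0" by (rule chart_vector_inj[OF Y chy])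
  qed
  from C_inverse_function[OF Pv_smooth PR(4) t0 this]
  obtain U' V' g where g: "open U'" "U' \<subseteq> R" "t0 \<in> U'" "open V'" "Pv t0 \<in> V'" "homeomorphism U' V' Pv g"
    "C_nat_on (Suc 2) V' g" by metis
  \<comment> \<open>\<open>w1\<close> represents the covector \<open>q\<close>, and
    \<open>Pv t0\<close> represents \<open>p\<close> up to the fixed shift \<open>?K\<close>. So
    \<open>l\<close> is the affine curve of covectors, and \<open>J\<close> consists of the times at
    which it stays in the domain of the local inverse.\<close>
  define w1 where "w1 = frechet Pv t0 d"
  define l where "l = (\<lambda>\<tau>. Pv t0 + \<tau> *\<^sub>R w1)"
  define J where "J = l -` V'"
  have Cl: "C_nat_on k UNIV l" for k unfolding l_def
    by (intro C_nat_on_add[OF open_UNIV C_nat_on_const] C_nat_on_scaleR[OF open_UNIV C_nat_on_ident[OF open_UNIV] C_nat_on_const])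
  have J: "open J" unfolding J_def
    using C_nat_on_imp_continuous_on[OF Cl] g(4) by (intro open_vimage) auto
  have J0: "0 \<in> J" using g(5) by (simp add: J_def l_def)
  define \<gamma>' where "\<gamma>' = (\<lambda>\<tau>. g (l \<tau>))"
  have "C_nat_on (Suc 2) J \<gamma>'" unfolding \<gamma>'_def
    by (rule C_nat_on_compose[OF J g(7) C_nat_on_subset[OF Cl]]) (auto simp: J_def)
  then have C\<gamma>: "C_nat_on 2 J \<gamma>'" by (rule C_nat_on_mono) simp
  have \<gamma>': "\<gamma>' \<tau> \<in> R" "Pv (\<gamma>' \<tau>) = l \<tau>" if "\<tau> \<in> J" for \<tau>
  proof -
    have "l \<tau> \<in> V'" using that by (simp add: J_def)
    then show "\<gamma>' \<tau> \<in> R" "Pv (\<gamma>' \<tau>) = l \<tau>"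
      using homeomorphism_image2[OF g(6)] homeomorphism_apply2[OF g(6)] g(2) unfolding \<gamma>'_def by blast+
  qed
  \<comment> \<open>The local inverse only produces some point with the right covector. Injectivity
    of \<open>D_z b(leaf x, y)\<close> in \<open>y\<close> on all of \<open>Y\<close> identifies it
    with the value chosen by \<open>inv_into\<close>.\<close>
  have C: "\<gamma> \<tau> = inv_into V \<psi> (\<gamma>' \<tau>)" if \<tau>: "\<tau> \<in> J" for \<tau>
    unfolding \<gamma>_def c_exp_def
  proof (rule inv_into_f_eq[OF twisted_Z[OF x] inY[OF \<gamma>'(1)[OF \<tau>]]])
    show "Dx Z b (leaf x) (inv_into V \<psi> (\<gamma>' \<tau>)) = (\<lambda>w. Dx Z b (leaf x) y w + \<tau> * Dxy Z b (leaf x) y v w)"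
    proof
      fix w
      show "Dx Z b (leaf x) (inv_into V \<psi> (\<gamma>' \<tau>)) w = Dx Z b (leaf x) y w + \<tau> * Dxy Z b (leaf x) y v w"
      proof (cases "w \<in> tangent_space Z (leaf x)")
        case True
        then obtain a where a: "w = ?w a" unfolding tangent_space_eq[OF zc] by blast
        have "inv_into V \<psi> t0 = y" using injy chy(2) by (simp add: t0_def)
        then show ?thesis
          using A[OF \<gamma>'(1)[OF \<tau>], of a] A[OF t0, of a] B[of d a] \<gamma>'(2)[OF \<tau>]
          by (simp add: a d w1_def l_def inner_add_right)
      qed (simp add: Dx_def Dxy_def differential_def)
    qed
  qed
  \<comment> \<open>Along the section \<open>b\<close> differs from the local cost by a term free of
    \<open>\<tau>\<close>, so the second derivative may be computed on \<open>F\<close>, which is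
    C^4.\<close>
  define G0 where "G0 = (\<lambda>s. (deriv ^^ 2) (\<lambda>\<tau>. F (s, \<gamma>' \<tau>)) 0)"
  have im: "\<gamma>' ` J \<subseteq> R" using \<gamma>' by auto
  note G0 = deriv2_partial_differentiable[OF F4 PR(1,4) J J0 C\<gamma> im, folded G0_def]
  define N where "N = {\<zeta> \<in> N0. \<sigma> \<zeta> \<in> P}"
  have N: "open N" unfolding N_def by (rule open_preimage_within[OF N0(1) C_nat_on_imp_continuous_on[OF N0(3)] PR(1)])
  have s0P: "s0 \<in> P" using PR(2) by (simp add: s0_def)
  have \<sigma>z0: "\<sigma> z0 = s0" using N0(5) by (simp add: z0_def s0_def)
  show ?thesis
  proof (rule that[of J N "\<lambda>\<zeta>. G0 (\<sigma> \<zeta>)"])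
    show "\<gamma> t \<in> points Y" if "t \<in> J" for t using C[OF that] inY[OF \<gamma>'(1)[OF that]] by simp
    show "Zchart e (leaf x) \<in> N" using N0(2,5) PR(2) by (simp add: N_def)
    show "C_nat_on 2 N (\<lambda>\<zeta>. G0 (\<sigma> \<zeta>))"
      by (rule C_nat_on_compose[OF N G0(1) C_nat_on_mono[OF C_nat_on_subset[OF N0(3)]]]) (auto simp: N_def)
    show "frechet (\<lambda>\<zeta>. G0 (\<sigma> \<zeta>)) (Zchart e (leaf x)) a = 0" for a
    proof -
      have "G0 differentiable (at s0)"
        by (rule C_nat_on_differentiable[OF _ s0P]) (use G0(1) in \<open>simp only: numeral_2_eq_2\<close>)
      then have "((G0 \<circ> \<sigma>) has_derivative frechet G0 s0 \<circ> ?S) (at z0)"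
        unfolding frechet_derivative_works using diff_chain_at[OF d\<sigma>] \<sigma>z0 by metis
      from fun_cong[OF frechet_derivative_at[OF this], of a]
      have "frechet (\<lambda>\<zeta>. G0 (\<sigma> \<zeta>)) z0 a = frechet G0 s0 (?S a)"
        by (simp add: o_def)
      also have "\<dots> = (deriv ^^ 2) (\<lambda>\<tau>. p a (\<gamma>' \<tau>)) 0"
        unfolding p_def by (rule G0(2)[OF s0P])
      also have "\<dots> = (deriv ^^ 2) (\<lambda>\<tau>. a \<bullet> Pv t0 + \<tau> * (a \<bullet> w1)) 0"
        by (rule deriv2_eq_on_open[OF J J0]) (simp add: p_Pv \<gamma>' l_def inner_add_right)
      also have "\<dots> = 0"
      proof -
        have "deriv (\<lambda>\<tau>. a \<bullet> Pv t0 + \<tau> * (a \<bullet> w1)) \<tau> = a \<bullet> w1" for \<tau>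
          by (rule DERIV_imp_deriv) (auto intro!: derivative_eq_intros)
        then have "deriv (\<lambda>\<tau>. a \<bullet> Pv t0 + \<tau> * (a \<bullet> w1)) = (\<lambda>\<tau>. a \<bullet> w1)" by (rule ext)
        then show ?thesis by (simp add: numeral_2_eq_2)
      qed
      finally show ?thesis by (simp add: z0_def)
    qed
    fix z assume z: "z \<in> Zset" "Zchart e z \<in> N"
    let ?\<zeta> = "Zchart e z"
    let ?x = "inv_into U \<phi> (\<sigma> ?\<zeta>)"
    have \<zeta>: "?\<zeta> \<in> N0" "\<sigma> ?\<zeta> \<in> P" using z(2) by (auto simp: N_def)
    have xX: "?x \<in> points X" using \<zeta>(1) N0(4) by (intro pointsI[OF ch(1)] inv_into_into) auto
    have "Zchart e (leaf ?x) = Zchart e z" using N0(6)[OF \<zeta>(1)] by (simp add: coord_def)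
    then have zx: "z = leaf ?x"
      using Zchart_inj[OF e] z(1) leaf_in_leaves[OF xX] by (metis inj_onD)
    have eq: "b z (\<gamma> \<tau>) = F (\<sigma> ?\<zeta>, \<gamma>' \<tau>) + - c ?x y\<^sub>0" if "\<tau> \<in> J" for \<tau>
    proof -
      have "b (leaf ?x) (\<gamma> \<tau>) = c ?x (\<gamma> \<tau>) - c ?x y\<^sub>0"
        by (rule b_leaf[OF xX]) (use C[OF that] inY[OF \<gamma>'(1)[OF that]] in simp)
      then show ?thesis using zx C[OF that] by (simp add: F_def local_cost_def)
    qed
    have "(deriv ^^ 2) (\<lambda>t. b z (\<gamma> t)) 0 = (deriv ^^ 2) (\<lambda>\<tau>. F (\<sigma> ?\<zeta>, \<gamma>' \<tau>) + - c ?x y\<^sub>0) 0"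
      by (rule deriv2_eq_on_open[OF J J0 eq])
    then show "(deriv ^^ 2) (\<lambda>t. b z (\<gamma> t)) 0 = G0 (\<sigma> ?\<zeta>)"
      unfolding deriv2_add_const by (simp add: G0_def)
  qed (rule J J0 N)+
qed

end

text \<open>A curve with velocity \<open>u\<close> has to be exhibited: with none, the condition in
  the description would hold for every \<open>r\<close>, and uniqueness would fail.\<close>

lemma MTW_eqI:
  assumes "\<And>\<beta>. C_curve \<infinity> A \<beta> \<Longrightarrow> \<beta> 0 = x \<Longrightarrow> velocity A \<beta> = u \<Longrightarrow> MTW_along A B k x y \<beta> v = r"
    and "C_curve \<infinity> A \<beta>" "\<beta> 0 = x" "velocity A \<beta> = u"
  shows "MTW A B k x y u v = r"
  unfolding MTW_def by (rule the_equality) (use assms in blast)+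

context reduction
begin

lemma MTW_along_reduced:
  assumes x: "x \<in> points X" and y: "y \<in> points Y" and v: "v \<in> tangent_space Y y" and e: "basis_at Y y\<^sub>0 e"
  obtains H where "\<And>\<beta> a. C_curve 2 Z \<beta> \<Longrightarrow> \<beta> 0 = leaf x \<Longrightarrow>
    velocity Z \<beta> = Zvector e x a \<Longrightarrow> MTW_along Z Y b (leaf x) y \<beta> v = H a"
proof -
  let ?\<gamma> = "\<lambda>t. c_exp Z Y b (leaf x) (\<lambda>w. Dx Z b (leaf x) y w + t * Dxy Z b (leaf x) y v w)"
  obtain J N G where G: "open J" "0 \<in> J" "\<And>t. t \<in> J \<Longrightarrow> ?\<gamma> t \<in> points Y"
    "open N" "Zchart e (leaf x) \<in> N" "C_nat_on 2 N G"
    "\<And>a. frechet G (Zchart e (leaf x)) a = 0"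
    "\<And>z. z \<in> Zset \<Longrightarrow> Zchart e z \<in> N \<Longrightarrow> (deriv ^^ 2) (\<lambda>t. b z (?\<gamma> t)) 0 = G (Zchart e z)"
    by (rule reduced_exp_analysis[OF x y v e]) (rule that)
  define H where "H = (\<lambda>a. - (3 / 2) * (\<Sum>i\<in>Basis. \<Sum>j\<in>Basis. (a \<bullet> i) * (a \<bullet> j)
        * frechet (\<lambda>x. frechet G x i) (Zchart e (leaf x)) j))"
  note zc = smooth_atlas_Z ZchartI[OF e] leaf_in_leaves[OF x]
  show ?thesis
  proof (rule that[of H])
    fix \<beta> a assume \<beta>: "C_curve 2 Z \<beta>" "\<beta> 0 = leaf x"
      and vel: "velocity Z \<beta> = Zvector e x a"
    obtain \<epsilon> where \<epsilon>: "0 < \<epsilon>" "\<beta> ` {-\<epsilon><..<\<epsilon>} \<subseteq> Zset" "C_on 2 {-\<epsilon><..<\<epsilon>} (Zchart e \<circ> \<beta>)"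
      by (rule C_curve_chart[OF zc(1,2) _ \<beta>(1)]) (use \<beta>(2) zc(3) in auto)
    have "C_curve 1 Z \<beta>" by (rule C_curve_mono[OF \<beta>(1)]) (simp add: one_enat_def numeral_eq_enat)
    from velocity_C_curve[OF zc \<beta>(2) this] vel
    have a: "frechet (Zchart e \<circ> \<beta>) 0 1 = a"
      using chart_vector_inj[OF zc] by metis
    define T where "T = {s \<in> {-\<epsilon><..<\<epsilon>}. (Zchart e \<circ> \<beta>) s \<in> N}"
    have T: "open T" unfolding T_def
      by (rule open_preimage_within[OF _ C_on_imp_continuous_on[OF \<epsilon>(3)] G(4)]) simp
    have T0: "0 \<in> T" using \<epsilon>(1) \<beta>(2) G(5) by (simp add: T_def)
    have "C_nat_on 2 T (Zchart e \<circ> \<beta>)"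
      using \<epsilon>(3) unfolding C_on_numeral by (rule C_nat_on_subset) (auto simp: T_def)
    moreover have "(Zchart e \<circ> \<beta>) ` T \<subseteq> N" by (auto simp: T_def)
    ultimately have d: "(deriv ^^ 2) (\<lambda>s. G ((Zchart e \<circ> \<beta>) s)) 0 = (\<Sum>i\<in>Basis. \<Sum>j\<in>Basis. (a \<bullet> i) * (a \<bullet> j)
        * frechet (\<lambda>x. frechet G x i) (Zchart e (leaf x)) j)"
      by (subst deriv2_compose[OF G(6) T T0]) (simp_all only: a o_apply \<beta>(2) G(7) add_0)
    have "(deriv ^^ 2) (\<lambda>s. (deriv ^^ 2) (\<lambda>t. b (\<beta> s) (?\<gamma> t)) 0) 0 = (deriv ^^ 2) (\<lambda>s. G ((Zchart e \<circ> \<beta>) s)) 0"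
      by (rule deriv2_eq_on_open[OF T T0]) (use \<epsilon>(2) in \<open>auto simp: T_def intro!: G(8)\<close>)
    then show "MTW_along Z Y b (leaf x) y \<beta> v = H a"
      unfolding MTW_along_def H_def d[symmetric] by simp
  qed
qed

text \<open>By \<open>c_exp_pushforward\<close> both iterated derivatives use the same curve in
  \<open>Y\<close>. Along it \<open>c (\<beta> s)\<close> and \<open>b (leaf (\<beta> s))\<close>
  differ by \<open>c (\<beta> s) y\<^sub>0\<close>, which is constant in \<open>t\<close>.\<close>

lemma MTW_along_pushforward:
  assumes S: "smooth_inclusion S X" and ch: "(U, \<phi>) \<in> S" "p \<in> U" and e: "basis_at Y y\<^sub>0 e"
    and y: "y \<in> points Y" and v: "v \<in> tangent_space Y y"
    and surj: "surj (dcoord e U \<phi> p)"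
    and \<beta>: "0 < \<epsilon>" "\<beta> ` {-\<epsilon><..<\<epsilon>} \<subseteq> U"
  shows "MTW_along S Y c p y \<beta> v = MTW_along Z Y b (leaf p) y (\<lambda>s. leaf (\<beta> s)) v"
proof -
  have sub: "points S \<subseteq> points X" using S by (simp add: smooth_inclusion_def)
  have p: "p \<in> points X" using sub pointsI[OF ch] by auto
  let ?\<gamma> = "\<lambda>t. c_exp Z Y b (leaf p) (\<lambda>w. Dx Z b (leaf p) y w + t * Dxy Z b (leaf p) y v w)"
  \<comment> \<open>What matters here is \<open>J\<close>: the formula for \<open>b\<close> applies
    to points of \<open>Y\<close>, and for \<open>t\<close> in \<open>J\<close> the exponential is
    one.\<close>
  obtain J N G where G: "open J" "0 \<in> J" "\<And>t. t \<in> J \<Longrightarrow> ?\<gamma> t \<in> points Y"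
    "open N" "Zchart e (leaf p) \<in> N" "C_nat_on 2 N G"
    "\<And>a. frechet G (Zchart e (leaf p)) a = 0"
    "\<And>z. z \<in> Zset \<Longrightarrow> Zchart e z \<in> N \<Longrightarrow> (deriv ^^ 2) (\<lambda>t. b z (?\<gamma> t)) 0 = G (Zchart e z)"
    by (rule reduced_exp_analysis[OF p y v e]) (rule that)
  have eq: "(deriv ^^ 2) (\<lambda>t. c (\<beta> s) (?\<gamma> t)) 0 = (deriv ^^ 2) (\<lambda>t. b (leaf (\<beta> s)) (?\<gamma> t)) 0"
    if s: "s \<in> {-\<epsilon><..<\<epsilon>}" for s
  proof -
    have "\<beta> s \<in> U" using \<beta>(2) s by (auto simp: image_subset_iff)
    then have "\<beta> s \<in> points X" using pointsI[OF ch(1)] sub by auto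
    then have "(deriv ^^ 2) (\<lambda>t. c (\<beta> s) (?\<gamma> t)) 0 = (deriv ^^ 2) (\<lambda>t. b (leaf (\<beta> s)) (?\<gamma> t) + c (\<beta> s) y\<^sub>0) 0"
      by (intro deriv2_eq_on_open[OF G(1,2)]) (simp add: b_leaf G(3))
    then show ?thesis by (simp only: deriv2_add_const)
  qed
  have "(deriv ^^ 2) (\<lambda>s. (deriv ^^ 2) (\<lambda>t. c (\<beta> s) (?\<gamma> t)) 0) 0
    = (deriv ^^ 2) (\<lambda>s. (deriv ^^ 2) (\<lambda>t. b (leaf (\<beta> s)) (?\<gamma> t)) 0) 0"
    by (rule deriv2_eq_on_open[of "{-\<epsilon><..<\<epsilon>}"]) (use \<beta>(1) eq in simp_all)
  then show ?thesis
    unfolding MTW_along_def c_exp_pushforward[OF S ch e y v surj] by simp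
qed

text \<open>Both descriptions evaluate to \<open>H\<close> at the pushed-forward velocity. A smooth
  curve on \<open>Z\<close> is in particular C^2, and every competing curve on \<open>S\<close> is
  sent to a C^2 curve of \<open>Z\<close> with that velocity, so no curve has to be lifted from
  \<open>Z\<close> to \<open>S\<close>.\<close>

lemma MTW_pushforward:
  assumes S: "smooth_inclusion S X" and ch: "(U, \<phi>) \<in> S" "p \<in> U" and e: "basis_at Y y\<^sub>0 e"
    and y: "y \<in> points Y" and v: "v \<in> tangent_space Y y"
    and surj: "surj (dcoord e U \<phi> p)"
  shows "MTW S Y c p y (chart_vector S U \<phi> p a) v =
    MTW Z Y b (leaf p) y (Zvector e p (dcoord e U \<phi> p a)) v"
proof -
  have SA: "smooth_atlas S" and sub: "points S \<subseteq> points X" using S by (auto simp: smooth_inclusion_def)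
  have p: "p \<in> points X" using sub pointsI[OF ch] by auto
  let ?a = "dcoord e U \<phi> p a"
  let ?w = "Zvector e p ?a"
  obtain H where H: "\<And>\<beta> a. C_curve 2 Z \<beta> \<Longrightarrow> \<beta> 0 = leaf p \<Longrightarrow>
    velocity Z \<beta> = Zvector e p a \<Longrightarrow> MTW_along Z Y b (leaf p) y \<beta> v = H a"
    by (rule MTW_along_reduced[OF p y v e]) (rule that)
  obtain \<beta> where \<beta>: "C_curve \<infinity> Z \<beta>" "\<beta> 0 = leaf p" "velocity Z \<beta> = ?w"
    by (rule chart_vector_curve[OF smooth_atlas_Z ZchartI[OF e] leaf_in_leaves[OF p]])
  have "MTW Z Y b (leaf p) y ?w v = H ?a"
    by (rule MTW_eqI[OF _ \<beta>]) (rule H, erule C_curve_mono, simp_all add: numeral_eq_enat)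
  obtain \<beta>' where \<beta>': "C_curve \<infinity> S \<beta>'" "\<beta>' 0 = p" "velocity S \<beta>' = chart_vector S U \<phi> p a"
    by (rule chart_vector_curve[OF SA ch])
  have "MTW S Y c p y (chart_vector S U \<phi> p a) v = H ?a"
  proof (rule MTW_eqI[OF _ \<beta>'])
    fix \<beta> assume \<beta>: "C_curve \<infinity> S \<beta>" "\<beta> 0 = p" "velocity S \<beta> = chart_vector S U \<phi> p a"
    note push = curve_pushforward[OF S ch e \<beta>]
    obtain \<epsilon> where \<epsilon>: "0 < \<epsilon>" "\<beta> ` {-\<epsilon><..<\<epsilon>} \<subseteq> U" using push(3) by blast
    show "MTW_along S Y c p y \<beta> v = H ?a"
      unfolding MTW_along_pushforward[OF S ch e y v surj \<epsilon>]
      by (rule H[OF push(1) _ push(2)]) (simp add: \<beta>(2))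
  qed
  then show ?thesis using \<open>MTW Z Y b (leaf p) y ?w v = H ?a\<close> by simp
qed

text \<open>(A3S) at one point of the first factor: \<open>c\<close> at \<open>x\<close>, its
  restriction to a surface through \<open>x\<close>, and \<open>b\<close> at the leaf of
  \<open>x\<close> are compared point by point.\<close>

definition "A3S_at A k x \<longleftrightarrow> (\<forall>y\<in>points Y. \<forall>u\<in>tangent_space A x. \<forall>v\<in>tangent_space Y y.
        Dxy A k x y v u = 0 \<and>
        (\<exists>v'\<in>tangent_space Y y. Dxy A k x y v' u \<noteq> 0) \<and>
        v \<noteq> (\<lambda>f. 0) \<longrightarrow> MTW A Y k x y u v > 0)"

lemma A3S_iff: "A3S A Y k \<longleftrightarrow> (\<forall>x\<in>points A. A3S_at A k x)"
  by (simp add: A3S_def A3S_at_def)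

text \<open>The curvature and the pairings depend on \<open>u\<close> only through its image under
  the differential of \<open>Q\<close>; surjectivity turns quantification over \<open>u\<close> into
  quantification over all tangent vectors of \<open>Z\<close>. The demand that some pairing with
  \<open>u\<close> be nonzero excludes the kernel of that differential, where the curvature
  vanishes.\<close>

lemma A3S_at_submanifold_iff:
  assumes S: "smooth_inclusion S X" and ch: "(U, \<phi>) \<in> S" "p \<in> U" and e: "basis_at Y y\<^sub>0 e"
    and surj: "surj (dcoord e U \<phi> p)"
  shows "A3S_at S c p \<longleftrightarrow> A3S_at Z b (leaf p)"
proof -
  have SA: "smooth_atlas S" and sub: "points S \<subseteq> points X" using S by (auto simp: smooth_inclusion_def)
  have p: "p \<in> points X" using sub pointsI[OF ch] by auto
  let ?L = "dcoord e U \<phi> p"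
  let ?w = "Zvector e p"
  define A where "A y w v \<longleftrightarrow> Dxy Z b (leaf p) y v w = 0 \<and>
        (\<exists>v'\<in>tangent_space Y y. Dxy Z b (leaf p) y v' w \<noteq> 0) \<and>
        v \<noteq> (\<lambda>f. 0) \<longrightarrow> MTW Z Y b (leaf p) y w v > 0" for y w v
  have all: "(\<forall>a. P (?L a)) \<longleftrightarrow> (\<forall>a. P a)" for P using surj by (metis surjD)
  have "A3S_at S c p \<longleftrightarrow> (\<forall>y\<in>points Y. \<forall>a. \<forall>v\<in>tangent_space Y y. A y (?w (?L a)) v)"
    unfolding A3S_at_def A_def tangent_space_eq[OF SA ch] ball_simps
    by (intro ball_cong all_cong1 refl)
      (simp add: Dxy_pushforward[OF S ch e] MTW_pushforward[OF S ch e _ _ surj] cong: bex_cong)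
  also have "\<dots> \<longleftrightarrow> (\<forall>y\<in>points Y. \<forall>a. \<forall>v\<in>tangent_space Y y. A y (?w a) v)"
    by (intro ball_cong refl all[of "\<lambda>a. \<forall>v\<in>tangent_space Y _. A _ (?w a) v"])
  also have "\<dots> \<longleftrightarrow> A3S_at Z b (leaf p)"
    unfolding A3S_at_def A_def tangent_space_eq[OF smooth_atlas_Z ZchartI[OF e] leaf_in_leaves[OF p]] ball_simps ..
  finally show ?thesis .
qed

lemma A3S_quotient_iff: "A3S Z Y b \<longleftrightarrow> A3S X Y c"
proof -
  obtain e :: "'n \<Rightarrow> 'b tangent" where e: "basis_at Y y\<^sub>0 e" using basis_exists by blast
  have "A3S_at X c x \<longleftrightarrow> A3S_at Z b (leaf x)" if "x \<in> points X" for x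
  proof -
    obtain U \<phi> where ch: "(U, \<phi>) \<in> X" "x \<in> U" using \<open>x \<in> points X\<close> by (rule pointsE)
    show ?thesis by (rule A3S_at_submanifold_iff[OF smooth_inclusion_refl ch e coord_submersion[OF ch e]])
  qed
  then show ?thesis unfolding A3S_iff Z_points leaves_eq by simp
qed

end

subsection \<open>Embedded surfaces\<close>

lemma smoothly_embedded_inclusion:
  "smoothly_embedded S A \<Longrightarrow> smooth_atlas A \<Longrightarrow> smooth_atlas S \<Longrightarrow> smooth_inclusion S A"
  by (simp add: smooth_inclusion_def smoothly_embedded_transitions) (simp add: smoothly_embedded_def)

lemma smoothly_embedded_inj:
  assumes "smoothly_embedded S A" "(U, \<phi>) \<in> S" "(V, \<psi>) \<in> A" "p \<in> U" "p \<in> V"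
  shows "inj (frechet (\<psi> \<circ> inv_into U \<phi>) (\<phi> p))"
  using assms unfolding smoothly_embedded_def by fastforce

lemma transition_C_nat_on:
  assumes "smooth_transitions B A" "(U, \<phi>) \<in> B" "(V, \<psi>) \<in> A"
  shows "C_nat_on k (\<phi> ` (U \<inter> V)) (\<psi> \<circ> inv_into U \<phi>)"
  using smooth_transitionsD(2)[OF assms] by (simp add: C_on_infinity)

lemma transition_has_derivative:
  assumes "smooth_transitions B A" "(U, \<phi>) \<in> B" "(V, \<psi>) \<in> A" "p \<in> U" "p \<in> V"
  shows "((\<psi> \<circ> inv_into U \<phi>) has_derivative frechet (\<psi> \<circ> inv_into U \<phi>) (\<phi> p)) (at (\<phi> p))"
  by (rule C_nat_on_has_derivative[OF transition_C_nat_on[OF assms(1-3), where k="Suc 0"]]) (use assms(4,5) in blast)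

lemma C_curve_preimage:
  assumes A: "smooth_atlas A" and \<gamma>: "C_curve k A \<gamma>" "\<gamma> 0 \<in> G" and G: "openin (manifold_topology A) G"
  obtains \<epsilon> where "0 < \<epsilon>" "\<gamma> ` {-\<epsilon><..<\<epsilon>} \<subseteq> G"
proof -
  have "\<gamma> 0 \<in> points A" using openin_subset[OF G] \<gamma>(2) by auto
  then obtain U \<phi> where ch: "(U, \<phi>) \<in> A" "\<gamma> 0 \<in> U" by (rule pointsE)
  obtain e where e: "0 < e" "\<gamma> ` {-e<..<e} \<subseteq> U" "C_on k {-e<..<e} (\<phi> \<circ> \<gamma>)"
    by (rule C_curve_chart[OF A ch \<gamma>(1)]) (rule that)
  define T where "T = {t \<in> {-e<..<e}. (\<phi> \<circ> \<gamma>) t \<in> \<phi> ` (U \<inter> G)}"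
  have T: "open T" unfolding T_def
    by (rule open_preimage_within[OF _ C_on_imp_continuous_on[OF e(3)] open_chart_image[OF A G ch(1)]]) simp
  have "0 \<in> T" using e(1) ch(2) \<gamma>(2) by (simp add: T_def)
  then obtain \<epsilon> where \<epsilon>: "0 < \<epsilon>" "ball 0 \<epsilon> \<subseteq> T" using T open_contains_ball by blast
  have b: "ball 0 \<epsilon> = {-\<epsilon><..<\<epsilon>}" by (auto simp: dist_real_def)
  have "\<gamma> t \<in> G" if "t \<in> T" for t
  proof -
    have "\<gamma> t \<in> U" "\<phi> (\<gamma> t) \<in> \<phi> ` (U \<inter> G)" using that e(2) by (auto simp: T_def)
    then show ?thesis using smooth_atlasD(1)[OF A ch(1)] by (auto dest: inj_onD)
  qed
  then show ?thesis using \<epsilon> by (intro that[of \<epsilon>]) (auto simp: b)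
qed

text \<open>Composing the immersion with a linear left inverse of its differential gives a local
  diffeomorphism; this is what makes \<open>\<gamma>\<close> differentiable in the charts of the submanifold.\<close>

lemma velocity_in_submanifold:
  fixes S :: "('a, real ^ 'n) atlas" and A :: "('a, 'e::euclidean_space) atlas"
  assumes emb: "smoothly_embedded S A" and A: "smooth_atlas A" and S: "smooth_atlas S"
    and ch: "(U, \<phi>) \<in> S" "p \<in> U" and ch': "(V, \<psi>) \<in> A" "p \<in> V"
    and \<gamma>: "C_curve 1 A \<gamma>" "\<gamma> 0 = p" "0 < \<delta>" "\<gamma> ` {-\<delta><..<\<delta>} \<subseteq> points S"
  obtains a where "frechet (\<psi> \<circ> inv_into U \<phi>) (\<phi> p) a = frechet (\<psi> \<circ> \<gamma>) 0 1"
proof -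
  define \<iota> where "\<iota> = \<psi> \<circ> inv_into U \<phi>"
  let ?D = "frechet \<iota> (\<phi> p)"
  define W where "W = \<phi> ` (U \<inter> V)"
  have tr: "smooth_transitions S A" by (rule smoothly_embedded_transitions[OF emb A S])
  have W: "open W" "\<phi> p \<in> W" unfolding W_def using smooth_transitionsD(1)[OF tr ch(1) ch'(1)] ch ch' by auto
  have d\<iota>: "(\<iota> has_derivative ?D) (at (\<phi> p))"
    unfolding \<iota>_def by (rule transition_has_derivative[OF tr ch(1) ch'(1) ch(2) ch'(2)])
  have injD: "inj ?D" unfolding \<iota>_def by (rule smoothly_embedded_inj[OF emb ch(1) ch'(1) ch(2) ch'(2)])
  obtain l where l: "linear l" "l \<circ> ?D = id"
    using linear_injective_left_inverse[OF has_derivative_linear[OF d\<iota>] injD] by blast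
  have bl: "bounded_linear l" using l(1) by (simp add: linear_conv_bounded_linear)
  have C: "C_nat_on (Suc 0) W (\<lambda>w. l (\<iota> w))"
    unfolding W_def \<iota>_def
    by (rule C_nat_on_bounded_linear_compose[OF bl W(1)[unfolded W_def] transition_C_nat_on[OF tr ch(1) ch'(1)]])
  have "((\<lambda>w. l (\<iota> w)) has_derivative (\<lambda>h. l (?D h))) (at (\<phi> p))"
    by (rule bounded_linear.has_derivative[OF bl d\<iota>])
  then have "frechet (\<lambda>w. l (\<iota> w)) (\<phi> p) = (\<lambda>h. l (?D h))"
    by (rule frechet_derivative_at[symmetric])
  also have "\<dots> = id" using l(2) by (simp add: o_def)
  finally have "inj (frechet (\<lambda>w. l (\<iota> w)) (\<phi> p))" by simp
  from C_inverse_function[OF C W this]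
  obtain U' V' g where g: "open U'" "U' \<subseteq> W" "\<phi> p \<in> U'" "open V'" "l (\<iota> (\<phi> p)) \<in> V'"
    "homeomorphism U' V' (\<lambda>w. l (\<iota> w)) g" "C_nat_on (Suc 0) V' g" by metis
  \<comment> \<open>The subspace topology keeps the curve on the right sheet: near 0 it stays in an
    open set of \<open>A\<close> that meets \<open>S\<close> only in the piece of the chart where
    \<open>g\<close> inverts \<open>l \<circ> \<iota>\<close>.\<close>
  have "openin (manifold_topology S) {x \<in> U. \<phi> x \<in> U'}"
    by (rule openin_chart_preimage[OF ch(1) g(1)])
  then obtain G where G: "openin (manifold_topology A) G" "{x \<in> U. \<phi> x \<in> U'} = G \<inter> points S"
    using emb unfolding smoothly_embedded_def by (auto simp: openin_subtopology)
  have "\<gamma> 0 \<in> G" using G(2) ch(2) g(3) \<gamma>(2) by blast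
  then obtain \<epsilon>1 where \<epsilon>1: "0 < \<epsilon>1" "\<gamma> ` {-\<epsilon>1<..<\<epsilon>1} \<subseteq> G"
    using C_curve_preimage[OF A \<gamma>(1) _ G(1)] by blast
  obtain \<epsilon>2 where \<epsilon>2: "0 < \<epsilon>2" "\<gamma> ` {-\<epsilon>2<..<\<epsilon>2} \<subseteq> V" "C_on 1 {-\<epsilon>2<..<\<epsilon>2} (\<psi> \<circ> \<gamma>)"
    by (rule C_curve_chart[OF A ch'(1) _ \<gamma>(1)]) (use \<gamma>(2) ch'(2) in auto)
  define \<epsilon> where "\<epsilon> = min \<delta> (min \<epsilon>1 \<epsilon>2)"
  have \<epsilon>: "0 < \<epsilon>" using \<gamma>(3) \<epsilon>1 \<epsilon>2 by (simp add: \<epsilon>_def)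
  have in_UV: "\<gamma> t \<in> U" "\<phi> (\<gamma> t) \<in> U'" "\<gamma> t \<in> V" if "t \<in> {-\<epsilon><..<\<epsilon>}" for t
  proof -
    have "t \<in> {-\<delta><..<\<delta>}" "t \<in> {-\<epsilon>1<..<\<epsilon>1}" "t \<in> {-\<epsilon>2<..<\<epsilon>2}" using that by (auto simp: \<epsilon>_def)
    then have "\<gamma> t \<in> G \<inter> points S" "\<gamma> t \<in> V" using \<gamma>(4) \<epsilon>1(2) \<epsilon>2(2) by auto
    then show "\<gamma> t \<in> U" "\<phi> (\<gamma> t) \<in> U'" "\<gamma> t \<in> V" using G(2) by auto
  qed
  let ?e = "frechet (\<psi> \<circ> \<gamma>) 0 1"
  have v: "((\<psi> \<circ> \<gamma>) has_vector_derivative ?e) (at 0)"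
    by (rule has_vector_derivative_frechet[OF \<epsilon>2(3)]) (use \<epsilon>2(1) in simp)
  have injU: "inj_on \<phi> U" by (rule smooth_atlasD(1)[OF S ch(1)])
  have \<iota>\<gamma>: "\<iota> (\<phi> (\<gamma> t)) = \<psi> (\<gamma> t)" if "t \<in> {-\<epsilon><..<\<epsilon>}" for t
    using in_UV(1)[OF that] injU by (simp add: \<iota>_def)
  have gl: "g (l (\<psi> (\<gamma> t))) = \<phi> (\<gamma> t)" if "t \<in> {-\<epsilon><..<\<epsilon>}" for t
    using homeomorphism_apply1[OF g(6) in_UV(2)[OF that]] \<iota>\<gamma>[OF that] by simp
  have 0: "l (\<iota> (\<phi> p)) = l (\<psi> (\<gamma> 0))" using \<iota>\<gamma>[of 0] \<epsilon> \<gamma>(2) by simp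
  let ?G = "frechet g (l (\<psi> (\<gamma> 0)))"
  have dg: "(g has_derivative ?G) (at (l (\<psi> (\<gamma> 0))))"
    by (rule C_nat_on_has_derivative[OF g(7)]) (use g(5) 0 in simp)
  have "((\<lambda>t. l ((\<psi> \<circ> \<gamma>) t)) has_derivative (\<lambda>t. l (t *\<^sub>R ?e))) (at 0)"
    by (rule bounded_linear.has_derivative[OF bl v[unfolded has_vector_derivative_def]])
  from diff_chain_at[OF this, of g ?G] dg
  have "((\<lambda>t. g (l (\<psi> (\<gamma> t)))) has_derivative (\<lambda>t. ?G (l (t *\<^sub>R ?e)))) (at 0)"
    by (simp add: o_def)
  then have "((\<lambda>t. \<phi> (\<gamma> t)) has_derivative (\<lambda>t. ?G (l (t *\<^sub>R ?e)))) (at 0)"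
    by (rule has_derivative_transform_within_open[OF _ open_greaterThanLessThan[of "-\<epsilon>" \<epsilon>]]) (use \<epsilon> gl in simp_all)
  from diff_chain_at[OF this, of \<iota> ?D] d\<iota> \<gamma>(2)
  have "((\<lambda>t. \<iota> (\<phi> (\<gamma> t))) has_derivative (\<lambda>t. ?D (?G (l (t *\<^sub>R ?e))))) (at 0)"
    by (simp add: o_def)
  then have "((\<psi> \<circ> \<gamma>) has_derivative (\<lambda>t. ?D (?G (l (t *\<^sub>R ?e))))) (at 0)"
    by (rule has_derivative_transform_within_open[OF _ open_greaterThanLessThan[of "-\<epsilon>" \<epsilon>]]) (use \<epsilon> \<iota>\<gamma> in simp_all)
  from has_derivative_unique[OF this v[unfolded has_vector_derivative_def]]
  have "(\<lambda>t. ?D (?G (l (t *\<^sub>R ?e)))) = (\<lambda>t. t *\<^sub>R ?e)" .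
  from fun_cong[OF this, of 1] have "?D (?G (l ?e)) = ?e" by simp
  then show ?thesis using that[of "?G (l ?e)"] by (simp add: \<iota>_def)
qed

text \<open>A chart line of \<open>S\<close> seen in \<open>A\<close>. Together with
  \<open>velocity_in_submanifold\<close> it identifies the tangent vectors within \<open>S\<close>
  with the range of the differential of the inclusion.\<close>

lemma embedded_curve:
  assumes t: "smooth_transitions S A" and A: "smooth_atlas A" and S: "smooth_atlas S"
    and ch: "(U, \<phi>) \<in> S" "p \<in> U" and ch': "(V, \<psi>) \<in> A" "p \<in> V"
  obtains \<gamma> \<epsilon> where "C_curve 1 A \<gamma>" "\<gamma> 0 = p" "0 < \<epsilon>" "\<gamma> ` {-\<epsilon><..<\<epsilon>} \<subseteq> points S"
    "velocity A \<gamma> = chart_vector A V \<psi> p (frechet (\<psi> \<circ> inv_into U \<phi>) (\<phi> p) a)"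
proof -
  let ?\<iota> = "\<psi> \<circ> inv_into U \<phi>"
  let ?W = "\<phi> ` (U \<inter> V)"
  have injU: "inj_on \<phi> U" by (rule smooth_atlasD(1)[OF S ch(1)])
  have injV: "inj_on \<psi> V" by (rule smooth_atlasD(1)[OF A ch'(1)])
  have W: "open ?W" "\<phi> p \<in> ?W" using smooth_transitionsD(1)[OF t ch(1) ch'(1)] ch ch' by auto
  have C: "C_on 1 ?W ?\<iota>" unfolding C_on_1 by (rule transition_C_nat_on[OF t ch(1) ch'(1)])
  have im: "?\<iota> ` ?W \<subseteq> \<psi> ` V" "?\<iota> (\<phi> p) = \<psi> p" using ch injU by auto
  obtain \<gamma> \<epsilon> where \<gamma>: "C_curve 1 A \<gamma>" "\<gamma> 0 = p" "0 < \<epsilon>"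
    "velocity A \<gamma> = chart_vector A V \<psi> p (frechet ?\<iota> (\<phi> p) a)"
    "\<And>t. t \<in> {-\<epsilon><..<\<epsilon>} \<Longrightarrow> \<phi> p + t *\<^sub>R a \<in> ?W \<and> \<gamma> t = inv_into V \<psi> (?\<iota> (\<phi> p + t *\<^sub>R a))"
    by (rule chart_line_curve[OF A ch' W C im(2,1)
          transition_has_derivative[OF t ch(1) ch'(1) ch(2) ch'(2)] order_refl]) (rule that)
  have "\<gamma> t \<in> points S" if t: "t \<in> {-\<epsilon><..<\<epsilon>}" for t
  proof -
    obtain x where "x \<in> U" "x \<in> V" "\<phi> p + t *\<^sub>R a = \<phi> x" using \<gamma>(5)[OF t] by blast
    then show ?thesis using \<gamma>(5)[OF t] injU injV pointsI[OF ch(1)] by simp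
  qed
  then show ?thesis using \<gamma> by (intro that[of \<gamma> \<epsilon>]) auto
qed

section \<open>Leaves, the kernel of the differential of the quotient map, and
  transversality\<close>

context reduction
begin

lemma coord_transition:
  assumes S: "smooth_inclusion S X" and ch: "(U, \<phi>) \<in> S" "p \<in> U" and ch': "(V, \<psi>) \<in> X" "p \<in> V"
    and e: "basis_at Y y\<^sub>0 e"
  shows "dcoord e U \<phi> p a =
    dcoord e V \<psi> p (frechet (\<psi> \<circ> inv_into U \<phi>) (\<phi> p) a)"
proof -
  have SA: "smooth_atlas S" and t: "smooth_transitions S X" using S by (auto simp: smooth_inclusion_def)
  have injU: "inj_on \<phi> U" by (rule smooth_atlasD(1)[OF SA ch(1)])
  have injV: "inj_on \<psi> V" by (rule smooth_atlasD(1)[OF X ch'(1)])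
  let ?\<iota> = "\<psi> \<circ> inv_into U \<phi>"
  have "((coord e V \<psi> \<circ> ?\<iota>) has_derivative
    dcoord e V \<psi> p \<circ> frechet ?\<iota> (\<phi> p)) (at (\<phi> p))"
    by (rule diff_chain_at[OF transition_has_derivative[OF t ch(1) ch'(1) ch(2) ch'(2)]])
      (use coord_derivative[OF smooth_inclusion_refl ch' e] injU ch in simp)
  then have "(coord e U \<phi> has_derivative
    dcoord e V \<psi> p \<circ> frechet ?\<iota> (\<phi> p)) (at (\<phi> p))"
    by (rule has_derivative_transform_within_open[OF _ smooth_transitionsD(1)[OF t ch(1) ch'(1)]])
      (use ch ch' injU injV in \<open>auto simp: coord_def\<close>)
  from fun_cong[OF frechet_derivative_at[OF this], of a] show ?thesis by simp
qed

text \<open>\<open>Q\<close> is constant along a curve in a leaf, so the chain rule puts the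
  velocity into the kernel of its differential. The converse is \<open>leaf_curve\<close>.\<close>

lemma velocity_in_leaf:
  assumes ch: "(V, \<psi>) \<in> X" "p \<in> V" and e: "basis_at Y y\<^sub>0 e"
    and \<eta>: "C_curve 1 X \<eta>" "\<eta> 0 = p" "0 < \<delta>" "\<eta> ` {-\<delta><..<\<delta>} \<subseteq> leaf p"
  shows "dcoord e V \<psi> p (frechet (\<psi> \<circ> \<eta>) 0 1) = 0"
proof -
  obtain \<epsilon>' where \<epsilon>': "0 < \<epsilon>'" "\<eta> ` {-\<epsilon>'<..<\<epsilon>'} \<subseteq> V" "C_on 1 {-\<epsilon>'<..<\<epsilon>'} (\<psi> \<circ> \<eta>)"
    by (rule C_curve_chart[OF X ch(1) _ \<eta>(1)]) (use \<eta>(2) ch(2) in auto)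
  have v: "((\<psi> \<circ> \<eta>) has_vector_derivative frechet (\<psi> \<circ> \<eta>) 0 1) (at 0)"
    by (rule has_vector_derivative_frechet[OF \<epsilon>'(3)]) (use \<epsilon>'(1) in simp)
  let ?L = "dcoord e V \<psi> p"
  have L: "(coord e V \<psi> has_derivative ?L) (at ((\<psi> \<circ> \<eta>) 0))"
    using coord_derivative[OF smooth_inclusion_refl ch e] \<eta>(2) by simp
  from diff_chain_at[OF v[unfolded has_vector_derivative_def] L]
  have d: "((coord e V \<psi> \<circ> (\<psi> \<circ> \<eta>)) has_derivative
    (?L \<circ> (\<lambda>t. t *\<^sub>R frechet (\<psi> \<circ> \<eta>) 0 1))) (at 0)" .
  have "((coord e V \<psi> \<circ> (\<psi> \<circ> \<eta>)) has_derivative (\<lambda>t. 0)) (at 0)"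
  proof (rule has_derivative_transform_within_open[OF has_derivative_const])
    show "open {-min \<delta> \<epsilon>'<..<min \<delta> \<epsilon>'}" by simp
    show "0 \<in> {-min \<delta> \<epsilon>'<..<min \<delta> \<epsilon>'}" using \<eta>(3) \<epsilon>'(1) by simp
    fix t assume "t \<in> {-min \<delta> \<epsilon>'<..<min \<delta> \<epsilon>'}"
    then have "t \<in> {-\<delta><..<\<delta>}" "t \<in> {-\<epsilon>'<..<\<epsilon>'}" by auto
    then have "\<eta> t \<in> leaf p" "\<eta> t \<in> V" using \<eta>(4) \<epsilon>'(2) by blast+
    then show "Zchart e (leaf p) = (coord e V \<psi> \<circ> (\<psi> \<circ> \<eta>)) t"
      using coord_chart[OF smooth_inclusion_refl ch(1)] leaf_eq by simp
  qed
  from fun_cong[OF has_derivative_unique[OF d this], of 1] show ?thesis by simp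
qed

text \<open>The straightening map carries the line through \<open>\<psi> p\<close> in a kernel
  direction into the leaf; its derivative at the base point is the identity, so the curve has
  exactly the prescribed velocity.\<close>

lemma leaf_curve:
  assumes ch: "(V, \<psi>) \<in> X" "p \<in> V" and e: "basis_at Y y\<^sub>0 e"
    and a: "dcoord e V \<psi> p a = 0"
  obtains \<eta> \<epsilon> where "C_curve 1 X \<eta>" "\<eta> 0 = p" "0 < \<epsilon>" "\<eta> ` {-\<epsilon><..<\<epsilon>} \<subseteq> leaf p"
    "velocity X \<eta> = chart_vector X V \<psi> p a"
proof -
  obtain N g where g: "open N" "\<psi> p \<in> N" "C_nat_on 3 N g" "g (\<psi> p) = \<psi> p" "g ` N \<subseteq> \<psi> ` V"
    "(g has_derivative (\<lambda>h. h)) (at (\<psi> p))"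
    "\<And>v. v \<in> N \<Longrightarrow> coord e V \<psi> (g v) = coord e V \<psi> (\<psi> p) + dcoord e V \<psi> p (v - \<psi> p)"
    by (rule coord_straightening[OF ch e]) (rule that)
  have C: "C_on 1 N g" unfolding C_on_1 by (rule C_nat_on_mono[OF g(3)]) simp
  obtain \<eta> \<epsilon> where \<eta>: "C_curve 1 X \<eta>" "\<eta> 0 = p" "0 < \<epsilon>" "velocity X \<eta> = chart_vector X V \<psi> p a"
    "\<And>t. t \<in> {-\<epsilon><..<\<epsilon>} \<Longrightarrow> \<psi> p + t *\<^sub>R a \<in> N \<and> \<eta> t = inv_into V \<psi> (g (\<psi> p + t *\<^sub>R a))"
    by (rule chart_line_curve[OF X ch g(1,2) C g(4,5,6) order_refl]) (rule that)
  have linL: "linear (dcoord e V \<psi> p)"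
    by (rule has_derivative_linear[OF coord_derivative[OF smooth_inclusion_refl ch e]])
  have "\<eta> t \<in> leaf p" if t: "t \<in> {-\<epsilon><..<\<epsilon>}" for t
  proof -
    note \<eta>t = \<eta>(5)[OF t]
    have x: "\<eta> t \<in> points X" using \<eta>t g(5) by (auto intro!: pointsI[OF ch(1)] inv_into_into)
    have "Zchart e (leaf (\<eta> t)) = coord e V \<psi> (g (\<psi> p + t *\<^sub>R a))" using \<eta>t by (simp add: coord_def)
    also have "\<dots> = Zchart e (leaf p)"
      using g(7) \<eta>t a coord_chart[OF smooth_inclusion_refl ch] by (simp add: linear_cmul[OF linL])
    finally have "leaf (\<eta> t) = leaf p"
      using Zchart_inj[OF e] leaf_in_leaves[OF x] leaf_in_leaves[OF pointsI[OF ch]] by (meson inj_onD)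
    then show ?thesis using leaf_self[OF x] by simp
  qed
  then show ?thesis using \<eta> by (intro that[of \<eta> \<epsilon>]) auto
qed

text \<open>Leaf directions are killed by the differential of \<open>Q\<close>. If together with the
  directions of \<open>S\<close> they span the tangent space of \<open>X\<close>, the latter alone
  have the full image, which is everything by \<open>coord_submersion\<close>.\<close>

lemma transverse_imp_surj:
  fixes S :: "('a, real ^ 'k::finite) atlas"
  assumes emb: "smoothly_embedded S X" and SA: "smooth_atlas S" and ch: "(U, \<phi>) \<in> S" "p \<in> U"
    and e: "basis_at Y y\<^sub>0 e" and tr: "transverse_at X (points S) (leaf p) p"
  shows "surj (dcoord e U \<phi> p)"
  unfolding surj_def
proof
  have S: "smooth_inclusion S X" by (rule smoothly_embedded_inclusion[OF emb X SA])
  fix \<xi> :: "real ^ 'n"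
  have "p \<in> points X" using pointsI[OF ch] S by (auto simp: smooth_inclusion_def)
  then obtain V \<psi> where ch': "(V, \<psi>) \<in> X" "p \<in> V" by (rule pointsE)
  let ?L = "dcoord e V \<psi> p"
  have linL: "linear ?L"
    by (rule has_derivative_linear[OF coord_derivative[OF smooth_inclusion_refl ch' e]])
  obtain a where a: "?L a = \<xi>" using coord_submersion[OF ch' e] by (metis surjD)
  have "chart_vector X V \<psi> p a \<in> tangent_space X p" unfolding tangent_space_eq[OF X ch'] by simp
  then obtain u w where uw: "chart_vector X V \<psi> p a = (\<lambda>f. u f + w f)"
    "u \<in> tangent_within X (points S) p" "w \<in> tangent_within X (leaf p) p"
    using tr unfolding transverse_at_def by blast
  obtain \<gamma> \<delta> where \<gamma>: "u = velocity X \<gamma>" "C_curve 1 X \<gamma>" "\<gamma> 0 = p" "0 < \<delta>" "\<gamma> ` {-\<delta><..<\<delta>} \<subseteq> points S"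
    using uw(2) unfolding tangent_within_def by blast
  obtain \<eta> \<delta>' where \<eta>: "w = velocity X \<eta>" "C_curve 1 X \<eta>" "\<eta> 0 = p" "0 < \<delta>'" "\<eta> ` {-\<delta>'<..<\<delta>'} \<subseteq> leaf p"
    using uw(3) unfolding tangent_within_def by blast
  let ?a = "frechet (\<psi> \<circ> \<gamma>) 0 1" and ?b = "frechet (\<psi> \<circ> \<eta>) 0 1"
  have "chart_vector X V \<psi> p a = chart_vector X V \<psi> p (?a + ?b)"
    unfolding uw(1) \<gamma>(1) \<eta>(1) velocity_C_curve[OF X ch' \<gamma>(3,2)] velocity_C_curve[OF X ch' \<eta>(3,2)]
      chart_vector_add[OF X ch'] ..
  then have ab: "a = ?a + ?b" by (rule chart_vector_inj[OF X ch'])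
  have b: "?L ?b = 0" by (rule velocity_in_leaf[OF ch' e \<eta>(2-5)])
  obtain a' where a': "frechet (\<psi> \<circ> inv_into U \<phi>) (\<phi> p) a' = ?a"
    by (rule velocity_in_submanifold[OF emb X SA ch ch' \<gamma>(2-5)])
  have "dcoord e U \<phi> p a' = \<xi>"
    unfolding coord_transition[OF S ch ch' e] a' using a b by (simp add: ab linear_add[OF linL])
  then show "\<exists>a. \<xi> = dcoord e U \<phi> p a" by blast
qed

text \<open>For a tangent vector of \<open>X\<close>, surjectivity yields a vector of
  \<open>S\<close> with the same image under the differential of \<open>Q\<close>; the difference
  lies in the kernel and is realised by a curve in the leaf.\<close>

lemma surj_imp_transverse:
  assumes S: "smooth_inclusion S X" and ch: "(U, \<phi>) \<in> S" "p \<in> U"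
    and e: "basis_at Y y\<^sub>0 e" and surj: "surj (dcoord e U \<phi> p)"
  shows "transverse_at X (points S) (leaf p) p"
  unfolding transverse_at_def
proof (intro equalityI subsetI)
  have SA: "smooth_atlas S" and t: "smooth_transitions S X" and sub: "points S \<subseteq> points X"
    using S by (auto simp: smooth_inclusion_def)
  have "p \<in> points X" using pointsI[OF ch] sub by auto
  then obtain V \<psi> where ch': "(V, \<psi>) \<in> X" "p \<in> V" by (rule pointsE)
  let ?R = "{\<lambda>f. u f + w f | u w. u \<in> tangent_within X (points S) p \<and> w \<in> tangent_within X (leaf p) p}"
  note T = tangent_space_eq[OF X ch']
  {
    fix v assume "v \<in> ?R"
    then obtain u w where v: "v = (\<lambda>f. u f + w f)" "u \<in> tangent_within X (points S) p" "w \<in> tangent_within X (leaf p) p"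
      by blast
    then have "u \<in> tangent_space X p" "w \<in> tangent_space X p"
      unfolding tangent_within_def tangent_space_def by blast+
    then obtain a a' where "u = chart_vector X V \<psi> p a" "w = chart_vector X V \<psi> p a'" unfolding T by blast
    then have "v = chart_vector X V \<psi> p (a + a')" unfolding v(1) chart_vector_add[OF X ch'] by simp
    then show "v \<in> tangent_space X p" unfolding T by simp
  next
    fix v assume "v \<in> tangent_space X p"
    then obtain a where a: "v = chart_vector X V \<psi> p a" unfolding T by blast
    let ?L = "dcoord e V \<psi> p"
    let ?D = "frechet (\<psi> \<circ> inv_into U \<phi>) (\<phi> p)"
    have linL: "linear ?L"
      by (rule has_derivative_linear[OF coord_derivative[OF smooth_inclusion_refl ch' e]])
    obtain a' where "dcoord e U \<phi> p a' = ?L a" using surj by (metis surjD)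
    then have "?L (a - ?D a') = 0"
      unfolding coord_transition[OF S ch ch' e] by (simp add: linear_diff[OF linL])
    then obtain \<eta> \<epsilon> where \<eta>: "C_curve 1 X \<eta>" "\<eta> 0 = p" "0 < \<epsilon>" "\<eta> ` {-\<epsilon><..<\<epsilon>} \<subseteq> leaf p"
      "velocity X \<eta> = chart_vector X V \<psi> p (a - ?D a')" by (rule leaf_curve[OF ch' e])
    obtain \<gamma> \<delta> where \<gamma>: "C_curve 1 X \<gamma>" "\<gamma> 0 = p" "0 < \<delta>" "\<gamma> ` {-\<delta><..<\<delta>} \<subseteq> points S"
      "velocity X \<gamma> = chart_vector X V \<psi> p (?D a')"
      by (rule embedded_curve[OF t X SA ch ch'])
    have "v = (\<lambda>f. velocity X \<gamma> f + velocity X \<eta> f)"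
      unfolding a \<gamma>(5) \<eta>(5) chart_vector_add[OF X ch', symmetric] by simp
    moreover have "velocity X \<gamma> \<in> tangent_within X (points S) p"
      unfolding tangent_within_def using \<gamma> by blast
    moreover have "velocity X \<eta> \<in> tangent_within X (leaf p) p"
      unfolding tangent_within_def using \<eta> by blast
    ultimately show "v \<in> ?R" by blast
  }
qed

end

section \<open>Construction of transversal surfaces\<close>

lemma transition_derivative_inj:
  assumes X: "smooth_atlas X" and ch: "(U, \<phi>) \<in> X" "p \<in> U" and ch': "(V, \<psi>) \<in> X" "p \<in> V"
  shows "inj (frechet (\<psi> \<circ> inv_into U \<phi>) (\<phi> p))"
proof -
  note t = smooth_transitions_refl[OF X]
  have inj: "inj_on \<phi> U" "inj_on \<psi> V" using smooth_atlasD X ch ch' by blast+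
  let ?D = "frechet (\<psi> \<circ> inv_into U \<phi>) (\<phi> p)"
  let ?E = "frechet (\<phi> \<circ> inv_into V \<psi>) (\<psi> p)"
  have "((\<phi> \<circ> inv_into V \<psi> \<circ> (\<psi> \<circ> inv_into U \<phi>)) has_derivative ?E \<circ> ?D) (at (\<phi> p))"
    by (rule diff_chain_at[OF transition_has_derivative[OF t ch(1) ch'(1) ch(2) ch'(2)]])
      (use transition_has_derivative[OF t ch'(1) ch(1) ch'(2) ch(2)] inj ch in simp)
  then have "((\<lambda>s. s) has_derivative ?E \<circ> ?D) (at (\<phi> p))"
    by (rule has_derivative_transform_within_open[OF _ smooth_transitionsD(1)[OF t ch(1) ch'(1)]])
      (use ch ch' inj in auto)
  then have "?E \<circ> ?D = (\<lambda>h. h)" using has_derivative_ident has_derivative_unique by blast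
  then show ?thesis by (metis comp_apply injI)
qed

text \<open>The slice carries a single chart, the ambient chart followed by a linear left inverse of
  \<open>A\<close>. The immersion condition reduces to injectivity of \<open>A\<close> and of the
  derivatives of the transition maps of \<open>X\<close>.\<close>

lemma chart_slice:
  fixes X :: "('a, 'e::euclidean_space) atlas" and A :: "'f::euclidean_space \<Rightarrow> 'e"
  assumes X: "smooth_manifold X" and ch: "(U, \<phi>) \<in> X" and A: "linear A" "inj A"
    and B: "open B" "(\<lambda>w. s0 + A w) ` B \<subseteq> \<phi> ` U"
  obtains D \<theta> where "smooth_manifold {(D, \<theta>)}" "smoothly_embedded {(D, \<theta>)} X"
    "D = (\<lambda>w. inv_into U \<phi> (s0 + A w)) ` B"
    "\<And>w. w \<in> B \<Longrightarrow> inv_into D \<theta> w = inv_into U \<phi> (s0 + A w)"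
    "\<And>w. w \<in> B \<Longrightarrow> \<theta> (inv_into U \<phi> (s0 + A w)) = w"
proof -
  have XA: "smooth_atlas X" using X by (simp add: smooth_manifold_def)
  have inj: "inj_on \<phi> U" by (rule smooth_atlasD(1)[OF XA ch])
  obtain l where l: "linear l" "l \<circ> A = id" using linear_injective_left_inverse[OF A] by blast
  have lA: "l (A w) = w" for w using l(2) by (metis comp_apply id_apply)
  have bl: "bounded_linear l" "bounded_linear A" using l A by (simp_all add: linear_conv_bounded_linear)
  define \<iota> where "\<iota> = (\<lambda>w. s0 + A w)"
  define j where "j = (\<lambda>w. inv_into U \<phi> (\<iota> w))"
  define D where "D = j ` B"
  define \<theta> where "\<theta> = (\<lambda>x. l (\<phi> x - s0))"
  let ?S = "{(D, \<theta>)}"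
  have \<iota>B: "\<iota> w \<in> \<phi> ` U" if "w \<in> B" for w using B(2) that by (auto simp: \<iota>_def)
  have jU: "j w \<in> U" "\<phi> (j w) = \<iota> w" if "w \<in> B" for w
    using \<iota>B[OF that] by (simp_all add: j_def inv_into_into f_inv_into_f)
  have \<theta>j: "\<theta> (j w) = w" if "w \<in> B" for w using jU(2)[OF that] by (simp add: \<theta>_def \<iota>_def lA)
  have inj\<theta>: "inj_on \<theta> D" by (rule inj_onI) (auto simp: D_def \<theta>j)
  have \<theta>D: "\<theta> ` D = B" using \<theta>j by (force simp: D_def)
  have inv: "inv_into D \<theta> w = j w" if "w \<in> B" for w
    by (rule inv_into_f_eq[OF inj\<theta>]) (use that \<theta>j in \<open>auto simp: D_def\<close>)
  have DU: "D \<subseteq> U" using jU(1) by (auto simp: D_def)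
  have C\<iota>: "C_nat_on k B \<iota>" for k unfolding \<iota>_def
    by (intro C_nat_on_add[OF B(1) C_nat_on_const] C_nat_on_bounded_linear[OF bl(2) B(1)])
  have cont\<iota>: "continuous_on UNIV \<iota>" unfolding \<iota>_def
    using linear_continuous_on[OF bl(2)] by (intro continuous_intros)
  have "C_nat_on k B (\<theta> \<circ> inv_into D \<theta>)" for k
    by (rule C_nat_on_cong[OF B(1) _ C_nat_on_ident[OF B(1)]]) (simp add: inv \<theta>j)
  then have S: "smooth_atlas ?S"
    unfolding smooth_atlas_iff smooth_transitions_def using inj\<theta> B(1) by (auto simp: \<theta>D C_on_infinity)
  have im: "\<theta> ` (D \<inter> G) = {w \<in> B. \<iota> w \<in> \<phi> ` (U \<inter> G)}" for G
  proof (intro equalityI subsetI)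
    fix w assume "w \<in> \<theta> ` (D \<inter> G)"
    then have w: "w \<in> B" "j w \<in> G" using \<theta>j by (auto simp: D_def)
    then show "w \<in> {w \<in> B. \<iota> w \<in> \<phi> ` (U \<inter> G)}" using jU[OF w(1)] by (metis (mono_tags) IntI image_eqI mem_Collect_eq)
  next
    fix w assume "w \<in> {w \<in> B. \<iota> w \<in> \<phi> ` (U \<inter> G)}"
    then obtain x where w: "w \<in> B" "\<iota> w = \<phi> x" "x \<in> U" "x \<in> G" by blast
    then have "j w = x" using inj by (simp add: j_def)
    then show "w \<in> \<theta> ` (D \<inter> G)" using w(1,4) \<theta>j[OF w(1)] by (intro image_eqI[of w \<theta> "j w"]) (auto simp: D_def)
  qed
  have sub_open: "open {w \<in> B. \<iota> w \<in> \<phi> ` (U \<inter> G)}" if "openin (manifold_topology X) G" for G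
    by (rule open_preimage_within[OF B(1) C_nat_on_imp_continuous_on[OF C\<iota>] open_chart_image[OF XA that ch]])
  have Sp: "points ?S = D" by (simp add: points_def)
  have top: "manifold_topology ?S = subtopology (manifold_topology X) D"
    unfolding topology_eq
  proof (intro allI iffI)
    fix G assume G: "openin (manifold_topology ?S) G"
    then have GD: "G \<subseteq> D" using openin_subset[OF G] Sp by simp
    have o: "open (\<theta> ` (D \<inter> G))" by (rule open_chart_image[OF S G]) simp
    \<comment> \<open>The formula for \<open>\<theta>\<close> makes sense on all of
      \<open>U\<close>, so an open set of the slice is the trace of an open set of
      \<open>X\<close>.\<close>
    have "open ((\<lambda>s. l (s - s0)) -` (\<theta> ` (D \<inter> G)))"
      by (rule open_vimage[OF o]) (intro continuous_intros bounded_linear.continuous_on[OF bl(1)])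
    then have "openin (manifold_topology X) {x \<in> U. \<phi> x \<in> (\<lambda>s. l (s - s0)) -` (\<theta> ` (D \<inter> G))}"
      by (rule openin_chart_preimage[OF ch])
    moreover have "G = {x \<in> U. \<phi> x \<in> (\<lambda>s. l (s - s0)) -` (\<theta> ` (D \<inter> G))} \<inter> D"
    proof (intro equalityI subsetI)
      fix x assume "x \<in> G"
      then show "x \<in> {x \<in> U. \<phi> x \<in> (\<lambda>s. l (s - s0)) -` (\<theta> ` (D \<inter> G))} \<inter> D"
        using GD DU by (auto simp: \<theta>_def)
    next
      fix x assume x: "x \<in> {x \<in> U. \<phi> x \<in> (\<lambda>s. l (s - s0)) -` (\<theta> ` (D \<inter> G))} \<inter> D"
      then have "\<theta> x \<in> \<theta> ` (D \<inter> G)" by (simp add: \<theta>_def)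
      then show "x \<in> G" using x inj\<theta> by (auto dest: inj_onD)
    qed
    ultimately show "openin (subtopology (manifold_topology X) D) G"
      unfolding openin_subtopology by blast
  next
    fix G assume "openin (subtopology (manifold_topology X) D) G"
    then obtain H where H: "openin (manifold_topology X) H" "G = H \<inter> D" unfolding openin_subtopology by blast
    have "openin (manifold_topology ?S) {x \<in> D. \<theta> x \<in> {w \<in> B. \<iota> w \<in> \<phi> ` (U \<inter> H)}}"
      by (rule openin_chart_preimage[OF _ sub_open[OF H(1)]]) simp
    moreover have "{x \<in> D. \<theta> x \<in> {w \<in> B. \<iota> w \<in> \<phi> ` (U \<inter> H)}} = G"
      unfolding im[symmetric] H(2) using inj\<theta> by (auto dest: inj_onD)
    ultimately show "openin (manifold_topology ?S) G" by simp
  qed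
  have man: "smooth_manifold ?S"
    using X S top Hausdorff_space_subtopology second_countable_subtopology unfolding smooth_manifold_def by metis
  have trans: "C_on \<infinity> (\<theta> ` (D \<inter> V)) (\<psi> \<circ> inv_into D \<theta>) \<and>
      (\<forall>w\<in>\<theta> ` (D \<inter> V). inj (frechet (\<psi> \<circ> inv_into D \<theta>) w))" if ch': "(V, \<psi>) \<in> X" for V \<psi>
  proof
    define W where "W = \<theta> ` (D \<inter> V)"
    have W: "open W" unfolding W_def im by (rule sub_open[OF openin_chart_domain[OF ch']])
    have W_im: "W = {w \<in> B. \<iota> w \<in> \<phi> ` (U \<inter> V)}" by (simp add: W_def im)
    have eq: "(\<psi> \<circ> inv_into U \<phi>) (\<iota> w) = (\<psi> \<circ> inv_into D \<theta>) w" if "w \<in> W" for w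
      using that by (simp add: W_im inv j_def)
    have "C_nat_on k W (\<lambda>w. (\<psi> \<circ> inv_into U \<phi>) (\<iota> w))" for k
      by (rule C_nat_on_compose[OF W transition_C_nat_on[OF smooth_transitions_refl[OF XA] ch ch'] C_nat_on_subset[OF C\<iota>]])
        (auto simp: W_im)
    then have "C_nat_on k W (\<psi> \<circ> inv_into D \<theta>)" for k
      by (rule C_nat_on_cong[OF W, rotated]) (rule eq)
    then show "C_on \<infinity> (\<theta> ` (D \<inter> V)) (\<psi> \<circ> inv_into D \<theta>)" by (simp add: C_on_infinity W_def)
    show "\<forall>w\<in>\<theta> ` (D \<inter> V). inj (frechet (\<psi> \<circ> inv_into D \<theta>) w)"
      unfolding W_def[symmetric]
    proof
      fix w assume w: "w \<in> W"
      then obtain x where x: "\<iota> w = \<phi> x" "x \<in> U" "x \<in> V" by (auto simp: W_im)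
      let ?E = "frechet (\<psi> \<circ> inv_into U \<phi>) (\<phi> x)"
      have "(\<iota> has_derivative A) (at w)" unfolding \<iota>_def
        using bounded_linear_imp_has_derivative[OF bl(2)] by (auto intro!: derivative_eq_intros)
      from diff_chain_at[OF this, of "\<psi> \<circ> inv_into U \<phi>" ?E]
        transition_has_derivative[OF smooth_transitions_refl[OF XA] ch ch' x(2,3)]
      have "((\<lambda>w. (\<psi> \<circ> inv_into U \<phi>) (\<iota> w)) has_derivative (\<lambda>h. ?E (A h))) (at w)"
        by (simp add: x(1) o_def)
      then have "((\<psi> \<circ> inv_into D \<theta>) has_derivative (\<lambda>h. ?E (A h))) (at w)"
        by (rule has_derivative_transform_within_open[OF _ W w]) (rule eq)
      then have "frechet (\<psi> \<circ> inv_into D \<theta>) w = (\<lambda>h. ?E (A h))"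
        by (rule frechet_derivative_at[symmetric])
      moreover have "inj (\<lambda>h. ?E (A h))"
        using inj_compose[OF transition_derivative_inj[OF XA ch x(2) ch' x(3)] A(2)] by (simp add: o_def)
      ultimately show "inj (frechet (\<psi> \<circ> inv_into D \<theta>) w)" by simp
    qed
  qed
  have "D \<subseteq> points X" using DU pointsI[OF ch] by auto
  then have emb: "smoothly_embedded ?S X"
    unfolding smoothly_embedded_def Sp using top trans by auto
  show ?thesis
    by (rule that[OF man emb]) (use inv \<theta>j in \<open>simp_all add: D_def j_def \<iota>_def\<close>)
qed

context reduction
begin

text \<open>With \<open>A\<close> a right inverse of the differential of \<open>Q\<close> at
  \<open>x\<close>, the map \<open>Q\<close> along the slice has the identity as derivative at 0.
  The inverse function theorem yields a neighbourhood on which this derivative stays bijective, so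
  the disc is transversal at each of its points and not just at \<open>x\<close>.\<close>

lemma transversal_disc:
  assumes X': "smooth_manifold X" and x: "x \<in> points X" and e: "basis_at Y y\<^sub>0 e"
  obtains S :: "('a, real ^ 'n) atlas" where "smooth_manifold S" "smoothly_embedded S X" "x \<in> points S"
    "\<And>U \<phi> p. (U, \<phi>) \<in> S \<Longrightarrow> p \<in> U \<Longrightarrow> surj (dcoord e U \<phi> p)"
proof -
  obtain U \<phi> where ch: "(U, \<phi>) \<in> X" "x \<in> U" using x by (rule pointsE)
  let ?q = "coord e U \<phi>"
  let ?L = "frechet ?q (\<phi> x)"
  have dq: "(?q has_derivative ?L) (at (\<phi> x))"
    by (rule coord_derivative[OF smooth_inclusion_refl ch e])
  obtain A where A: "linear A" "?L \<circ> A = id"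
    using linear_surjective_right_inverse[OF has_derivative_linear[OF dq] coord_submersion[OF ch e]] by blast
  have LA: "?L (A w) = w" for w using A(2) by (metis comp_apply id_apply)
  have injA: "inj A" by (rule injI) (metis LA)
  have bA: "bounded_linear A" using A(1) by (simp add: linear_conv_bounded_linear)
  define \<iota> where "\<iota> = (\<lambda>w. \<phi> x + A w)"
  have C\<iota>: "C_nat_on k UNIV \<iota>" for k unfolding \<iota>_def
    by (intro C_nat_on_add C_nat_on_const C_nat_on_bounded_linear[OF bA]) auto
  define W where "W = \<iota> -` (\<phi> ` U)"
  have W: "open W" unfolding W_def
    using C_nat_on_imp_continuous_on[OF C\<iota>] smooth_atlasD(2)[OF X ch(1)] by (intro open_vimage) auto
  have \<iota>0: "\<iota> 0 = \<phi> x" using linear_0[OF A(1)] by (simp add: \<iota>_def)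
  have W0: "0 \<in> W" using \<iota>0 ch(2) by (simp add: W_def)
  have "C_nat_on 3 W (\<lambda>w. ?q (\<iota> w))"
    by (rule C_nat_on_compose[OF W coord_smooth[OF smooth_inclusion_refl ch(1) e] C_nat_on_subset[OF C\<iota>]])
      (auto simp: W_def)
  then have C: "C_nat_on (Suc 2) W (\<lambda>w. ?q (\<iota> w))" by (simp add: eval_nat_numeral)
  have "(\<iota> has_derivative A) (at 0)" unfolding \<iota>_def
    using bounded_linear_imp_has_derivative[OF bA] by (auto intro!: derivative_eq_intros)
  from diff_chain_at[OF this, of ?q ?L] dq \<iota>0
  have "((\<lambda>w. ?q (\<iota> w)) has_derivative (\<lambda>h. h)) (at 0)" by (simp add: o_def LA)
  then have "frechet (\<lambda>w. ?q (\<iota> w)) 0 = (\<lambda>h. h)" by (rule frechet_derivative_at[symmetric])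
  then have "inj (frechet (\<lambda>w. ?q (\<iota> w)) 0)" by (simp add: inj_def)
  from C_inverse_function[OF C W W0 this]
  obtain B V g where B: "open B" "B \<subseteq> W" "0 \<in> B" "open V" "?q (\<iota> 0) \<in> V" "homeomorphism B V (\<lambda>w. ?q (\<iota> w)) g"
    "C_nat_on (Suc 2) V g" "\<And>w. w \<in> B \<Longrightarrow> bij (frechet (\<lambda>w. ?q (\<iota> w)) w)" by metis
  have im: "(\<lambda>w. \<phi> x + A w) ` B \<subseteq> \<phi> ` U" using B(2) by (auto simp: W_def \<iota>_def)
  obtain D \<theta> where D: "smooth_manifold {(D, \<theta>)}" "smoothly_embedded {(D, \<theta>)} X"
    "D = (\<lambda>w. inv_into U \<phi> (\<phi> x + A w)) ` B"
    "\<And>w. w \<in> B \<Longrightarrow> inv_into D \<theta> w = inv_into U \<phi> (\<phi> x + A w)"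
    "\<And>w. w \<in> B \<Longrightarrow> \<theta> (inv_into U \<phi> (\<phi> x + A w)) = w"
    by (rule chart_slice[OF X' ch(1) A(1) injA B(1) im]) (rule that)
  show ?thesis
  proof (rule that[OF D(1,2)])
    have "inv_into U \<phi> (\<phi> x + A 0) = x"
      using linear_0[OF A(1)] smooth_atlasD(1)[OF X ch(1)] ch(2) by simp
    then have "x \<in> D" unfolding D(3) using B(3) by (metis image_eqI)
    then show "x \<in> points {(D, \<theta>)}" by (simp add: points_def)
    fix U' \<phi>' p assume "(U', \<phi>') \<in> {(D, \<theta>)}" "p \<in> U'"
    then have U': "U' = D" "\<phi>' = \<theta>" "p \<in> D" by auto
    then obtain w where w: "w \<in> B" "p = inv_into U \<phi> (\<phi> x + A w)" unfolding D(3) by blast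
    have "(\<lambda>w. ?q (\<iota> w)) differentiable (at w)"
      by (rule C_nat_on_differentiable[OF C]) (use w(1) B(2) in auto)
    then have "frechet (\<lambda>w. ?q (\<iota> w)) w = frechet (coord e D \<theta>) w"
      by (rule frechet_derivative_transform_within_open[OF _ B(1) w(1)]) (simp add: coord_def \<iota>_def D(4))
    then show "surj (frechet (coord e U' \<phi>') (\<phi>' p))"
      using B(8)[OF w(1)] unfolding U' w(2) D(5)[OF w(1)] by (simp add: bij_is_surj)
  qed
qed

lemma A3S_surfaces_iff:
  assumes X': "smooth_manifold X"
  shows "A3S X Y c \<longleftrightarrow>
    (\<forall>S :: ('a, real ^ 'n) atlas.
       smooth_manifold S \<and> smoothly_embedded S X \<and>
       (\<forall>x\<in>points X. \<forall>p\<in>points S \<inter> level_set X Y c x y\<^sub>0.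
          transverse_at X (points S) (level_set X Y c x y\<^sub>0) p)
       \<longrightarrow> A3S S Y c)"
    (is "_ \<longleftrightarrow> (\<forall>S. ?H S \<longrightarrow> _)")
proof
  obtain e :: "'n \<Rightarrow> 'b tangent" where e: "basis_at Y y\<^sub>0 e" using basis_exists by blast
  assume "A3S X Y c"
  then have Z: "A3S Z Y b" by (simp add: A3S_quotient_iff)
  show "\<forall>S. ?H S \<longrightarrow> A3S S Y c"
  proof (intro allI impI)
    fix S :: "('a, real ^ 'n) atlas" assume S: "?H S"
    then have SA: "smooth_atlas S" and emb: "smoothly_embedded S X" by (auto simp: smooth_manifold_def)
    note inc = smoothly_embedded_inclusion[OF emb X SA]
    have sub: "points S \<subseteq> points X" using inc by (simp add: smooth_inclusion_def)
    show "A3S S Y c"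
      unfolding A3S_iff
    proof
      fix p assume p: "p \<in> points S"
      then obtain U \<phi> where ch: "(U, \<phi>) \<in> S" "p \<in> U" by (rule pointsE)
      have "p \<in> points X" using p sub by blast
      \<comment> \<open>The transversality hypothesis is applied with \<open>x = p\<close>, whose
        level set is the leaf through \<open>p\<close>.\<close>
      moreover then have "p \<in> points S \<inter> level_set X Y c p y\<^sub>0"
        using p leaf_self by (simp add: leaf_def)
      ultimately have "transverse_at X (points S) (leaf p) p"
        using S unfolding leaf_def by blast
      then have "A3S_at S c p \<longleftrightarrow> A3S_at Z b (leaf p)"
        by (intro A3S_at_submanifold_iff[OF inc ch e] transverse_imp_surj[OF emb SA ch e])
      then show "A3S_at S c p"
        using Z leaf_in_leaves[OF \<open>p \<in> points X\<close>] by (simp add: A3S_iff Z_points)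
    qed
  qed
next
  obtain e :: "'n \<Rightarrow> 'b tangent" where e: "basis_at Y y\<^sub>0 e" using basis_exists by blast
  assume all: "\<forall>S. ?H S \<longrightarrow> A3S S Y c"
  have "A3S_at X c x" if x: "x \<in> points X" for x
  proof -
    obtain S :: "('a, real ^ 'n) atlas" where S: "smooth_manifold S" "smoothly_embedded S X" "x \<in> points S"
      and surj: "\<And>U \<phi> p. (U, \<phi>) \<in> S \<Longrightarrow> p \<in> U \<Longrightarrow> surj (dcoord e U \<phi> p)"
      by (rule transversal_disc[OF X' x e]) (rule that)
    have SA: "smooth_atlas S" using S(1) by (simp add: smooth_manifold_def)
    note inc = smoothly_embedded_inclusion[OF S(2) X SA]
    have "transverse_at X (points S) (level_set X Y c x' y\<^sub>0) p"
      if "p \<in> points S" "p \<in> level_set X Y c x' y\<^sub>0" for x' p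
    proof -
      obtain U \<phi> where ch: "(U, \<phi>) \<in> S" "p \<in> U" using \<open>p \<in> points S\<close> by (rule pointsE)
      \<comment> \<open>A level set meeting \<open>S\<close> at \<open>p\<close> is the leaf of
        \<open>p\<close> itself, so it is enough to treat that leaf.\<close>
      have "leaf p = level_set X Y c x' y\<^sub>0"
        using leaf_eq[of p x'] that(2) by (simp add: leaf_def)
      then show ?thesis using surj_imp_transverse[OF inc ch e surj[OF ch]] by simp
    qed
    then have "A3S S Y c" using all S(1,2) by blast
    then have "A3S_at S c x" using S(3) by (simp add: A3S_iff)
    moreover obtain U \<phi> where ch: "(U, \<phi>) \<in> S" "x \<in> U" using S(3) by (rule pointsE)
    ultimately have Zx: "A3S_at Z b (leaf x)"
      using A3S_at_submanifold_iff[OF inc ch e surj[OF ch]] by simp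
    obtain V \<psi> where ch': "(V, \<psi>) \<in> X" "x \<in> V" using x by (rule pointsE)
    show "A3S_at X c x"
      using A3S_at_submanifold_iff[OF smooth_inclusion_refl ch' e coord_submersion[OF ch' e]] Zx by simp
  qed
  then show "A3S X Y c" by (simp add: A3S_iff)
qed

end

text \<open>\<open>C_on_subset\<close> provides local C^4 extensions of \<open>c\<close> from the
  product of the closures in \<open>M\<close> and \<open>N\<close>. Such an extension agrees with
  \<open>c\<close> at the points of \<open>X\<close> and \<open>Y\<close>, and the smooth inclusions
  turn it into C^4 regularity in the product atlas of \<open>X\<close> and \<open>Y\<close>.
  Injectivity on the closure restricts to \<open>points Y\<close>.\<close>

lemma reductionI:
  fixes X :: "('a, real ^ 'm::finite) atlas"
    and Y :: "('b, real ^ 'n::finite) atlas"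
    and M :: "('a, 'p::euclidean_space) atlas"
    and N :: "('b, 'q::euclidean_space) atlas"
  assumes X: "smooth_manifold X" and Y: "smooth_manifold Y"
    and conn: "connected_space (manifold_topology Y)"
    and M: "smooth_manifold M" and N: "smooth_manifold N"
    and XM: "smoothly_embedded X M" and YN: "smoothly_embedded Y N"
    and c: "C_on_subset 4 (product_atlas M N)
           ((manifold_topology M closure_of points X) \<times> (manifold_topology N closure_of points Y))
           (\<lambda>(x, y). c x y)"
    and twist: "twisted X (manifold_topology N closure_of points Y) c"
    and nondeg: "nondegenerate X Y c" and y0: "y\<^sub>0 \<in> points Y" and red: "reduced_cost X Y c y\<^sub>0 b"
  shows "reduction X Y c y\<^sub>0 b"
proof
  show XA: "smooth_atlas X" and YA: "smooth_atlas Y" using X Y by (simp_all add: smooth_manifold_def)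
  have MA: "smooth_atlas M" and NA: "smooth_atlas N" using M N by (simp_all add: smooth_manifold_def)
  note iX = smoothly_embedded_inclusion[OF XM MA XA] and iY = smoothly_embedded_inclusion[OF YN NA YA]
  have sub: "points X \<subseteq> points M" "points Y \<subseteq> points N" using iX iY by (simp_all add: smooth_inclusion_def)
  have cl: "points X \<subseteq> manifold_topology M closure_of points X" "points Y \<subseteq> manifold_topology N closure_of points Y"
    using sub by (simp_all add: closure_of_subset)
  show "twisted X (points Y) c"
    using twist cl(2) unfolding twisted_def by (blast intro: inj_on_subset)
  fix x y assume x: "x \<in> points X" and y: "y \<in> points Y"
  have tr: "smooth_transitions (product_atlas X Y) (product_atlas M N)"
    by (rule smooth_transitions_product)
      (use iX iY smooth_atlasD(1)[OF XA] smooth_atlasD(1)[OF YA] in \<open>auto simp: smooth_inclusion_def\<close>)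
  obtain W g where W: "(x, y) \<in> W" "C_fun_on 4 (product_atlas M N) W g"
    "\<forall>z\<in>W \<inter> ((manifold_topology M closure_of points X) \<times> (manifold_topology N closure_of points Y)).
       g z = (case z of (x, y) \<Rightarrow> c x y)"
    using c x y cl unfolding C_on_subset_def by blast
  show "C_near 4 (product_atlas X Y) (x, y) (\<lambda>(x, y). c x y)"
  proof (rule C_near_transfer[OF smooth_atlas_product[OF MA NA] smooth_atlas_product[OF XA YA] tr _ _ W(1,2)])
    show "g z = (case z of (x, y) \<Rightarrow> c x y)" if "z \<in> W" "z \<in> points (product_atlas X Y)" for z
      using W(3) that cl unfolding points_product_atlas by blast
  qed (use x y sub in \<open>auto simp: points_product_atlas\<close>)
qed (rule y0 nondeg conn red)+

theorem theorem3p9: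
  fixes X :: "('a, real ^ 'm::finite) atlas"
    and Y :: "('b, real ^ 'n::finite) atlas"
    and M :: "('a, 'p::euclidean_space) atlas"
    and N :: "('b, 'q::euclidean_space) atlas"
    and c :: "'a \<Rightarrow> 'b \<Rightarrow> real"
    and y\<^sub>0 :: 'b
    and b :: "'a set \<Rightarrow> 'b \<Rightarrow> real"
  assumes "CARD('m) \<ge> CARD('n)"
    and "smooth_manifold X" and "smooth_manifold Y"
    and "connected_space (manifold_topology Y)"
    and "smooth_manifold M" and "smooth_manifold N"
    and "smoothly_embedded X M" and "smoothly_embedded Y N"
    and "compactin (manifold_topology M) (manifold_topology M closure_of points X)"
    and "compactin (manifold_topology N) (manifold_topology N closure_of points Y)"
    and "C_on_subset 4 (product_atlas M N)
           ((manifold_topology M closure_of points X) \<times> (manifold_topology N closure_of points Y))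
           (\<lambda>(x, y). c x y)"
    and "twisted X (manifold_topology N closure_of points Y) c"
    and "nondegenerate X Y c"
    and "\<And>x y. x \<in> points X \<Longrightarrow> y \<in> points Y \<Longrightarrow>
           connectedin (manifold_topology X) (level_set X Y c x y)"
    and "\<And>x y y'. x \<in> points X \<Longrightarrow> y \<in> points Y \<Longrightarrow> y' \<in> points Y \<Longrightarrow>
           level_set X Y c x y = level_set X Y c x y'"
    and "y\<^sub>0 \<in> points Y"
    and "reduced_cost X Y c y\<^sub>0 b"
  shows "(A3S (quotient_atlas X Y c y\<^sub>0) Y b \<longleftrightarrow> A3S X Y c) \<and>
         (A3S X Y c \<longleftrightarrow>
            (\<forall>S :: ('a, real ^ 'n) atlas.
               smooth_manifold S \<and> smoothly_embedded S X \<and>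
               (\<forall>x\<in>points X. \<forall>p\<in>points S \<inter> level_set X Y c x y\<^sub>0.
                  transverse_at X (points S) (level_set X Y c x y\<^sub>0) p)
               \<longrightarrow> A3S S Y c))"
proof -
  interpret reduction X Y c y\<^sub>0 b
    by (rule reductionI[OF assms(2-8,11-13,16,17)])
  show ?thesis using A3S_quotient_iff A3S_surfaces_iff[OF assms(2)] by blast
qed

end
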